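(* Suppose $n\ge1$ and $m<\frac{n-2}{2}$. Let $B_R\subset\mathbb{R}^n$ be the ball of radius $R>0$ centered at zero and let $W$ be a Bessel potential on $(0,R)$. Then for all radial $u\in C_0^\infty(B_R)$ $$\int_{B_R}\frac{|\Delta u|^2}{|x|^{2m}}dx\ge\Big(\frac{n+2m}{2}\Big)^2\int_{B_R}\frac{|\nabla u|^2}{|x|^{2m+2}}dx+\beta(W;R)\int_{B_R}W(x)\frac{|\nabla u|^2}{|x|^{2m}}dx .$$ Moreover, $\big(\frac{n+2m}{2}\big)^2$ and $\beta(W;R)$ are the best constants.
   Context: A non-negative $C^1$ function $W$ on $(0,R)$ is a Bessel potential on $(0,R)$ if there is $c>0$ such that $y''+\frac1r y'+cW(r)y=0$ has a positive solution on $(0,R)$; its weight $\beta(W;R)$ is the supremum of all such $c$. One writes $W(x)=W(|x|)$. A constant in an inequality is best if it cannot be replaced by a larger one (the other constant being kept), here among radial functions in $C_0^\infty(B_R)$. *)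

theory Defs
  imports "HOL-Analysis.Analysis"
begin

definition bessel_ode :: "(real \<Rightarrow> real) \<Rightarrow> real \<Rightarrow> real \<Rightarrow> bool" where
  "bessel_ode W R c \<longleftrightarrow>
     (\<exists>y y' y''. \<forall>r\<in>{0<..<R}.
        (y has_real_derivative y' r) (at r) \<and>
        (y' has_real_derivative y'' r) (at r) \<and>
        y'' r + 1 / r * y' r + c * W r * y r = 0 \<and>
        y r > 0)"

definition bessel_potential :: "(real \<Rightarrow> real) \<Rightarrow> real \<Rightarrow> bool" where
  "bessel_potential W R \<longleftrightarrow>
     W C1_differentiable_on {0<..<R} \<and>
     (\<forall>r\<in>{0<..<R}. W r \<ge> 0) \<and>
     (\<exists>c>0. bessel_ode W R c)"

text \<open>The supremum is taken in the extended non-negative reals because it is infinite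
  when \<open>W\<close> vanishes identically on \<open>(0,R)\<close>.\<close>

definition bessel_weight :: "(real \<Rightarrow> real) \<Rightarrow> real \<Rightarrow> ennreal" where
  "bessel_weight W R = Sup {ennreal c |c. c > 0 \<and> bessel_ode W R c}"

definition dir_deriv :: "('a::euclidean_space \<Rightarrow> real) \<Rightarrow> 'a \<Rightarrow> 'a \<Rightarrow> real" where
  "dir_deriv u v x = frechet_derivative u (at x) v"

primrec C_k :: "nat \<Rightarrow> ('a::euclidean_space \<Rightarrow> real) \<Rightarrow> bool" where
  "C_k 0 u \<longleftrightarrow> continuous_on UNIV u"
| "C_k (Suc k) u \<longleftrightarrow> (\<forall>x. u differentiable at x) \<and> (\<forall>b\<in>Basis. C_k k (dir_deriv u b))"

definition grad :: "('a::euclidean_space \<Rightarrow> real) \<Rightarrow> 'a \<Rightarrow> 'a" where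
  "grad u x = (\<Sum>b\<in>Basis. dir_deriv u b x *\<^sub>R b)"

definition laplacian :: "('a::euclidean_space \<Rightarrow> real) \<Rightarrow> 'a \<Rightarrow> real" where
  "laplacian u x = (\<Sum>b\<in>Basis. dir_deriv (dir_deriv u b) b x)"

text \<open>Elements of \<open>C\<^sub>0\<^sup>\<infinity>(B\<^sub>R)\<close> are represented by their extensions by zero to the whole
  space, which are smooth there.\<close>

definition test_function :: "real \<Rightarrow> ('a::euclidean_space \<Rightarrow> real) \<Rightarrow> bool" where
  "test_function R u \<longleftrightarrow> (\<forall>k. C_k k u) \<and> closure {x. u x \<noteq> 0} \<subseteq> ball 0 R"

definition radial :: "('a::euclidean_space \<Rightarrow> real) \<Rightarrow> bool" where
  "radial u \<longleftrightarrow> (\<forall>x y. norm x = norm y \<longrightarrow> u x = u y)"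

text \<open>The integrals are integrals of non-negative functions, taken with values in the
  extended non-negative reals, so that no integrability needs to be presupposed (\<open>W\<close> may be
  unbounded near \<open>0\<close> and \<open>R\<close>). The integrands at the origin are junk values on a null set.\<close>

definition hardy_rellich_radial ::
    "'a::euclidean_space itself \<Rightarrow> real \<Rightarrow> real \<Rightarrow> (real \<Rightarrow> real) \<Rightarrow> ennreal \<Rightarrow> ennreal \<Rightarrow> bool" where
  "hardy_rellich_radial _ m R W A B \<longleftrightarrow>
     (\<forall>u :: 'a \<Rightarrow> real. test_function R u \<longrightarrow> radial u \<longrightarrow>
        (\<integral>\<^sup>+x\<in>ball 0 R. ennreal (\<bar>laplacian u x\<bar>\<^sup>2 / norm x powr (2 * m)) \<partial>lborel)
        \<ge> A * (\<integral>\<^sup>+x\<in>ball 0 R. ennreal ((norm (grad u x))\<^sup>2 / norm x powr (2 * m + 2)) \<partial>lborel)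
          + B * (\<integral>\<^sup>+x\<in>ball 0 R. ennreal (W (norm x) * ((norm (grad u x))\<^sup>2 / norm x powr (2 * m))) \<partial>lborel))"

end

theory Submission
  imports Defs
begin

text \<open>For a radial \<open>u(x) = \<phi>(\<bar>x\<bar>)\<close> put \<open>f = \<phi>'\<close>, so that \<open>\<bar>\<nabla>u\<bar> = \<bar>f\<bar>\<close> and \<open>\<Delta>u = f' + (n-1) f/r\<close>, and
  polar coordinates turn the inequality into a weighted one-dimensional one. If \<open>y > 0\<close> solves the
  Bessel equation for \<open>c\<close>, then \<open>p = y'/y\<close> solves the Riccati equation \<open>p' = - p/r - c W - p\<^sup>2\<close>,
  and completing the square with \<open>p\<close> writes the difference of the two sides (with \<open>c\<close> in place of
  \<open>\<beta>(W;R)\<close>) as a non-negative term plus a derivative. The boundary term at \<open>0\<close> is harmless because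
  \<open>r y'\<close> is decreasing and \<open>y > 0\<close> on all of \<open>(0,R)\<close>, which forces \<open>y' \<le> 0\<close>.

  For sharpness, an inequality with constants \<open>A\<close>, \<open>B\<close> amounts, with \<open>f = r\<^bsup>-(n-2-2m)/2\<^esup> g\<close>, to
  \<open>\<integral> r g'\<^sup>2 \<ge> (A - C) \<integral> g\<^sup>2/r + B \<integral> W r g\<^sup>2\<close> for compactly supported \<open>g\<close>, where \<open>C\<close> is the claimed
  constant. If \<open>\<integral> r g'\<^sup>2 \<ge> B \<integral> V r g\<^sup>2\<close> for all such \<open>g\<close>, then for \<open>c < B\<close> no solution of
  \<open>y'' + y'/r + c V y = 0\<close> has two zeros in \<open>(0,R)\<close>, and hence there is a positive one. With \<open>V = W\<close>
  this gives \<open>B \<le> \<beta>(W;R)\<close>; with \<open>V = 1/r\<^sup>2\<close>, for which no positive solution exists, it gives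
  \<open>A \<le> C\<close>.\<close>

section \<open>Smooth functions and a flat exponential\<close>

text \<open>The constant \<open>C\<close> is forced by the choice
  \<open>2 * \<alpha> = \<kappa> - 1\<close>: completing the square then leaves exactly
  \<open>(N - 1 - \<alpha>)\<^sup>2 = C\<close> in front of \<open>f\<^sup>2 / r\<^sup>2\<close>.
  The hypothesis on \<open>m\<close> says \<open>\<kappa> - 1 > 0\<close>, so a bounded profile
  leaves no contribution at the origin. Since the weight is defined through positive solutions,
  sharpness becomes a question of oscillation and needs no explicit minimising sequence. Two
  obstacles shape it. A solution cut off at two of its zeros has corners there; a power of it with
  exponent \<open>1 + e\<close> is C^1 and loses only a factor that tends to 1 with
  \<open>e\<close>. This costs the strict inequality c < B, which a supremum tolerates. Moreover,
  the inequality is given only for functions smooth on the whole space, whereas a solution has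
  limited regularity; it is therefore first extended to C^1 profiles with compact support in (0,R),
  where all weights are bounded. Finally, solutions must exist on the whole open interval although
  the coefficients may blow up at both ends, which linearity permits.\<close>

lemma DERIV_eventually_eq:
  fixes f g :: "real \<Rightarrow> real"
  assumes "eventually (\<lambda>s. f s = g s) (nhds x)" "(g has_real_derivative d) (at x)"
  shows "(f has_real_derivative d) (at x)"
  using DERIV_cong_ev[OF refl assms(1) refl] assms(2) by blast

lemma dir_deriv_eq:
  assumes "(u has_derivative D) (at x)"
  shows "dir_deriv u v x = D v"
  unfolding dir_deriv_def using frechet_derivative_at[OF assms] by simp

lemma C_k_SucD: "C_k (Suc k) u \<Longrightarrow> C_k k u"
proof (induction k arbitrary: u)
  case 0
  then show ?case
    by (auto simp: continuous_on_eq_continuous_at intro: differentiable_imp_continuous_within)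
next
  case (Suc k)
  then show ?case by (metis C_k.simps(2))
qed

lemma C_k_const: "C_k k (\<lambda>x. c)"
proof (induction k arbitrary: c)
  case (Suc k)
  have "dir_deriv (\<lambda>x::'a. c) b = (\<lambda>x. 0)" for b
    by (rule ext, rule dir_deriv_eq) auto
  with Suc show ?case by simp
qed simp

lemma C_k_add: "C_k k u \<Longrightarrow> C_k k v \<Longrightarrow> C_k k (\<lambda>x. u x + v x)"
proof (induction k arbitrary: u v)
  case 0 then show ?case by (auto intro: continuous_on_add)
next
  case (Suc k)
  have "dir_deriv (\<lambda>x. u x + v x) b = (\<lambda>x. dir_deriv u b x + dir_deriv v b x)" for b
  proof
    fix x
    have "(u has_derivative frechet_derivative u (at x)) (at x)"
      "(v has_derivative frechet_derivative v (at x)) (at x)"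
      using Suc.prems by (auto simp: frechet_derivative_works[symmetric])
    from has_derivative_add[OF this] show "dir_deriv (\<lambda>x. u x + v x) b x = dir_deriv u b x + dir_deriv v b x"
      by (subst dir_deriv_eq) (auto simp: dir_deriv_def)
  qed
  with Suc show ?case by simp
qed

lemma C_k_mult: "C_k k u \<Longrightarrow> C_k k v \<Longrightarrow> C_k k (\<lambda>x. u x * v x)"
proof (induction k arbitrary: u v)
  case 0 then show ?case by (auto intro: continuous_on_mult)
next
  case (Suc k)
  have "dir_deriv (\<lambda>x. u x * v x) b = (\<lambda>x. u x * dir_deriv v b x + dir_deriv u b x * v x)" for b
  proof
    fix x
    have "(u has_derivative frechet_derivative u (at x)) (at x)"
      "(v has_derivative frechet_derivative v (at x)) (at x)"
      using Suc.prems by (auto simp: frechet_derivative_works[symmetric])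
    from has_derivative_mult[OF this]
    show "dir_deriv (\<lambda>x. u x * v x) b x = u x * dir_deriv v b x + dir_deriv u b x * v x"
      by (subst dir_deriv_eq) (auto simp: dir_deriv_def)
  qed
  moreover have "C_k k u" "C_k k v" using Suc.prems by (blast intro: C_k_SucD)+
  ultimately show ?case using Suc.prems Suc.IH by (auto intro!: C_k_add)
qed

text \<open>By the chain rule the derivative is a product whose first factor,
  \<open>dir_deriv h 1 (u x)\<close>, is again a composition with the same \<open>u\<close>. The
  induction therefore runs over all outer functions at once.\<close>

lemma C_k_compose:
  fixes h :: "real \<Rightarrow> real"
  shows "C_k k h \<Longrightarrow> C_k k u \<Longrightarrow> C_k k (\<lambda>x. h (u x))"
proof (induction k arbitrary: h u)
  case 0 then show ?case by (auto intro: continuous_on_compose2)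
next
  case (Suc k)
  have *: "((\<lambda>x. h (u x)) has_derivative (\<lambda>v. dir_deriv h 1 (u x) * dir_deriv u v x)) (at x)" for x
  proof -
    have "(u has_derivative frechet_derivative u (at x)) (at x)"
      "(h has_derivative frechet_derivative h (at (u x))) (at (u x))"
      using Suc.prems by (auto simp: frechet_derivative_works[symmetric])
    from has_derivative_compose[OF this]
    have hd: "((\<lambda>x. h (u x)) has_derivative (\<lambda>v. frechet_derivative h (at (u x)) (frechet_derivative u (at x) v))) (at x)" .
    have lin: "frechet_derivative h (at (u x)) w = frechet_derivative h (at (u x)) 1 * w" for w
    proof -
      have "linear (frechet_derivative h (at (u x)))"
        using Suc.prems by (intro linear_frechet_derivative) auto
      from linear_cmul[OF this, of w 1] show ?thesis by (simp add: mult.commute)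
    qed
    have "(\<lambda>v. frechet_derivative h (at (u x)) (frechet_derivative u (at x) v)) =
        (\<lambda>v. dir_deriv h 1 (u x) * dir_deriv u v x)"
      unfolding dir_deriv_def by (rule ext) (rule lin)
    with hd show ?thesis by (simp only:)
  qed
  have "dir_deriv (\<lambda>x. h (u x)) b = (\<lambda>x. dir_deriv h 1 (u x) * dir_deriv u b x)" for b
    by (rule ext, rule dir_deriv_eq, rule *)
  moreover have "(\<lambda>x. h (u x)) differentiable at x" for x
    unfolding differentiable_def using * by blast
  moreover have "C_k k (\<lambda>x. dir_deriv h 1 (u x) * dir_deriv u b x)" if "b \<in> Basis" for b
  proof (rule C_k_mult)
    show "C_k k (\<lambda>x. dir_deriv h 1 (u x))"
      by (rule Suc.IH[of "dir_deriv h 1" u]) (use Suc.prems in \<open>auto intro: C_k_SucD\<close>)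
    show "C_k k (dir_deriv u b)" using Suc.prems that by simp
  qed
  ultimately show ?case by simp
qed

lemma C_k_linear:
  assumes "bounded_linear u" shows "C_k k u"
proof (cases k)
  case 0 then show ?thesis by (simp add: linear_continuous_on assms)
next
  case (Suc j)
  have "(u has_derivative u) (at x)" for x
    using assms by (rule bounded_linear_imp_has_derivative)
  then have "u differentiable at x" "dir_deriv u b = (\<lambda>x. u b)" for x b
    by (auto simp: differentiable_def fun_eq_iff dir_deriv_eq)
  then show ?thesis using Suc by (auto intro: C_k_const)
qed

lemma dir_deriv_real:
  fixes h :: "real \<Rightarrow> real"
  assumes "(h has_real_derivative d) (at x)"
  shows "dir_deriv h 1 x = d"
  using dir_deriv_eq[of h "(*) d" x 1] assms by (simp add: has_field_derivative_def)

text \<open>Lets a smooth function be prescribed through its derivative, as happens twice in the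
  construction of the approximating test functions.\<close>

lemma C_k_antiderivative:
  fixes h :: "real \<Rightarrow> real"
  assumes "\<And>x. (H has_real_derivative h x) (at x)" "\<And>k. C_k k h"
  shows "C_k k H"
proof (cases k)
  case 0
  then show ?thesis using assms
    by (auto simp: continuous_on_eq_continuous_at intro: DERIV_isCont)
next
  case (Suc j)
  have "dir_deriv H 1 = h" using assms by (auto intro: dir_deriv_real)
  moreover have "H differentiable at x" for x
    using assms(1)[of x] by (auto simp: real_differentiable_def)
  ultimately show ?thesis using Suc assms(2) by auto
qed

lemma C_k_inner_self: "C_k k (\<lambda>x::'a::euclidean_space. x \<bullet> x)"
proof -
  have "(\<lambda>x::'a. x \<bullet> x) = (\<lambda>x. \<Sum>b\<in>Basis. (x \<bullet> b) * (x \<bullet> b))"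
    by (rule ext) (rule euclidean_inner)
  moreover have "C_k k (\<lambda>x::'a. \<Sum>b\<in>S. (x \<bullet> b) * (x \<bullet> b))" if "finite S" for S
    using that
  proof induction
    case empty show ?case by (simp add: C_k_const)
  next
    case (insert b S)
    have "C_k k (\<lambda>x. x \<bullet> b)" by (intro C_k_linear bounded_linear_inner_left)
    with insert show ?case by (simp add: C_k_add C_k_mult)
  qed
  ultimately show ?thesis by simp
qed

lemma C_k_polynomial:
  fixes P :: "real \<Rightarrow> real"
  assumes "real_polynomial_function P"
  shows "C_k k P"
  using assms
proof induction
  case (linear f) then show ?case by (rule C_k_linear)
next
  case (const c) show ?case by (rule C_k_const)
next
  case (add f g) from add.IH show ?case by (rule C_k_add)
next
  case (mult f g) from mult.IH show ?case by (rule C_k_mult)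
qed

text \<open>The classical flat function (\<open>j = 0\<close>) together with its multiples by
  negative powers of \<open>x\<close>. The span of this family is closed under differentiation, so
  one induction proves all members smooth.\<close>

definition flat_exp :: "nat \<Rightarrow> real \<Rightarrow> real" where
  "flat_exp j x = (if x > 0 then (1 / x) ^ j * exp (- (1 / x)) else 0)"

lemma flat_exp_tendsto_0: "((\<lambda>x. (1 / x) ^ j * exp (- (1 / x))) \<longlongrightarrow> 0) (at_right (0::real))"
proof -
  have "((\<lambda>x::real. x ^ j / exp x) \<longlongrightarrow> 0) at_top" by (rule tendsto_power_div_exp_0)
  then have "((\<lambda>x::real. inverse x ^ j / exp (inverse x)) \<longlongrightarrow> 0) (at_right 0)"
    by (simp add: filterlim_at_top_to_right)
  then show ?thesis by (simp add: exp_minus divide_simps)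
qed

lemma flat_exp_deriv:
  "(flat_exp j has_real_derivative (- real j * flat_exp (Suc j) x + flat_exp (j + 2) x)) (at x)"
proof -
  consider "x < 0" | "x > 0" | "x = 0" by linarith
  then show ?thesis
  proof cases
    case 1
    have "((\<lambda>x. 0) has_real_derivative 0) (at x)" by simp
    moreover have "eventually (\<lambda>y. y < 0) (nhds x)" using 1 by (auto intro: eventually_nhds_in_open[of "{..<0}", simplified])
    then have "eventually (\<lambda>y. flat_exp j y = 0) (nhds x)"
      by eventually_elim (simp add: flat_exp_def)
    ultimately have "(flat_exp j has_real_derivative 0) (at x)"
      by (rule DERIV_eventually_eq[rotated])
    then show ?thesis using 1 by (simp add: flat_exp_def)
  next
    case 2
    have "((\<lambda>x. (1 / x) ^ j * exp (- (1 / x))) has_real_derivative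
        (- real j * ((1 / x) ^ Suc j * exp (- (1 / x))) + (1 / x) ^ (j + 2) * exp (- (1 / x)))) (at x)"
    proof -
      have "((\<lambda>t. t ^ j * exp (- t)) has_real_derivative
          (real j * t ^ (j - 1) * exp (- t) - t ^ j * exp (- t))) (at t)" for t :: real
        by (auto intro!: derivative_eq_intros)
      moreover have "((\<lambda>x. 1 / x) has_real_derivative - ((1 / x) ^ 2)) (at x)"
        using 2 by (auto intro!: derivative_eq_intros simp: power2_eq_square)
      ultimately have "((\<lambda>x. (1 / x) ^ j * exp (- (1 / x))) has_real_derivative
          (real j * (1 / x) ^ (j - 1) * exp (- (1 / x)) - (1 / x) ^ j * exp (- (1 / x))) * - ((1 / x) ^ 2)) (at x)"
        by (rule DERIV_chain2)
      also have "(real j * (1 / x) ^ (j - 1) * exp (- (1 / x)) - (1 / x) ^ j * exp (- (1 / x))) * - ((1 / x) ^ 2)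
          = - real j * ((1 / x) ^ Suc j * exp (- (1 / x))) + (1 / x) ^ (j + 2) * exp (- (1 / x))"
      proof -
        \<comment> \<open>For \<open>j = 0\<close> the truncated exponent \<open>j - 1\<close> is
          harmless because its coefficient \<open>real j\<close> vanishes.\<close>
        have "(real j * i ^ (j - 1) * E - i ^ j * E) * - (i ^ 2) = - real j * (i ^ Suc j * E) + i ^ (j + 2) * E"
          for i E :: real
          by (cases j) (simp_all add: algebra_simps power2_eq_square)
        then show ?thesis .
      qed
      finally show ?thesis .
    qed
    moreover have "eventually (\<lambda>y. y > 0) (nhds x)" using 2 by (auto intro: eventually_nhds_in_open[of "{0<..}", simplified])
    then have "eventually (\<lambda>y. flat_exp j y = (1 / y) ^ j * exp (- (1 / y))) (nhds x)"
      by eventually_elim (simp add: flat_exp_def)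
    ultimately have "(flat_exp j has_real_derivative
        (- real j * ((1 / x) ^ Suc j * exp (- (1 / x))) + (1 / x) ^ (j + 2) * exp (- (1 / x)))) (at x)"
      by (rule DERIV_eventually_eq[rotated])
    then show ?thesis using 2 by (simp add: flat_exp_def)
  next
    case 3
    have l: "((\<lambda>y. (flat_exp j y - flat_exp j 0) / (y - 0)) \<longlongrightarrow> 0) (at_left 0)"
      by (rule tendsto_eventually) (auto simp: eventually_at_filter flat_exp_def)
    \<comment> \<open>Dividing by \<open>y\<close> supplies one more factor \<open>1 / y\<close>, so
      the difference quotient is the function with index \<open>Suc j\<close>.\<close>
    have r: "((\<lambda>y. (flat_exp j y - flat_exp j 0) / (y - 0)) \<longlongrightarrow> 0) (at_right 0)"
    proof (rule Lim_transform_eventually[OF flat_exp_tendsto_0[of "Suc j"]])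
      show "\<forall>\<^sub>F y in at_right 0. (1 / y) ^ Suc j * exp (- (1 / y)) = (flat_exp j y - flat_exp j 0) / (y - 0)"
        by (auto simp: eventually_at_filter flat_exp_def)
    qed
    from filterlim_split_at[OF l r] show ?thesis using 3
      by (simp add: has_field_derivative_iff flat_exp_def)
  qed
qed

lemma C_k_flat_exp: "C_k k (flat_exp j)"
proof (induction k arbitrary: j)
  case 0
  then show ?case using flat_exp_deriv
    by (auto simp: continuous_on_eq_continuous_at intro: DERIV_isCont)
next
  case (Suc k)
  have "dir_deriv (flat_exp j) 1 = (\<lambda>x. - real j * flat_exp (Suc j) x + flat_exp (j + 2) x)"
    by (rule ext, rule dir_deriv_real, rule flat_exp_deriv)
  moreover have "flat_exp j differentiable at x" for x
    using flat_exp_deriv[of j x] by (auto simp: real_differentiable_def)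
  moreover have "C_k k (\<lambda>x. - real j * flat_exp (Suc j) x + flat_exp (j + 2) x)"
    by (intro C_k_add C_k_mult C_k_const Suc)
  ultimately show ?case by simp
qed

section \<open>Linear systems of two differential equations\<close>

lemma antiderivative_on_interval:
  fixes f :: "real \<Rightarrow> real"
  assumes "continuous_on {l<..<h} f" "t0 \<in> {l<..<h}"
  shows "\<exists>F. F t0 = 0 \<and> (\<forall>t\<in>{l<..<h}. (F has_real_derivative f t) (at t))"
proof -
  have "\<exists>F. \<forall>x::real. ereal l < x \<longrightarrow> x < ereal h \<longrightarrow> (F has_vector_derivative f x) (at x)"
    using assms by (intro einterval_antiderivative)
      (auto simp: continuous_on_eq_continuous_at)
  then obtain F where F: "\<And>t. t \<in> {l<..<h} \<Longrightarrow> (F has_real_derivative f t) (at t)"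
    by (auto simp: has_real_derivative_iff_has_vector_derivative)
  show ?thesis
    by (rule exI[of _ "\<lambda>t. F t - F t0"]) (auto intro!: derivative_eq_intros F)
qed

text \<open>\<open>F\<close> is compared with the primitive of the bound on the right of
  \<open>t0\<close>, and by reflection on the left. This is the inductive step for the factorial
  decay of the Picard terms; \<open>j = 0\<close> gives the usual mean value estimate.\<close>

lemma power_bound_antiderivative:
  fixes F f :: "real \<Rightarrow> real"
  assumes d: "\<And>s. s \<in> {p..q} \<Longrightarrow> (F has_real_derivative f s) (at s)"
    and b: "\<And>s. s \<in> {p..q} \<Longrightarrow> \<bar>f s\<bar> \<le> K * \<bar>s - t0\<bar> ^ j"
    and t: "t0 \<in> {p..q}" "t \<in> {p..q}" and "F t0 = 0"
  shows "\<bar>F t\<bar> \<le> K * \<bar>t - t0\<bar> ^ Suc j / Suc j"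
proof -
  have main: "\<bar>G x\<bar> \<le> K * x ^ Suc j / Suc j"
    if "x \<ge> 0" "\<And>s. s \<in> {0..x} \<Longrightarrow> (G has_real_derivative g s) (at s)" "\<And>s. s \<in> {0..x} \<Longrightarrow> \<bar>g s\<bar> \<le> K * s ^ j" "G 0 = 0"
    for G g :: "real \<Rightarrow> real" and x
  proof -
    have P: "((\<lambda>s. K * s ^ Suc j / Suc j) has_real_derivative K * s ^ j) (at s)" for s
      by (auto intro!: derivative_eq_intros simp del: power_Suc)
    have "(\<lambda>s. K * s ^ Suc j / Suc j - G s) 0 \<le> (\<lambda>s. K * s ^ Suc j / Suc j - G s) x"
    proof (rule DERIV_nonneg_imp_nondecreasing[OF \<open>x \<ge> 0\<close>])
      fix s assume "0 \<le> s" "s \<le> x"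
      then show "\<exists>y. ((\<lambda>s. K * s ^ Suc j / Suc j - G s) has_real_derivative y) (at s) \<and> 0 \<le> y"
        using DERIV_diff[OF P that(2), of s] that(3)[of s] by (intro exI[of _ "K * s ^ j - g s"]) auto
    qed
    moreover have "(\<lambda>s. K * s ^ Suc j / Suc j + G s) 0 \<le> (\<lambda>s. K * s ^ Suc j / Suc j + G s) x"
    proof (rule DERIV_nonneg_imp_nondecreasing[OF \<open>x \<ge> 0\<close>])
      fix s assume "0 \<le> s" "s \<le> x"
      then show "\<exists>y. ((\<lambda>s. K * s ^ Suc j / Suc j + G s) has_real_derivative y) (at s) \<and> 0 \<le> y"
        using DERIV_add[OF P that(2), of s] that(3)[of s] by (intro exI[of _ "K * s ^ j + g s"]) auto
    qed
    ultimately show ?thesis using \<open>G 0 = 0\<close> by (simp add: abs_le_iff)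
  qed
  show ?thesis
  proof (cases "t \<ge> t0")
    case True
    have "\<bar>F (t0 + (t - t0))\<bar> \<le> K * (t - t0) ^ Suc j / Suc j"
    proof (rule main[where g = "\<lambda>s. f (t0 + s)"])
      fix s assume s: "s \<in> {0..t - t0}"
      have "((\<lambda>s. F (t0 + s)) has_real_derivative f (t0 + s) * 1) (at s)"
        using s t by (intro DERIV_chain2[where f=F] d) (auto intro!: derivative_eq_intros)
      then show "((\<lambda>s. F (t0 + s)) has_real_derivative f (t0 + s)) (at s)" by simp
      show "\<bar>f (t0 + s)\<bar> \<le> K * s ^ j" using b[of "t0 + s"] s t by auto
    qed (use True assms in auto)
    then show ?thesis using True by simp
  next
    case False
    have "\<bar>F (t0 - (t0 - t))\<bar> \<le> K * (t0 - t) ^ Suc j / Suc j"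
    proof (rule main[where g = "\<lambda>s. - f (t0 - s)"])
      fix s assume s: "s \<in> {0..t0 - t}"
      have "((\<lambda>s. F (t0 - s)) has_real_derivative f (t0 - s) * (-1)) (at s)"
        using s t by (intro DERIV_chain2[where f=F] d) (auto intro!: derivative_eq_intros)
      then show "((\<lambda>s. F (t0 - s)) has_real_derivative - f (t0 - s)) (at s)" by simp
      show "\<bar>- f (t0 - s)\<bar> \<le> K * s ^ j" using b[of "t0 - s"] s t by auto
    qed (use False assms in auto)
    then show ?thesis using False by simp
  qed
qed

text \<open>The choice operator turns taking a primitive into a total operation, so that the Picard
  terms can be defined by primitive recursion. It is meaningful when \<open>f\<close> is continuous
  on the interval and \<open>t0\<close> lies in it.\<close>

definition antiderivative :: "real \<Rightarrow> real \<Rightarrow> real \<Rightarrow> (real \<Rightarrow> real) \<Rightarrow> real \<Rightarrow> real" where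
  "antiderivative l h t0 f = (SOME F. F t0 = 0 \<and> (\<forall>t\<in>{l<..<h}. (F has_real_derivative f t) (at t)))"

lemma antiderivative:
  assumes "continuous_on {l<..<h} f" "t0 \<in> {l<..<h}"
  shows "antiderivative l h t0 f t0 = 0"
    and "t \<in> {l<..<h} \<Longrightarrow> (antiderivative l h t0 f has_real_derivative f t) (at t)"
  using someI_ex[OF antiderivative_on_interval[OF assms]] unfolding antiderivative_def by auto

text \<open>Picard iteration for \<open>y' = a z\<close>, \<open>z' = b y\<close>: the \<open>j\<close>-th terms of the series for \<open>y\<close> and \<open>z\<close>.\<close>

primrec picard_term :: "real \<Rightarrow> real \<Rightarrow> real \<Rightarrow> (real \<Rightarrow> real) \<Rightarrow> (real \<Rightarrow> real) \<Rightarrow> real \<Rightarrow> real \<Rightarrow> nat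
    \<Rightarrow> (real \<Rightarrow> real) \<times> (real \<Rightarrow> real)" where
  "picard_term l h t0 a b y0 z0 0 = (\<lambda>_. y0, \<lambda>_. z0)"
| "picard_term l h t0 a b y0 z0 (Suc j) =
    (antiderivative l h t0 (\<lambda>t. a t * snd (picard_term l h t0 a b y0 z0 j) t),
     antiderivative l h t0 (\<lambda>t. b t * fst (picard_term l h t0 a b y0 z0 j) t))"

text \<open>A solution exists on the whole open interval although \<open>a\<close> and
  \<open>b\<close> may be unbounded near its ends: the Picard terms do not depend on a subinterval,
  and by linearity their series converges uniformly on every compact one containing
  \<open>t0\<close>.\<close>

lemma linear_system_solution:
  fixes a b :: "real \<Rightarrow> real"
  assumes a: "continuous_on {l<..<h} a" and b: "continuous_on {l<..<h} b" and t0: "t0 \<in> {l<..<h}"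
  obtains y z where "y t0 = y0" "z t0 = z0"
    "\<And>t. t \<in> {l<..<h} \<Longrightarrow> (y has_real_derivative a t * z t) (at t)"
    "\<And>t. t \<in> {l<..<h} \<Longrightarrow> (z has_real_derivative b t * y t) (at t)"
proof -
  define Y Z where "Y j = fst (picard_term l h t0 a b y0 z0 j)"
    and "Z j = snd (picard_term l h t0 a b y0 z0 j)" for j
  define Y' Z' where "Y' j = (case j of 0 \<Rightarrow> (\<lambda>_. 0) | Suc i \<Rightarrow> (\<lambda>t. a t * Z i t))"
    and "Z' j = (case j of 0 \<Rightarrow> (\<lambda>_. 0) | Suc i \<Rightarrow> (\<lambda>t. b t * Y i t))" for j
  have c: "continuous_on {l<..<h} (Y j) \<and> continuous_on {l<..<h} (Z j)" for j
  proof (induction j)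
    case (Suc j)
    have "isCont (Y (Suc j)) t" "isCont (Z (Suc j)) t" if "t \<in> {l<..<h}" for t
      unfolding Y_def Z_def picard_term.simps fst_conv snd_conv
      using Suc a b t0 that
      by (auto intro!: DERIV_isCont antiderivative continuous_on_mult simp: Y_def Z_def)
    then show ?case by (simp add: continuous_at_imp_continuous_on)
  qed (simp add: Y_def Z_def)
  have init: "Y 0 = (\<lambda>_. y0)" "Z 0 = (\<lambda>_. z0)" "Y (Suc j) t0 = 0" "Z (Suc j) t0 = 0" for j
    using antiderivative(1)[OF continuous_on_mult[OF a] t0] antiderivative(1)[OF continuous_on_mult[OF b] t0] c
    by (auto simp: Y_def Z_def)
  have dY: "(Y j has_real_derivative Y' j t) (at t)" and dZ: "(Z j has_real_derivative Z' j t) (at t)"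
    if "t \<in> {l<..<h}" for j t
    using antiderivative(2)[OF continuous_on_mult[OF a, of "Z (j - 1)"] t0 that]
      antiderivative(2)[OF continuous_on_mult[OF b, of "Y (j - 1)"] t0 that] c
    by (cases j; simp add: Y_def Z_def Y'_def Z'_def)+
  have key: "summable (\<lambda>j. Y j t) \<and> summable (\<lambda>j. Z j t) \<and>
    ((\<lambda>x. \<Sum>j. Y j x) has_real_derivative (\<Sum>j. Y' j t)) (at t) \<and>
    ((\<lambda>x. \<Sum>j. Z j x) has_real_derivative (\<Sum>j. Z' j t)) (at t)"
    if t: "t \<in> {l<..<h}" for t
  proof -
    \<comment> \<open>A compact interval inside the domain with both \<open>t\<close> and
      \<open>t0\<close> in its interior; the coefficients are bounded on it.\<close>
    define p q where "p = (l + min t t0) / 2" and "q = (h + max t t0) / 2"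
    have pq: "l < p" "p < t" "p < t0" "t < q" "t0 < q" "q < h"
      using t t0 by (auto simp: p_def q_def greaterThanLessThan_iff)
    have sub: "{p..q} \<subseteq> {l<..<h}" using pq by (auto simp: greaterThanLessThan_iff)
    have "compact (a ` {p..q} \<union> b ` {p..q})"
      using a b sub by (intro compact_Un compact_continuous_image) (auto intro: continuous_on_subset)
    then obtain L0 where "\<forall>x\<in>a ` {p..q} \<union> b ` {p..q}. norm x \<le> L0"
      using compact_imp_bounded[THEN bounded_iff[THEN iffD1]] by fast
    then have L0: "\<And>s. s \<in> {p..q} \<Longrightarrow> \<bar>a s\<bar> \<le> L0 \<and> \<bar>b s\<bar> \<le> L0" by auto
    define L where "L = max L0 0"
    have L: "\<And>s. s \<in> {p..q} \<Longrightarrow> \<bar>a s\<bar> \<le> L \<and> \<bar>b s\<bar> \<le> L" "L \<ge> 0"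
      using L0 by (force simp: L_def)+
    define M where "M = max \<bar>y0\<bar> \<bar>z0\<bar>"
    have M: "M \<ge> 0" by (simp add: M_def)
    \<comment> \<open>Each of the \<open>j\<close> integrations from \<open>t0\<close> contributes a
      factor \<open>L\<close> and raises the power of the distance by one; this produces the
      factorial.\<close>
    have bd: "\<forall>s\<in>{p..q}. \<bar>Y j s\<bar> \<le> M * (L * \<bar>s - t0\<bar>) ^ j / fact j \<and> \<bar>Z j s\<bar> \<le> M * (L * \<bar>s - t0\<bar>) ^ j / fact j" for j
    proof (induction j)
      case 0 show ?case by (simp add: init M_def)
    next
      case (Suc j)
      have *: "\<bar>Y (Suc j) s\<bar> \<le> (M * L ^ Suc j / fact j) * \<bar>s - t0\<bar> ^ Suc j / Suc j"
              "\<bar>Z (Suc j) s\<bar> \<le> (M * L ^ Suc j / fact j) * \<bar>s - t0\<bar> ^ Suc j / Suc j" if s: "s \<in> {p..q}" for s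
      proof -
        have "\<bar>Y' (Suc j) r\<bar> \<le> (M * L ^ Suc j / fact j) * \<bar>r - t0\<bar> ^ j"
             "\<bar>Z' (Suc j) r\<bar> \<le> (M * L ^ Suc j / fact j) * \<bar>r - t0\<bar> ^ j" if "r \<in> {p..q}" for r
        proof -
          have "\<bar>a r\<bar> * \<bar>Z j r\<bar> \<le> L * (M * (L * \<bar>r - t0\<bar>) ^ j / fact j)"
               "\<bar>b r\<bar> * \<bar>Y j r\<bar> \<le> L * (M * (L * \<bar>r - t0\<bar>) ^ j / fact j)"
            using bspec[OF Suc that] L(1)[OF that] L(2) by (blast intro: mult_mono abs_ge_zero)+
          then show "\<bar>Y' (Suc j) r\<bar> \<le> (M * L ^ Suc j / fact j) * \<bar>r - t0\<bar> ^ j"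
             "\<bar>Z' (Suc j) r\<bar> \<le> (M * L ^ Suc j / fact j) * \<bar>r - t0\<bar> ^ j"
            by (simp_all add: Y'_def Z'_def abs_mult power_mult_distrib mult_ac)
        qed
        note bds = this
        have t0p: "t0 \<in> {p..q}" using pq by simp
        show "\<bar>Y (Suc j) s\<bar> \<le> (M * L ^ Suc j / fact j) * \<bar>s - t0\<bar> ^ Suc j / Suc j"
          using sub by (intro power_bound_antiderivative[OF dY bds(1) t0p s init(3)]) auto
        show "\<bar>Z (Suc j) s\<bar> \<le> (M * L ^ Suc j / fact j) * \<bar>s - t0\<bar> ^ Suc j / Suc j"
          using sub by (intro power_bound_antiderivative[OF dZ bds(2) t0p s init(4)]) auto
      qed
      moreover have "(M * L ^ Suc j / fact j) * \<bar>s - t0\<bar> ^ Suc j / Suc j = M * (L * \<bar>s - t0\<bar>) ^ Suc j / fact (Suc j)" for s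
        by (simp add: power_mult_distrib field_simps del: power_Suc)
      ultimately show ?case by metis
    qed
    have bd': "\<bar>Y j s\<bar> \<le> M * (L * (q - p)) ^ j / fact j" "\<bar>Z j s\<bar> \<le> M * (L * (q - p)) ^ j / fact j" if "s \<in> {p..q}" for s j
    proof -
      have "M * (L * \<bar>s - t0\<bar>) ^ j / fact j \<le> M * (L * (q - p)) ^ j / fact j"
        using that pq L M by (intro divide_right_mono mult_left_mono power_mono) auto
      then show "\<bar>Y j s\<bar> \<le> M * (L * (q - p)) ^ j / fact j" "\<bar>Z j s\<bar> \<le> M * (L * (q - p)) ^ j / fact j"
        using bd[of j] that by force+
    qed
    define S where "S j = M * (L * (q - p)) ^ j / fact j" for j
    have "summable (\<lambda>j. M * (inverse (fact j) * (L * (q - p)) ^ j))"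
      by (intro summable_mult summable_exp)
    then have S: "summable S" by (simp add: S_def[abs_def] field_simps)
    \<comment> \<open>Majorant of the derivatives: a derivative is a coefficient times the preceding
      term, hence the shifted index.\<close>
    define S' where "S' j = (case j of 0 \<Rightarrow> 0 | Suc i \<Rightarrow> L * S i)" for j
    have "summable (\<lambda>j. S' (Suc j))" by (simp add: S'_def S summable_mult)
    then have S': "summable S'" by (subst (asm) summable_Suc_iff)
    have bdd: "\<bar>Y' j s\<bar> \<le> S' j" "\<bar>Z' j s\<bar> \<le> S' j" if "s \<in> {p..q}" for s j
    proof (atomize (full), cases j)
      case (Suc i)
      have "\<bar>a s\<bar> * \<bar>Z i s\<bar> \<le> L * S i" "\<bar>b s\<bar> * \<bar>Y i s\<bar> \<le> L * S i"
        using bd'[OF that, of i, folded S_def] L(1)[OF that] L(2) by (blast intro: mult_mono abs_ge_zero)+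
      then show "\<bar>Y' j s\<bar> \<le> S' j \<and> \<bar>Z' j s\<bar> \<le> S' j"
        by (simp add: Suc Y'_def Z'_def S'_def abs_mult)
    qed (simp add: Y'_def Z'_def S'_def)
    have u: "uniformly_convergent_on {p..q} (\<lambda>n x. \<Sum>i<n. Y' i x)"
            "uniformly_convergent_on {p..q} (\<lambda>n x. \<Sum>i<n. Z' i x)"
      using bdd by (intro Weierstrass_m_test'[OF _ S']; simp)+
    have s: "summable (\<lambda>j. Y j t)" "summable (\<lambda>j. Z j t)"
      using pq bd'[of t] by (intro summable_comparison_test'[OF S, of 0]; simp add: S_def)+
    have i: "t \<in> interior {p..q}" "t \<in> {p..q}" using pq by (auto simp: greaterThanLessThan_iff)
    have "((\<lambda>x. \<Sum>j. Y j x) has_real_derivative (\<Sum>j. Y' j t)) (at t)"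
      using sub by (intro has_field_derivative_series'(2)[of "{p..q}" Y Y', OF _ _ u(1) i(2) s(1) i(1)] has_field_derivative_at_within[OF dY]) auto
    moreover have "((\<lambda>x. \<Sum>j. Z j x) has_real_derivative (\<Sum>j. Z' j t)) (at t)"
      using sub by (intro has_field_derivative_series'(2)[of "{p..q}" Z Z', OF _ _ u(2) i(2) s(2) i(1)] has_field_derivative_at_within[OF dZ]) auto
    ultimately show ?thesis using s by simp
  qed
  have shift: "(\<Sum>j. Y' j t) = a t * (\<Sum>j. Z j t)" "(\<Sum>j. Z' j t) = b t * (\<Sum>j. Y j t)"
    if "t \<in> {l<..<h}" for t
  proof -
    have "summable (\<lambda>j. Y' (Suc j) t)" "summable (\<lambda>j. Z' (Suc j) t)"
      using key[OF that] by (auto simp: Y'_def Z'_def summable_mult)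
    then have "summable (\<lambda>j. Y' j t)" "summable (\<lambda>j. Z' j t)"
      using summable_Suc_iff[of "\<lambda>j. Y' j t"] summable_Suc_iff[of "\<lambda>j. Z' j t"] by blast+
    from this[THEN suminf_split_head]
    have "(\<Sum>j. Y' j t) = (\<Sum>j. Y' (Suc j) t)" "(\<Sum>j. Z' j t) = (\<Sum>j. Z' (Suc j) t)"
      by (simp_all add: Y'_def Z'_def)
    then show "(\<Sum>j. Y' j t) = a t * (\<Sum>j. Z j t)" "(\<Sum>j. Z' j t) = b t * (\<Sum>j. Y j t)"
      using key[OF that] by (simp_all add: Y'_def Z'_def suminf_mult)
  qed
  have "(\<lambda>j. Y j t0) = (\<lambda>j. if j = 0 then y0 else 0)" "(\<lambda>j. Z j t0) = (\<lambda>j. if j = 0 then z0 else 0)"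
    using init by (auto simp: fun_eq_iff gr0_conv_Suc)
  then have "(\<Sum>j. Y j t0) = y0" "(\<Sum>j. Z j t0) = z0"
    using sums_unique[OF sums_single[of 0 "\<lambda>_. y0"]] sums_unique[OF sums_single[of 0 "\<lambda>_. z0"]] by simp_all
  then show thesis using key shift that[of "\<lambda>x. \<Sum>j. Y j x" "\<lambda>x. \<Sum>j. Z j x"] by simp
qed

section \<open>Positive solutions of the Bessel equation from a Hardy inequality\<close>

text \<open>A Hardy inequality for radial functions in the plane, whose measure is
  \<open>r dr\<close>. Since \<open>g\<close> is C^1 on the whole line, vanishing outside
  \<open>{p..q}\<close> also makes \<open>g\<close> and \<open>g'\<close> vanish at the endpoints;
  the support avoids 0 and \<open>R\<close>, where \<open>V\<close> may be unbounded.\<close>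

definition hardy_form :: "(real \<Rightarrow> real) \<Rightarrow> real \<Rightarrow> real \<Rightarrow> bool" where
  "hardy_form V R B \<longleftrightarrow> (\<forall>g g' p q. 0 < p \<longrightarrow> p < q \<longrightarrow> q < R \<longrightarrow>
     (\<forall>r. (g has_real_derivative g' r) (at r)) \<longrightarrow> continuous_on UNIV g' \<longrightarrow>
     (\<forall>r. r \<notin> {p..q} \<longrightarrow> g r = 0) \<longrightarrow>
     B * integral {p..q} (\<lambda>r. V r * r * (g r)\<^sup>2) \<le> integral {p..q} (\<lambda>r. r * (g' r)\<^sup>2))"

section \<open>Functions of class C^1 cut off to a compact interval\<close>

lemma DERIV_zero_if_dominated:
  fixes g h :: "real \<Rightarrow> real"
  assumes "(h has_real_derivative 0) (at x)" "h x = 0" "\<And>r. \<bar>g r\<bar> \<le> \<bar>h r\<bar>"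
  shows "(g has_real_derivative 0) (at x)"
proof -
  have "g x = 0" using assms(3)[of x] assms(2) by simp
  have "((\<lambda>y. (h y - h x) / (y - x)) \<longlongrightarrow> 0) (at x)"
    using assms(1) by (simp add: has_field_derivative_iff)
  then have "((\<lambda>y. (g y - g x) / (y - x)) \<longlongrightarrow> 0) (at x)"
    by (rule Lim_null_comparison[rotated, OF tendsto_norm_zero])
      (simp add: \<open>g x = 0\<close> assms divide_right_mono)
  then show ?thesis by (simp add: has_field_derivative_iff)
qed

text \<open>At an endpoint the truncated function is dominated by \<open>h\<close>, whose value and
  derivative are zero there, so its own difference quotients tend to zero.\<close>

lemma DERIV_cutoff:
  fixes h h' :: "real \<Rightarrow> real"
  assumes d: "\<And>r. r \<in> {p..q} \<Longrightarrow> (h has_real_derivative h' r) (at r)"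
    and z: "h p = 0" "h q = 0" "h' p = 0" "h' q = 0" and "p < q"
  shows "((\<lambda>r. if r \<in> {p..q} then h r else 0) has_real_derivative (if r \<in> {p..q} then h' r else 0)) (at r)"
proof -
  consider "r \<in> {p<..<q}" | "r \<in> - {p..q}" | "r = p" | "r = q" by force
  then show ?thesis
  proof cases
    case 1
    then have "eventually (\<lambda>s. s \<in> {p<..<q}) (nhds r)" by (intro eventually_nhds_in_open) auto
    then have "eventually (\<lambda>s. (if s \<in> {p..q} then h s else 0) = h s) (nhds r)"
      by eventually_elim auto
    then have "((\<lambda>s. if s \<in> {p..q} then h s else 0) has_real_derivative h' r) (at r)"
      by (rule DERIV_eventually_eq) (use 1 d in auto)
    then show ?thesis using 1 by auto
  next
    case 2
    then have "eventually (\<lambda>s. s \<in> - {p..q}) (nhds r)" by (intro eventually_nhds_in_open) auto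
    then have "eventually (\<lambda>s. (if s \<in> {p..q} then h s else 0) = 0) (nhds r)"
      by eventually_elim auto
    then have "((\<lambda>s. if s \<in> {p..q} then h s else 0) has_real_derivative 0) (at r)"
      by (rule DERIV_eventually_eq) simp
    then show ?thesis using 2 by auto
  next
    case 3
    have "(h has_real_derivative 0) (at p)" using d[of p] z \<open>p < q\<close> by simp
    then have "((\<lambda>r. if r \<in> {p..q} then h r else 0) has_real_derivative 0) (at p)"
      by (rule DERIV_zero_if_dominated[where h = h and x = p, OF _ z(1)]) simp
    then show ?thesis using 3 z by simp
  next
    case 4
    have "(h has_real_derivative 0) (at q)" using d[of q] z \<open>p < q\<close> by simp
    then have "((\<lambda>r. if r \<in> {p..q} then h r else 0) has_real_derivative 0) (at q)"
      by (rule DERIV_zero_if_dominated[where h = h and x = q, OF _ z(2)]) simp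
    then show ?thesis using 4 z by simp
  qed
qed

lemma continuous_on_cutoff:
  fixes h :: "real \<Rightarrow> real"
  assumes "continuous_on {p..q} h" "h p = 0" "h q = 0" "p < q"
  shows "continuous_on UNIV (\<lambda>r. if r \<in> {p..q} then h r else 0)"
proof -
  have "continuous_on ({p..q} \<union> ({..p} \<union> {q..})) (\<lambda>r. if r \<in> {p..q} then h r else 0)"
    using assms by (intro continuous_on_If) auto
  moreover have "{p..q} \<union> ({..p} \<union> {q..}) = UNIV" by auto
  ultimately show ?thesis by simp
qed

text \<open>The odd power of exponent \<open>1 + e\<close>. For \<open>e > 0\<close> its derivative
  vanishes at 0, which removes the corner that a solution cut off at its zeros would have.\<close>

lemma DERIV_mult_abs_powr:
  fixes e :: real assumes "e > 0"
  shows "((\<lambda>s. s * \<bar>s\<bar> powr e) has_real_derivative (1 + e) * \<bar>x\<bar> powr e) (at x)"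
proof -
  consider "x > 0" | "x < 0" | "x = 0" by linarith
  then show ?thesis
  proof cases
    case 1
    then have "eventually (\<lambda>s. s \<in> {0<..}) (nhds x)" by (intro eventually_nhds_in_open) auto
    then have "eventually (\<lambda>s. s * \<bar>s\<bar> powr e = s powr (1 + e)) (nhds x)"
      by eventually_elim (simp add: powr_add)
    moreover have "((\<lambda>s. s powr (1 + e)) has_real_derivative (1 + e) * \<bar>x\<bar> powr e) (at x)"
      using 1 by (auto intro!: derivative_eq_intros)
    ultimately show ?thesis by (rule DERIV_eventually_eq)
  next
    case 2
    then have "eventually (\<lambda>s. s \<in> {..<0}) (nhds x)" by (intro eventually_nhds_in_open) auto
    then have "eventually (\<lambda>s. s * \<bar>s\<bar> powr e = - ((- s) powr (1 + e))) (nhds x)"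
      by eventually_elim (simp add: powr_add)
    moreover have "((\<lambda>s. - ((- s) powr (1 + e))) has_real_derivative (1 + e) * \<bar>x\<bar> powr e) (at x)"
      using 2 by (auto intro!: derivative_eq_intros)
    ultimately show ?thesis by (rule DERIV_eventually_eq)
  next
    case 3
    have "((\<lambda>y. \<bar>y\<bar> powr e) \<longlongrightarrow> \<bar>0\<bar> powr e) (at (0::real))"
      using assms by (intro tendsto_powr') (auto intro!: tendsto_eq_intros)
    moreover have "eventually (\<lambda>y. \<bar>y\<bar> powr e = (y * \<bar>y\<bar> powr e - 0 * \<bar>0\<bar> powr e) / (y - 0)) (at (0::real))"
      by (simp add: eventually_at_filter)
    ultimately have "((\<lambda>y. (y * \<bar>y\<bar> powr e - 0 * \<bar>0\<bar> powr e) / (y - 0)) \<longlongrightarrow> \<bar>0\<bar> powr e) (at (0::real))"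
      by (rule Lim_transform_eventually)
    then show ?thesis using 3 assms by (simp add: has_field_derivative_iff)
  qed
qed

text \<open>The Bessel equation multiplied by \<open>r\<close>, with \<open>z = r * y'\<close> as
  second unknown. As \<open>(r * y')' = - c * V r * r * y\<close>, it is a linear system of the form
  solved above, with coefficients continuous on the open interval.\<close>

locale bessel_system =
  fixes V :: "real \<Rightarrow> real" and R c :: real and y z :: "real \<Rightarrow> real"
  assumes dy: "\<And>r. r \<in> {0<..<R} \<Longrightarrow> (y has_real_derivative z r / r) (at r)"
    and dz: "\<And>r. r \<in> {0<..<R} \<Longrightarrow> (z has_real_derivative - (c * V r * r * y r)) (at r)"
begin

lemma cont: "continuous_on {0<..<R} y" "continuous_on {0<..<R} z"
  by (rule DERIV_continuous_on[OF has_field_derivative_at_within[OF dy]], assumption)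
    (rule DERIV_continuous_on[OF has_field_derivative_at_within[OF dz]], assumption)

text \<open>The test function is \<open>\<bar>y\<bar>\<^sup>e y\<close> cut off to \<open>[p,q]\<close>; it is continuously differentiable and
  the ratio of the two sides of the Hardy inequality for it is \<open>c (1+e)\<^sup>2/(1+2e)\<close>.\<close>

lemma zero_between_zeros:
  assumes V: "continuous_on {0<..<R} V" "\<And>r. r \<in> {0<..<R} \<Longrightarrow> V r \<ge> 0"
    and H: "hardy_form V R B" and c: "0 < c" "c < B"
    and pq: "0 < p" "p < q" "q < R" and yz: "y p = 0" "y q = 0" and s: "s \<in> {p..q}"
  shows "y s = 0"
proof -
  \<comment> \<open>The factor in front of \<open>c\<close> tends to 1 as \<open>e\<close> tends to
    0, and \<open>c < B\<close> leaves room for it.\<close>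
  obtain e where e: "e > 0" "(1 + e)\<^sup>2 / (1 + 2 * e) * c < B"
  proof -
    have "((\<lambda>e. (1 + e)\<^sup>2 / (1 + 2 * e) * c) \<longlongrightarrow> (1 + 0)\<^sup>2 / (1 + 2 * 0) * c) (at_right 0)"
      by (intro tendsto_intros) auto
    then have "eventually (\<lambda>e. (1 + e)\<^sup>2 / (1 + 2 * e) * c < B) (at_right 0)"
      using c by (intro order_tendstoD(2)[where y = "(1 + 0)\<^sup>2 / (1 + 2 * 0) * c"]) auto
    moreover have "eventually (\<lambda>e::real. e > 0) (at_right 0)" by (rule eventually_at_right_less)
    ultimately have "eventually (\<lambda>e. e > 0 \<and> (1 + e)\<^sup>2 / (1 + 2 * e) * c < B) (at_right 0)"
      by eventually_elim auto
    from eventually_happens[OF this] show thesis using that by auto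
  qed
  have sub: "{p..q} \<subseteq> {0<..<R}" using pq by auto
  define h h' where "h r = y r * \<bar>y r\<bar> powr e" and "h' r = (1 + e) * \<bar>y r\<bar> powr e * (z r / r)" for r
  define g g' where "g r = (if r \<in> {p..q} then h r else 0)"
    and "g' r = (if r \<in> {p..q} then h' r else 0)" for r
  have cy: "continuous_on {p..q} y" "continuous_on {p..q} z"
    using cont sub continuous_on_subset by blast+
  have cp: "continuous_on {p..q} (\<lambda>r. \<bar>y r\<bar> powr d)" if "d > 0" for d
    using that by (intro continuous_on_powr' continuous_intros cy) auto
  have cV: "continuous_on {p..q} V" using V(1) sub continuous_on_subset by blast
  have dh: "(h has_real_derivative h' r) (at r)" if "r \<in> {p..q}" for r
    unfolding h_def[abs_def] h'_def
    using that sub by (intro DERIV_chain2[OF DERIV_mult_abs_powr[OF e(1)] dy]) auto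
  have dg: "(g has_real_derivative g' r) (at r)" for r
    unfolding g_def[abs_def] g'_def
    by (intro DERIV_cutoff dh) (use yz pq e in \<open>auto simp: h_def h'_def\<close>)
  have ch': "continuous_on {p..q} h'"
    unfolding h'_def[abs_def] using pq by (intro continuous_intros cp cy e) auto
  have cg': "continuous_on UNIV g'"
    unfolding g'_def[abs_def]
    by (intro continuous_on_cutoff ch') (use yz pq e in \<open>auto simp: h'_def\<close>)
  define D where "D = integral {p..q} (\<lambda>r. V r * r * (g r)\<^sup>2)"
  have "continuous_on {p..q} g"
    using dg by (meson DERIV_isCont continuous_at_imp_continuous_on)
  then have iD: "(\<lambda>r. V r * r * (g r)\<^sup>2) integrable_on {p..q}"
    by (intro integrable_continuous_interval continuous_intros cV)
  have D0: "D \<ge> 0" unfolding D_def using V(2) sub pq by (intro integral_nonneg iD) auto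
  \<comment> \<open>The boundary term obtained by testing the equation with
    \<open>y * \<bar>y\<bar> powr (2 * e)\<close>; it vanishes at both zeros of \<open>y\<close>.
    The exponent is \<open>2 * e\<close> because \<open>g\<^sup>2\<close> equals \<open>y\<close>
    times this multiplier.\<close>
  define G G' where "G r = z r * (y r * \<bar>y r\<bar> powr (2 * e))"
    and "G' r = - (c * V r * r * y r) * (y r * \<bar>y r\<bar> powr (2 * e)) + z r * ((1 + 2 * e) * \<bar>y r\<bar> powr (2 * e) * (z r / r))" for r
  have "(G has_real_derivative G' r) (at r)" if "r \<in> {p..q}" for r
  proof -
    have "((\<lambda>r. y r * \<bar>y r\<bar> powr (2 * e)) has_real_derivative (1 + 2 * e) * \<bar>y r\<bar> powr (2 * e) * (z r / r)) (at r)"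
      using that sub e by (intro DERIV_chain2[OF DERIV_mult_abs_powr dy]) auto
    from DERIV_mult'[OF dz this] show ?thesis
      using that sub unfolding G_def[abs_def] G'_def by (simp add: add.commute subset_iff)
  qed
  then have iG: "(G' has_integral (G q - G p)) {p..q}"
    using pq by (intro fundamental_theorem_of_calculus)
      (auto simp: has_real_derivative_iff_has_vector_derivative[symmetric] intro: has_field_derivative_at_within)
  have sq: "(\<bar>y r\<bar> powr e)\<^sup>2 = \<bar>y r\<bar> powr (2 * e)" for r
    by (simp add: power2_eq_square powr_add[symmetric])
  have "((\<lambda>r. (1 + e)\<^sup>2 / (1 + 2 * e) * (G' r + c * (V r * r * (g r)\<^sup>2))) has_integral (1 + e)\<^sup>2 / (1 + 2 * e) * (G q - G p + c * D)) {p..q}"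
    unfolding D_def by (intro has_integral_mult_right has_integral_add iG integrable_integral iD)
  moreover have "(1 + e)\<^sup>2 / (1 + 2 * e) * (G' r + c * (V r * r * (g r)\<^sup>2)) = r * (g' r)\<^sup>2" if "r \<in> {p..q}" for r
  proof -
    define P where "P = \<bar>y r\<bar> powr e"
    have "r > 0" using that pq by auto
    have P: "\<bar>y r\<bar> powr (2 * e) = P\<^sup>2" by (simp add: P_def sq)
    have "G' r + c * (V r * r * (g r)\<^sup>2) = (1 + 2 * e) * (P\<^sup>2 * (z r)\<^sup>2 / r)"
      using that by (simp add: G'_def g_def h_def P flip: P_def) (simp add: algebra_simps power2_eq_square)
    then have "(1 + e)\<^sup>2 / (1 + 2 * e) * (G' r + c * (V r * r * (g r)\<^sup>2)) = (1 + e)\<^sup>2 * (P\<^sup>2 * (z r)\<^sup>2 / r)"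
      using e by simp
    also have "\<dots> = r * (g' r)\<^sup>2"
      using that \<open>r > 0\<close> by (simp add: g'_def h'_def flip: P_def) (simp add: field_simps power2_eq_square)
    finally show ?thesis .
  qed
  ultimately have "((\<lambda>r. r * (g' r)\<^sup>2) has_integral (1 + e)\<^sup>2 / (1 + 2 * e) * (G q - G p + c * D)) {p..q}"
    by (rule has_integral_eq[rotated])
  moreover have "G q = 0" "G p = 0" using yz by (auto simp: G_def)
  ultimately have iE: "((\<lambda>r. r * (g' r)\<^sup>2) has_integral (1 + e)\<^sup>2 / (1 + 2 * e) * c * D) {p..q}"
    by (simp add: mult.assoc)
  have "B * D \<le> (1 + e)\<^sup>2 / (1 + 2 * e) * c * D"
  proof -
    have "\<forall>r. r \<notin> {p..q} \<longrightarrow> g r = 0" by (simp add: g_def)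
    then show ?thesis
      using H[unfolded hardy_form_def, rule_format, OF pq dg cg'] integral_unique[OF iE]
      by (simp only: D_def) blast
  qed
  \<comment> \<open>As \<open>V\<close> may vanish on \<open>{p..q}\<close>, \<open>D = 0\<close>
    alone would not give \<open>g = 0\<close>. The energy is a multiple of \<open>D\<close>, so it
    vanishes too, and that forces \<open>g' = 0\<close>.\<close>
  then have "D \<le> 0" using mult_strict_right_mono[OF e(2), of D] by linarith
  then have "((\<lambda>r. r * (g' r)\<^sup>2) has_integral 0) {p..q}" using iE D0 by simp
  moreover have "continuous_on {p..q} (\<lambda>r. r * (g' r)\<^sup>2)"
    by (intro continuous_intros continuous_on_subset[OF cg']) auto
  ultimately have "r * (g' r)\<^sup>2 = 0" if "r \<in> {p..q}" for r
    using has_integral_0_cbox_imp_0[of p q "\<lambda>r. r * (g' r)\<^sup>2" r] that pq by auto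
  then have "g' r = 0" if "r \<in> {p..q}" for r using that pq by fastforce
  then have "(g has_real_derivative 0) (at r)" if "r \<in> {p..q}" for r using dg[of r] that by simp
  then have "g s = g p"
    using s \<open>p < q\<close> \<open>continuous_on {p..q} g\<close> by (intro DERIV_isconst2[of p q g s]) auto
  then show ?thesis using yz s pq by (auto simp: g_def h_def)
qed

end

section \<open>From solutions with at most one zero to a positive solution\<close>

lemma same_sign_on_connected:
  fixes f :: "'a::topological_space \<Rightarrow> real"
  assumes "continuous_on S f" "connected S" "\<And>x. x \<in> S \<Longrightarrow> f x \<noteq> 0"
    and "x \<in> S" "y \<in> S" "f x > 0"
  shows "f y > 0"
proof (rule ccontr)
  assume "\<not> f y > 0"
  then have "0 \<in> {f y..f x}" using assms by auto
  also have "\<dots> \<subseteq> f ` S"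
    using assms by (intro connected_contains_Icc connected_continuous_image) auto
  finally show False using assms(3) by auto
qed

text \<open>Let \<open>u\<close>, \<open>v\<close> be solutions with \<open>v\<close> vanishing at
  \<open>t0\<close>, positive to the right and negative to the left of it. Then
  \<open>u + \<lambda> * v\<close> is non-negative on the right iff \<open>\<lambda>\<close> is at
  least every ratio \<open>- u / v\<close> there, and on the left iff it is at most every ratio
  there. Absence of second zeros separates the two sets of ratios, so the supremum of the right one
  works. A zero of the resulting solution would be a double zero, which the Wronskian
  excludes.\<close>

lemma positive_solution:
  assumes R: "R > 0" and V: "continuous_on {0<..<R} V" "\<And>r. r \<in> {0<..<R} \<Longrightarrow> V r \<ge> 0"
    and H: "hardy_form V R B" and c: "0 < c" "c < B"
  obtains y z where "bessel_system V R c y z" "\<And>r. r \<in> {0<..<R} \<Longrightarrow> y r > 0"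
proof -
  define t0 where "t0 = R / 2"
  have t0: "t0 \<in> {0<..<R}" using R by (simp add: t0_def)
  have ab: "continuous_on {0<..<R} (\<lambda>r. 1 / r)" "continuous_on {0<..<R} (\<lambda>r. - (c * V r * r))"
    using V(1) by (auto intro!: continuous_intros)
  obtain u zu where u: "u t0 = 1" "zu t0 = 0"
    "\<And>r. r \<in> {0<..<R} \<Longrightarrow> (u has_real_derivative 1 / r * zu r) (at r)"
    "\<And>r. r \<in> {0<..<R} \<Longrightarrow> (zu has_real_derivative - (c * V r * r) * u r) (at r)"
    using linear_system_solution[OF ab t0] by blast
  obtain v zv where v: "v t0 = 0" "zv t0 = 1"
    "\<And>r. r \<in> {0<..<R} \<Longrightarrow> (v has_real_derivative 1 / r * zv r) (at r)"
    "\<And>r. r \<in> {0<..<R} \<Longrightarrow> (zv has_real_derivative - (c * V r * r) * v r) (at r)"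
    using linear_system_solution[OF ab t0] by blast
  have comb: "bessel_system V R c (\<lambda>r. \<alpha> * u r + \<beta> * v r) (\<lambda>r. \<alpha> * zu r + \<beta> * zv r)" for \<alpha> \<beta>
  proof
    fix r assume r: "r \<in> {0<..<R}"
    show "((\<lambda>r. \<alpha> * u r + \<beta> * v r) has_real_derivative (\<alpha> * zu r + \<beta> * zv r) / r) (at r)"
      by (rule derivative_eq_intros u(3) v(3) r refl)+ (simp add: field_simps add_divide_distrib)
    show "((\<lambda>r. \<alpha> * zu r + \<beta> * zv r) has_real_derivative - (c * V r * r * (\<alpha> * u r + \<beta> * v r))) (at r)"
      by (rule derivative_eq_intros u(4) v(4) r refl)+ (simp add: algebra_simps)
  qed
  have cu: "continuous_on {0<..<R} u" and cv: "continuous_on {0<..<R} v"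
    using bessel_system.cont(1)[OF comb[of 1 0]] bessel_system.cont(1)[OF comb[of 0 1]] by simp_all
  \<comment> \<open>Written with \<open>z = r * y'\<close>, the Wronskian already contains the
    weight \<open>r\<close> and is therefore constant.\<close>
  have wronskian: "u r * zv r - zu r * v r = 1" if r: "r \<in> {0<..<R}" for r
  proof -
    have "((\<lambda>r. u r * zv r - zu r * v r) has_real_derivative 0) (at r within {0<..<R})" if r: "r \<in> {0<..<R}" for r
    proof (rule has_field_derivative_at_within)
      show "((\<lambda>r. u r * zv r - zu r * v r) has_real_derivative 0) (at r)"
        by (rule derivative_eq_intros u(3,4) v(3,4) r refl)+ (simp add: algebra_simps)
    qed
    from has_field_derivative_zero_constant[OF _ this]
    obtain k where k: "\<And>r. r \<in> {0<..<R} \<Longrightarrow> u r * zv r - zu r * v r = k"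
      by auto
    show ?thesis using k[OF r] k[OF t0] u v by simp
  qed
  have degenerate: "\<alpha> = 0 \<and> \<beta> = 0"
    if "s \<in> {0<..<R}" "\<alpha> * u s + \<beta> * v s = 0" "\<alpha> * zu s + \<beta> * zv s = 0" for \<alpha> \<beta> s
  proof -
    have "\<alpha> * (u s * zv s - zu s * v s) = zv s * (\<alpha> * u s + \<beta> * v s) - v s * (\<alpha> * zu s + \<beta> * zv s)"
      "\<beta> * (u s * zv s - zu s * v s) = u s * (\<alpha> * zu s + \<beta> * zv s) - zu s * (\<alpha> * u s + \<beta> * v s)"
      by (simp_all add: algebra_simps)
    then show ?thesis using that wronskian[of s] by simp
  qed
  have two_zeros: "\<alpha> = 0 \<and> \<beta> = 0"
    if pq: "0 < p" "p < q" "q < R" and z: "\<alpha> * u p + \<beta> * v p = 0" "\<alpha> * u q + \<beta> * v q = 0" for \<alpha> \<beta> p q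
  proof -
    interpret bessel_system V R c "\<lambda>r. \<alpha> * u r + \<beta> * v r" "\<lambda>r. \<alpha> * zu r + \<beta> * zv r" by (rule comb)
    define s where "s = (p + q) / 2"
    have s: "s \<in> {p<..<q}" "s \<in> {0<..<R}" using pq by (auto simp: s_def)
    have zero: "\<alpha> * u r + \<beta> * v r = 0" if "r \<in> {p<..<q}" for r
      using that by (intro zero_between_zeros[OF V H c pq z]) auto
    have "eventually (\<lambda>r. r \<in> {p<..<q}) (nhds s)" using s by (intro eventually_nhds_in_open) auto
    then have "eventually (\<lambda>r. \<alpha> * u r + \<beta> * v r = 0) (nhds s)"
      by eventually_elim (rule zero)
    then have "((\<lambda>r. \<alpha> * u r + \<beta> * v r) has_real_derivative 0) (at s)"
      by (rule DERIV_eventually_eq) simp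
    then have "(\<alpha> * zu s + \<beta> * zv s) / s = 0" using dy[OF s(2)] DERIV_unique by blast
    then show ?thesis using degenerate[of s \<alpha> \<beta>] zero[OF s(1)] s by simp
  qed
  have v0: "v t \<noteq> 0" if "t \<in> {0<..<R}" "t \<noteq> t0" for t
    using two_zeros[of t t0 0 1] two_zeros[of t0 t 0 1] that t0 v(1) by (cases "t < t0") auto
  have dv: "(v has_real_derivative 1 / t0) (at t0)" using v(3)[OF t0] v(2) by simp
  have vpos: "v t > 0" if t: "t \<in> {t0<..<R}" for t
  proof -
    obtain d where d: "d > 0" "\<And>h. 0 < h \<Longrightarrow> h < d \<Longrightarrow> v t0 < v (t0 + h)"
      using DERIV_pos_inc_right[OF dv] t0 by auto
    define h where "h = min (d / 2) (t - t0)"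
    have "v (t0 + h) > 0" using d(2)[of h] d(1) t v(1) by (auto simp: h_def)
    then show ?thesis
      using t t0 d(1) v0 by (intro same_sign_on_connected[of "{t0<..<R}" v "t0 + h" t]
        continuous_on_subset[OF cv]) (auto simp: h_def)
  qed
  have vneg: "v t < 0" if t: "t \<in> {0<..<t0}" for t
  proof -
    obtain d where d: "d > 0" "\<And>h. 0 < h \<Longrightarrow> h < d \<Longrightarrow> v (t0 - h) < v t0"
      using DERIV_pos_inc_left[OF dv] t0 by auto
    define h where "h = min (d / 2) (t0 - t)"
    have "v (t0 - h) < 0" using d(2)[of h] d(1) t v(1) by (auto simp: h_def)
    then have "- v t > 0"
      using t t0 d(1) v0 by (intro same_sign_on_connected[of "{0<..<t0}" "\<lambda>t. - v t" "t0 - h" t]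
        continuous_intros continuous_on_subset[OF cv]) (auto simp: h_def)
    then show ?thesis by simp
  qed
  have sep: "- u t / v t < - u p / v p" if p: "p \<in> {0<..<t0}" and t: "t \<in> {t0<..<R}" for p t
  proof -
    \<comment> \<open>Equality would give the combination \<open>v p * u - u p * v\<close> the two
      zeros \<open>p\<close> and \<open>s\<close>, although \<open>v p\<close> is not zero. Hence
      this combination keeps on \<open>{p<..<R}\<close> the sign it has at \<open>t0\<close>, which
      is that of \<open>v p\<close>.\<close>
    have "u p * v s \<noteq> v p * u s" if "s \<in> {p<..<R}" for s
      using two_zeros[of p s "v p" "- u p"] that p t0 vneg[OF p] by auto
    then have "- (v p * u t - u p * v t) > 0"
      using p t t0 u(1) v(1) vneg[OF p]
      by (intro same_sign_on_connected[of "{p<..<R}" "\<lambda>s. - (v p * u s - u p * v s)" t0 t]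
        continuous_intros continuous_on_subset[OF cv] continuous_on_subset[OF cu]) auto
    then show ?thesis using vpos[OF t] vneg[OF p] by (simp add: divide_simps mult.commute)
  qed
  define T where "T = (\<lambda>t. - u t / v t) ` {t0<..<R}"
  have T: "T \<noteq> {}" "bdd_above T" using t0 sep[of "t0 / 2"]
    by (auto simp: T_def bdd_above_def intro!: exI[of _ "- u (t0 / 2) / v (t0 / 2)"] less_imp_le)
  have upper: "- u t / v t \<le> Sup T" if "t \<in> {t0<..<R}" for t
    using that T by (intro cSup_upper) (auto simp: T_def)
  have lower: "Sup T \<le> - u p / v p" if "p \<in> {0<..<t0}" for p
    using sep[OF that] T by (intro cSup_least) (auto simp: T_def less_imp_le)
  define y z where "y r = 1 * u r + Sup T * v r" and "z r = 1 * zu r + Sup T * zv r" for r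
  interpret bessel_system V R c y z unfolding y_def[abs_def] z_def[abs_def] by (rule comb)
  have y0: "y r \<ge> 0" if r: "r \<in> {0<..<R}" for r
  proof -
    consider "r = t0" | "r \<in> {t0<..<R}" | "r \<in> {0<..<t0}" using r by force
    then show ?thesis
    proof cases
      case 1 then show ?thesis using u v by (simp add: y_def)
    next
      case 2 then show ?thesis using upper[of r] vpos[of r] by (simp add: y_def field_simps)
    next
      case 3 then show ?thesis using lower[of r] vneg[of r] by (simp add: y_def field_simps)
    qed
  qed
  have "y r > 0" if r: "r \<in> {0<..<R}" for r
  proof (rule ccontr)
    assume "\<not> y r > 0"
    then have "y r = 0" using y0[OF r] by simp
    \<comment> \<open>A zero of the non-negative \<open>y\<close> is an interior minimum; the radius
      \<open>min r (R - r)\<close> keeps the neighbourhood inside the interval.\<close>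
    have "z r / r = 0"
      using y0 r \<open>y r = 0\<close> by (intro DERIV_local_min[OF dy[OF r], of "min r (R - r)"]) (auto simp: abs_if split: if_splits)
    then show False using degenerate[OF r, of 1 "Sup T"] \<open>y r = 0\<close> r by (simp add: y_def z_def)
  qed
  then show thesis using that bessel_system_axioms by blast
qed

lemma bessel_ode_of_system:
  assumes "bessel_system V R c y z" "\<And>r. r \<in> {0<..<R} \<Longrightarrow> y r > 0"
  shows "bessel_ode V R c"
proof -
  interpret bessel_system V R c y z by fact
  have "((\<lambda>r. z r / r) has_real_derivative - (c * V r * y r) - z r / r\<^sup>2) (at r)" if "r \<in> {0<..<R}" for r
    using that by (auto intro!: derivative_eq_intros dz[OF that] simp: field_simps power2_eq_square)
  then show ?thesis unfolding bessel_ode_def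
    using assms(2) dy by (intro exI[of _ y] exI[of _ "\<lambda>r. z r / r"] exI[of _ "\<lambda>r. - (c * V r * y r) - z r / r\<^sup>2"])
      (simp add: power2_eq_square)
qed

section \<open>Radial functions and polar coordinates\<close>

text \<open>Differentiating \<open>f (norm x) * ((b \<bullet> x) / norm x)\<close> once more along
  \<open>b\<close> gives a multiple of \<open>(x \<bullet> b)\<^sup>2\<close> plus
  \<open>f (norm x) / norm x\<close>. In the sum over the basis the squares add up to
  \<open>(norm x)\<^sup>2\<close>, which cancels one of the \<open>DIM('a)\<close> copies of the
  second term.\<close>

lemma radial_derivatives:
  fixes u :: "'a::euclidean_space \<Rightarrow> real"
  assumes u: "\<And>x. x \<noteq> 0 \<Longrightarrow> u x = \<phi> (norm x)"
    and d1: "\<And>r. r > 0 \<Longrightarrow> (\<phi> has_real_derivative f r) (at r)"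
    and d2: "\<And>r. r > 0 \<Longrightarrow> (f has_real_derivative f' r) (at r)"
    and x: "x \<noteq> 0"
  shows "norm (grad u x) = \<bar>f (norm x)\<bar>"
    and "laplacian u x = f' (norm x) + (real DIM('a) - 1) / norm x * f (norm x)"
proof -
  have near: "eventually (\<lambda>y. y \<noteq> 0) (nhds x)" if "x \<noteq> 0" for x :: 'a
    using that by (auto intro: eventually_nhds_in_open[of "- {0}", simplified])
  have norm: "(norm has_derivative (\<lambda>v. (v \<bullet> x) / norm x)) (at x)" if "x \<noteq> 0" for x :: 'a
    using has_derivative_norm[OF that] by (simp add: sgn_div_norm divide_inverse mult.commute)
  have dd: "dir_deriv u b x = f (norm x) * ((b \<bullet> x) / norm x)" if "x \<noteq> 0" for x b
  proof (rule dir_deriv_eq)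
    have "((\<lambda>x. \<phi> (norm x)) has_derivative (\<lambda>v. f (norm x) * ((v \<bullet> x) / norm x))) (at x)"
      using d1[of "norm x"] that
      by (intro has_derivative_compose[OF norm, of _ \<phi> "(*) (f (norm x))"])
        (auto simp: has_field_derivative_def)
    then show "(u has_derivative (\<lambda>v. f (norm x) * ((v \<bullet> x) / norm x))) (at x)"
    proof (rule has_derivative_transform_eventually)
      show "\<forall>\<^sub>F x in at x. \<phi> (norm x) = u x"
        using near[OF that] by (auto simp: eventually_at_filter u elim: eventually_mono)
    qed (auto simp: u that)
  qed
  have "grad u x = (\<Sum>b\<in>Basis. (f (norm x) / norm x) *\<^sub>R ((x \<bullet> b) *\<^sub>R b))"
    unfolding grad_def by (rule sum.cong) (simp_all add: dd[OF x] inner_commute)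
  also have "\<dots> = (f (norm x) / norm x) *\<^sub>R x"
    unfolding scaleR_sum_right[symmetric] euclidean_representation ..
  finally show "norm (grad u x) = \<bar>f (norm x)\<bar>" using x by simp
  have "dir_deriv (dir_deriv u b) b x =
      (f' (norm x) - f (norm x) / norm x) / (norm x)\<^sup>2 * (x \<bullet> b)\<^sup>2 + f (norm x) / norm x" if b: "b \<in> Basis" for b
  proof -
    have "((\<lambda>x. f (norm x) * ((b \<bullet> x) / norm x)) has_derivative
      (\<lambda>v. f (norm x) * ((b \<bullet> v) / norm x - (b \<bullet> x) * ((v \<bullet> x) / norm x) / (norm x)\<^sup>2) + f' (norm x) * ((v \<bullet> x) / norm x) * ((b \<bullet> x) / norm x))) (at x)"
    proof (rule has_derivative_mult)
      show "((\<lambda>x. f (norm x)) has_derivative (\<lambda>v. f' (norm x) * ((v \<bullet> x) / norm x))) (at x)"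
        using d2[of "norm x"] x
        by (intro has_derivative_compose[OF norm, of _ f "(*) (f' (norm x))"])
          (auto simp: has_field_derivative_def)
      have "((\<lambda>x. b \<bullet> x) has_derivative (\<lambda>v. b \<bullet> v)) (at x)"
        by (intro bounded_linear_imp_has_derivative bounded_linear_inner_right)
      from has_derivative_divide'[OF this norm[OF x]] x
      show "((\<lambda>x. b \<bullet> x / norm x) has_derivative (\<lambda>v. (b \<bullet> v) / norm x - (b \<bullet> x) * ((v \<bullet> x) / norm x) / (norm x)\<^sup>2)) (at x)"
        by (simp add: diff_divide_distrib power2_eq_square)
    qed
    then have "(dir_deriv u b has_derivative
      (\<lambda>v. f (norm x) * ((b \<bullet> v) / norm x - (b \<bullet> x) * ((v \<bullet> x) / norm x) / (norm x)\<^sup>2) + f' (norm x) * ((v \<bullet> x) / norm x) * ((b \<bullet> x) / norm x))) (at x)"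
    proof (rule has_derivative_transform_eventually)
      show "\<forall>\<^sub>F x in at x. f (norm x) * (b \<bullet> x / norm x) = dir_deriv u b x"
        using near[OF x] by (auto simp: eventually_at_filter dd elim: eventually_mono)
    qed (auto simp: dd x)
    from dir_deriv_eq[OF this, of b] show ?thesis
      using x b by (simp add: inner_same_Basis inner_commute) (simp add: field_simps power2_eq_square)
  qed
  then have "laplacian u x = (\<Sum>b\<in>Basis. (f' (norm x) - f (norm x) / norm x) / (norm x)\<^sup>2 * (x \<bullet> b)\<^sup>2 + f (norm x) / norm x)"
    unfolding laplacian_def by (intro sum.cong) auto
  also have "\<dots> = (f' (norm x) - f (norm x) / norm x) / (norm x)\<^sup>2 * (\<Sum>b\<in>Basis. (x \<bullet> b)\<^sup>2) + real DIM('a) * (f (norm x) / norm x)"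
    by (simp only: sum.distrib sum_distrib_left[symmetric]) simp
  also have "(\<Sum>b\<in>Basis. (x \<bullet> b)\<^sup>2) = (norm x)\<^sup>2"
    using euclidean_inner[of x x] power2_norm_eq_inner[of x] by (simp add: power2_eq_square[of "_ \<bullet> _"])
  also have "(f' (norm x) - f (norm x) / norm x) / (norm x)\<^sup>2 * (norm x)\<^sup>2 + real DIM('a) * (f (norm x) / norm x)
      = f' (norm x) + (real DIM('a) - 1) / norm x * f (norm x)"
    using x by (simp add: left_diff_distrib diff_divide_distrib)
  finally show "laplacian u x = f' (norm x) + (real DIM('a) - 1) / norm x * f (norm x)" .
qed

text \<open>Polar coordinates in the form sufficient for radial integrands. Half-lines generate the
  Borel sets, and both measures assign to \<open>{..x}\<close> the volume of a ball of radius
  \<open>x\<close> (zero for negative \<open>x\<close>), the density being the derivative of that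
  volume.\<close>

lemma distr_norm_lborel:
  "distr lborel borel (norm :: 'a::euclidean_space \<Rightarrow> real) =
   density lborel (\<lambda>r. ennreal (DIM('a) * unit_ball_vol DIM('a) * r ^ (DIM('a) - 1)) * indicator {0..} r)"
  (is "?M = ?N")
proof (rule measure_eqI_generator_eq[where E = "range atMost" and A = "\<lambda>i::nat. {..real i}" and \<Omega> = UNIV])
  have *: "emeasure ?M {..x} = ennreal (unit_ball_vol DIM('a) * (max 0 x) ^ DIM('a))" for x
  proof -
    have "emeasure ?M {..x} = emeasure lborel {y::'a. norm y \<le> x}"
      by (subst emeasure_distr) (auto intro!: arg_cong2[where f=emeasure])
    also have "\<dots> = ennreal (unit_ball_vol DIM('a) * (max 0 x) ^ DIM('a))"
    proof (cases "x \<ge> 0")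
      case True
      have "{y::'a. norm y \<le> x} = cball 0 x" by auto
      then show ?thesis using emeasure_cball[OF True, of "0::'a"] True by simp
    next
      case False
      then have "{y::'a. norm y \<le> x} = {}" by (auto simp: not_le intro: order.strict_trans2[OF _ norm_ge_zero])
      then show ?thesis using False by simp
    qed
    finally show ?thesis .
  qed
  fix X :: "real set" assume "X \<in> range atMost"
  then obtain x where X: "X = {..x}" by auto
  have "emeasure ?N {..x} = (\<integral>\<^sup>+r. ennreal (DIM('a) * unit_ball_vol DIM('a) * r ^ (DIM('a) - 1)) * indicator {0..max 0 x} r \<partial>lborel)"
  proof -
    have "emeasure ?N {..x} = (\<integral>\<^sup>+r. (ennreal (DIM('a) * unit_ball_vol DIM('a) * r ^ (DIM('a) - 1)) * indicator {0..} r) * indicator {..x} r \<partial>lborel)"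
      by (rule emeasure_density) auto
    also have "\<dots> = (\<integral>\<^sup>+r. ennreal (DIM('a) * unit_ball_vol DIM('a) * r ^ (DIM('a) - 1)) * indicator {0..max 0 x} r \<partial>lborel)"
    proof (rule nn_integral_cong_AE)
      \<comment> \<open>The two sides can differ only for \<open>x < 0\<close>, and then only at
        \<open>r = 0\<close>.\<close>
      show "AE r in lborel. ennreal (DIM('a) * unit_ball_vol DIM('a) * r ^ (DIM('a) - 1)) * indicator {0..} r * indicator {..x} r
          = ennreal (DIM('a) * unit_ball_vol DIM('a) * r ^ (DIM('a) - 1)) * indicator {0..max 0 x} r"
        using AE_lborel_singleton[of "0::real"]
        by eventually_elim (auto simp: indicator_def max_def)
    qed
    finally show ?thesis .
  qed
  also have "\<dots> = ennreal (unit_ball_vol DIM('a) * (max 0 x) ^ DIM('a) - unit_ball_vol DIM('a) * 0 ^ DIM('a))"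
    by (rule nn_integral_FTC_Icc) (auto intro!: derivative_eq_intros)
  finally show "emeasure ?M X = emeasure ?N X" by (simp add: X * zero_power)
next
  show "(\<Union>i::nat. {..real i}) = UNIV"
    by (auto simp: real_arch_simple)
  show "emeasure ?M {..real i} \<noteq> \<infinity>" for i
  proof -
    have "emeasure ?M {..real i} = emeasure lborel (cball (0::'a) (real i))"
      by (subst emeasure_distr) (auto intro!: arg_cong2[where f=emeasure])
    then show ?thesis by (simp add: emeasure_cball)
  qed
  show "Int_stable (range (atMost :: real \<Rightarrow> _))"
    by (auto simp: Int_stable_def)
qed (auto simp: borel_eq_atMost)

lemma nn_integral_radial_ball:
  fixes H :: "'a::euclidean_space \<Rightarrow> real"
  assumes h: "continuous_on {0<..<R} h" and H: "\<And>x. x \<in> ball 0 R \<Longrightarrow> x \<noteq> 0 \<Longrightarrow> H x = h (norm x)"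
  shows "(\<integral>\<^sup>+x\<in>ball 0 R. ennreal (H x) \<partial>lborel) =
    ennreal (DIM('a) * unit_ball_vol DIM('a)) * (\<integral>\<^sup>+r\<in>{0<..<R}. ennreal (h r * r ^ (DIM('a) - 1)) \<partial>lborel)"
proof -
  define k where "k r = ennreal (indicator {0<..<R} r *\<^sub>R h r)" for r
  have k: "k \<in> borel_measurable borel"
    unfolding k_def[abs_def]
    by (intro measurable_compose[OF borel_measurable_continuous_on_indicator measurable_ennreal] h) auto
  have "(\<integral>\<^sup>+x\<in>ball 0 R. ennreal (H x) \<partial>lborel) = (\<integral>\<^sup>+x. k (norm (x::'a)) \<partial>lborel)"
  proof (rule nn_integral_cong_AE)
    show "AE x in lborel. ennreal (H x) * indicator (ball 0 R) x = k (norm x)"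
      using AE_lborel_singleton[of "0::'a"]
      by eventually_elim (auto simp: k_def indicator_def H)
  qed
  also have "\<dots> = (\<integral>\<^sup>+r. k r \<partial>distr lborel borel (norm :: 'a \<Rightarrow> real))"
    using k by (subst nn_integral_distr) auto
  also have "\<dots> = (\<integral>\<^sup>+r. (ennreal (DIM('a) * unit_ball_vol DIM('a) * r ^ (DIM('a) - 1)) * indicator {0..} r) * k r \<partial>lborel)"
    unfolding distr_norm_lborel using k by (subst nn_integral_density) auto
  also have "\<dots> = (\<integral>\<^sup>+r. ennreal (DIM('a) * unit_ball_vol DIM('a)) * (ennreal (r ^ (DIM('a) - 1)) * k r) \<partial>lborel)"
    by (intro nn_integral_cong) (auto simp: k_def indicator_def ennreal_mult mult_ac)
  also have "\<dots> = ennreal (DIM('a) * unit_ball_vol DIM('a)) * (\<integral>\<^sup>+r. ennreal (r ^ (DIM('a) - 1)) * k r \<partial>lborel)"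
    using k by (intro nn_integral_cmult) auto
  also have "(\<integral>\<^sup>+r. ennreal (r ^ (DIM('a) - 1)) * k r \<partial>lborel) = (\<integral>\<^sup>+r\<in>{0<..<R}. ennreal (h r * r ^ (DIM('a) - 1)) \<partial>lborel)"
    by (intro nn_integral_cong) (auto simp: k_def indicator_def ennreal_mult''[symmetric] mult.commute)
  finally show ?thesis .
qed

section \<open>The one-dimensional inequality\<close>

text \<open>\<open>r * y'\<close> is non-increasing, so a positive value \<open>d\<close> at
  \<open>r\<close> would give \<open>y' s \<ge> d / s\<close> for all \<open>s \<le> r\<close>. Then
  \<open>y\<close> would lie below a logarithm that tends to minus infinity at 0, against
  positivity.\<close>

lemma bessel_solution_decreasing:
  fixes y y' y'' :: "real \<Rightarrow> real"
  assumes y: "\<And>r. r \<in> {0<..<R} \<Longrightarrow> (y has_real_derivative y' r) (at r)"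
    and y': "\<And>r. r \<in> {0<..<R} \<Longrightarrow> (y' has_real_derivative y'' r) (at r)"
    and super: "\<And>r. r \<in> {0<..<R} \<Longrightarrow> y'' r + 1 / r * y' r \<le> 0"
    and pos: "\<And>r. r \<in> {0<..<R} \<Longrightarrow> y r > 0" and r: "r \<in> {0<..<R}"
  shows "y' r \<le> 0"
proof (rule ccontr)
  assume neg: "\<not> y' r \<le> 0"
  define d where "d = r * y' r"
  have d: "d > 0" using neg r by (simp add: d_def)
  have mono: "s * y' s \<ge> d" if "0 < s" "s \<le> r" for s
    unfolding d_def
  proof (rule DERIV_nonpos_imp_nonincreasing[OF \<open>s \<le> r\<close>])
    fix x assume "s \<le> x" "x \<le> r"
    then have x: "x \<in> {0<..<R}" using that r by auto
    have "((\<lambda>s. s * y' s) has_real_derivative x * (y'' x + 1 / x * y' x)) (at x)"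
      using DERIV_mult'[OF DERIV_ident y'[OF x]] x by (simp add: distrib_left)
    moreover have "x * (y'' x + 1 / x * y' x) \<le> 0"
      using super[OF x] x by (intro mult_nonneg_nonpos) auto
    ultimately show "\<exists>y. ((\<lambda>s. s * y' s) has_real_derivative y) (at x) \<and> y \<le> 0" by blast
  qed
  \<comment> \<open>The point at which the logarithmic upper bound
    \<open>y r - d * (ln r - ln s)\<close> reaches zero.\<close>
  define s where "s = r * exp (- (y r / d))"
  have s: "0 < s" "s \<le> r" "s \<in> {0<..<R}" "ln s = ln r - y r / d"
    using r d pos[OF r] by (auto simp: s_def ln_mult mult_le_cancel_left1 intro: le_less_trans[rotated])
  have "y s - d * ln s \<le> y r - d * ln r"
  proof (rule DERIV_nonneg_imp_nondecreasing[OF \<open>s \<le> r\<close>])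
    fix x assume "s \<le> x" "x \<le> r"
    then have x: "x \<in> {0<..<R}" "0 < x" using s r by auto
    have "((\<lambda>x. y x - d * ln x) has_real_derivative y' x - d * (1 / x)) (at x)"
      using DERIV_diff[OF y[OF x(1)] DERIV_cmult[OF DERIV_ln_divide[OF x(2)]]] .
    moreover have "y' x - d * (1 / x) \<ge> 0"
      using mono[OF x(2) \<open>x \<le> r\<close>] x by (simp add: field_simps)
    ultimately show "\<exists>z. ((\<lambda>x. y x - d * ln x) has_real_derivative z) (at x) \<and> 0 \<le> z" by blast
  qed
  then have "y s \<le> 0" using s d by (simp add: algebra_simps)
  then show False using pos[OF s(3)] by simp
qed

lemma nn_integral_Icc_eq_integral:
  fixes h :: "real \<Rightarrow> real"
  assumes "continuous_on {a..b} h" "\<And>r. r \<in> {a..b} \<Longrightarrow> h r \<ge> 0"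
  shows "(\<integral>\<^sup>+r\<in>{a..b}. ennreal (h r) \<partial>lborel) = ennreal (integral {a..b} h)"
  using assms by (intro nn_integral_has_integral_lebesgue' integrable_integral integrable_continuous_interval)

lemma borel_measurable_ennreal_indicator:
  fixes h :: "real \<Rightarrow> real"
  assumes "S \<in> sets borel" "continuous_on S h"
  shows "(\<lambda>r. ennreal (h r) * indicator S r) \<in> borel_measurable lborel"
proof -
  have "(\<lambda>r. ennreal (indicator S r *\<^sub>R h r)) \<in> borel_measurable lborel"
    using borel_measurable_continuous_on_indicator[OF assms] by simp
  also have "(\<lambda>r. ennreal (indicator S r *\<^sub>R h r)) = (\<lambda>r. ennreal (h r) * indicator S r)"
    by (auto simp: indicator_def)
  finally show ?thesis .
qed

text \<open>The dimension enters as a real parameter, so that the one-dimensional analysis is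
  independent of the type; later lemmas tie them together by
  \<open>N = real DIM('a)\<close>.\<close>

locale radial_hardy =
  fixes N m R :: real and W :: "real \<Rightarrow> real"
  assumes N: "N \<ge> 1" and m: "m < (N - 2) / 2" and R: "R > 0"
    and cont_W: "continuous_on {0<..<R} W" and nonneg_W: "\<And>r. r \<in> {0<..<R} \<Longrightarrow> W r \<ge> 0"
begin

text \<open>\<open>\<kappa>\<close> is the power of \<open>r\<close> produced by the surface measure
  and the weight of the Laplacian term. With \<open>\<alpha> = (\<kappa> - 1) / 2\<close> the
  substitution \<open>f = r powr (- \<alpha>) * g\<close> leaves the plain weight \<open>r\<close>,
  and \<open>C\<close> equals \<open>(N - 1 - \<alpha>)\<^sup>2\<close>.\<close>

definition "\<kappa> = N - 1 - 2 * m"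
definition "\<alpha> = (N - 2 - 2 * m) / 2"
definition "C = ((N + 2 * m) / 2)\<^sup>2"

text \<open>\<open>lap\<close>, \<open>grd\<close> and \<open>pot\<close> are the three integrands
  in polar coordinates, including the surface factor \<open>r powr (N - 1)\<close> but not the area
  of the unit sphere.\<close>

definition lap :: "(real \<Rightarrow> real) \<Rightarrow> (real \<Rightarrow> real) \<Rightarrow> real \<Rightarrow> real" where
  "lap f f' r = (f' r + (N - 1) / r * f r)\<^sup>2 * r powr \<kappa>"
definition grd :: "(real \<Rightarrow> real) \<Rightarrow> real \<Rightarrow> real" where
  "grd f r = (f r)\<^sup>2 * r powr (\<kappa> - 2)"
definition pot :: "(real \<Rightarrow> real) \<Rightarrow> real \<Rightarrow> real" where
  "pot f r = W r * (f r)\<^sup>2 * r powr \<kappa>"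

lemma nonneg: "lap f f' r \<ge> 0" "grd f r \<ge> 0" "r \<in> {0<..<R} \<Longrightarrow> pot f r \<ge> 0"
  by (simp_all add: lap_def grd_def pot_def nonneg_W)

lemma cont:
  assumes "continuous_on S f" "S \<subseteq> {0<..<R}"
  shows "continuous_on S f' \<Longrightarrow> continuous_on S (lap f f')" "continuous_on S (grd f)" "continuous_on S (pot f)"
proof -
  have r: "continuous_on S (\<lambda>r. r powr e)" for e
    using assms(2) by (intro continuous_intros) auto
  have W: "continuous_on S W" using cont_W assms(2) continuous_on_subset by blast
  show "continuous_on S (lap f f')" if "continuous_on S f'"
    unfolding lap_def[abs_def] using assms by (intro continuous_intros that r) auto
  show "continuous_on S (grd f)"
    unfolding grd_def[abs_def] by (intro continuous_on_mult continuous_on_power assms r)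
  show "continuous_on S (pot f)"
    unfolding pot_def[abs_def] by (intro continuous_on_mult continuous_on_power assms W r)
qed

text \<open>The cross terms in \<open>f * f'\<close> of the two squares form part of the derivative
  of the boundary term. In the coefficient of \<open>(f r)\<^sup>2\<close>, the terms linear in
  \<open>p\<close> cancel because \<open>\<kappa> - 1 = 2 * \<alpha>\<close>, and the Riccati
  equation removes \<open>(r * p r)\<^sup>2\<close>; what remains is
  \<open>(N - 1 - \<alpha>)\<^sup>2 + r\<^sup>2 * v\<close>. Leaving \<open>v\<close> free allows
  both \<open>v = c * W r\<close> with \<open>p = y' / y\<close> and the trivial pair
  \<open>p = 0\<close>, \<open>v = 0\<close>.\<close>

lemma hardy_identity:
  assumes r: "r > 0" and f: "(f has_real_derivative f' r) (at r)"
    and p: "(p has_real_derivative - p r / r - v - (p r)\<^sup>2) (at r)"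
  shows "((\<lambda>r. (f r)\<^sup>2 * r powr (\<kappa> - 1) * (N - 1 - \<alpha> + r * p r)) has_real_derivative
    lap f f' r - C * grd f r - v * ((f r)\<^sup>2 * r powr \<kappa>) - (f' r + \<alpha> / r * f r - p r * f r)\<^sup>2 * r powr \<kappa>) (at r)"
proof -
  define Z where "Z = r powr (\<kappa> - 2)"
  have Z: "r powr (\<kappa> - 1) = Z * r" "r powr \<kappa> = Z * r\<^sup>2"
    using r powr_add[of r "\<kappa> - 2" 1] powr_add[of r "\<kappa> - 2" 2] by (simp_all add: Z_def)
  have "((\<lambda>r. (f r)\<^sup>2) has_real_derivative 2 * f r * f' r) (at r)"
    using DERIV_power[OF f, of 2] by (simp add: mult_ac)
  moreover have "((\<lambda>r. r powr (\<kappa> - 1)) has_real_derivative (\<kappa> - 1) * Z) (at r)"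
    using has_real_derivative_powr[OF r, of "\<kappa> - 1"] by (simp add: Z_def)
  moreover have "((\<lambda>r. N - 1 - \<alpha> + r * p r) has_real_derivative p r + r * (- p r / r - v - (p r)\<^sup>2)) (at r)"
    by (rule DERIV_cong[OF DERIV_add[OF DERIV_const DERIV_mult'[OF DERIV_ident p]]]) simp
  ultimately have d: "((\<lambda>r. (f r)\<^sup>2 * r powr (\<kappa> - 1) * (N - 1 - \<alpha> + r * p r)) has_real_derivative
     (2 * f r * f' r * r powr (\<kappa> - 1) + (\<kappa> - 1) * Z * (f r)\<^sup>2) * (N - 1 - \<alpha> + r * p r)
       + (p r + r * (- p r / r - v - (p r)\<^sup>2)) * ((f r)\<^sup>2 * r powr (\<kappa> - 1))) (at r)"
    by (intro DERIV_mult)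
  have "lap f f' r - C * grd f r - v * ((f r)\<^sup>2 * r powr \<kappa>) - (f' r + \<alpha> / r * f r - p r * f r)\<^sup>2 * r powr \<kappa>
    = Z * ((r * f' r + (N - 1) * f r)\<^sup>2 - C * (f r)\<^sup>2 - v * (r * f r)\<^sup>2 - (r * f' r + \<alpha> * f r - r * p r * f r)\<^sup>2)"
    unfolding lap_def grd_def Z Z_def[symmetric] using r by (simp add: field_simps power2_eq_square)
  also have "\<dots> = (2 * f r * f' r * r powr (\<kappa> - 1) + (\<kappa> - 1) * Z * (f r)\<^sup>2) * (N - 1 - \<alpha> + r * p r)
       + (p r + r * (- p r / r - v - (p r)\<^sup>2)) * ((f r)\<^sup>2 * r powr (\<kappa> - 1))"
    unfolding Z unfolding C_def \<kappa>_def \<alpha>_def using r by (simp add: field_simps power2_eq_square)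
  finally show ?thesis using d by simp
qed

text \<open>The identity is integrated over \<open>{e..\<rho>}\<close>. The boundary term vanishes
  at \<open>\<rho>\<close> together with \<open>f\<close>; at \<open>e\<close> it is at most a
  multiple of \<open>e powr (\<kappa> - 1)\<close>. Letting \<open>e\<close> tend to 0 uses monotone
  convergence on the left and the vanishing of this error on the right.\<close>

lemma hardy_rellich_1d:
  assumes ode: "bessel_ode W R c" and c: "c > 0"
    and f: "\<And>r. r \<in> {0<..<R} \<Longrightarrow> (f has_real_derivative f' r) (at r)"
    and f': "continuous_on {0<..<R} f'"
    and M: "\<And>r. r \<in> {0<..<R} \<Longrightarrow> \<bar>f r\<bar> \<le> M"
    and \<rho>: "0 < \<rho>" "\<rho> < R" and f0: "\<And>r. r \<in> {\<rho>..<R} \<Longrightarrow> f r = 0"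
  shows "ennreal C * (\<integral>\<^sup>+r\<in>{0<..<R}. ennreal (grd f r) \<partial>lborel) + ennreal c * (\<integral>\<^sup>+r\<in>{0<..<R}. ennreal (pot f r) \<partial>lborel)
    \<le> (\<integral>\<^sup>+r\<in>{0<..<R}. ennreal (lap f f' r) \<partial>lborel)" (is "_ \<le> ?L")
proof -
  obtain y y' y'' where y: "\<And>r. r \<in> {0<..<R} \<Longrightarrow> (y has_real_derivative y' r) (at r)"
      "\<And>r. r \<in> {0<..<R} \<Longrightarrow> (y' has_real_derivative y'' r) (at r)"
      "\<And>r. r \<in> {0<..<R} \<Longrightarrow> y'' r + 1 / r * y' r + c * W r * y r = 0"
      "\<And>r. r \<in> {0<..<R} \<Longrightarrow> y r > 0"
    using ode unfolding bessel_ode_def by blast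
  have "y'' r + 1 / r * y' r \<le> 0" if "r \<in> {0<..<R}" for r
  proof -
    have "0 \<le> c * W r * y r" using nonneg_W[OF that] y(4)[OF that] c by (intro mult_nonneg_nonneg) auto
    then show ?thesis using y(3)[OF that] by linarith
  qed
  then have dec: "y' r \<le> 0" if "r \<in> {0<..<R}" for r
    using bessel_solution_decreasing[OF y(1,2) _ y(4)] that by blast
  define p where "p r = y' r / y r" for r
  have p: "(p has_real_derivative - p r / r - c * W r - (p r)\<^sup>2) (at r)" if r: "r \<in> {0<..<R}" for r
  proof -
    have "(p has_real_derivative (y'' r * y r - y' r * y' r) / (y r * y r)) (at r)"
      unfolding p_def[abs_def] using y(4)[OF r] by (intro DERIV_divide y r) auto
    also have "y'' r = - (1 / r * y' r) - c * W r * y r" using y(3)[OF r] by linarith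
    also have "((- (1 / r * y' r) - c * W r * y r) * y r - y' r * y' r) / (y r * y r) = - p r / r - c * W r - (p r)\<^sup>2"
      using y(4)[OF r] r by (simp add: p_def field_simps power2_eq_square)
    finally show ?thesis .
  qed
  have cf: "continuous_on {0<..<R} f" and cp: "continuous_on {0<..<R} p"
    using DERIV_continuous_on[OF has_field_derivative_at_within[OF f]]
      DERIV_continuous_on[OF has_field_derivative_at_within[OF p]] by blast+
  define h where "h r = C * grd f r + c * pot f r" for r
  have C: "C \<ge> 0" by (simp add: C_def)
  have h0: "h r \<ge> 0" if "r \<in> {0<..<R}" for r using nonneg that C c by (simp add: h_def)
  have ch: "continuous_on S h" if "S \<subseteq> {0<..<R}" for S
    unfolding h_def[abs_def] using that continuous_on_subset[OF cf that] by (intro continuous_intros cont)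
  have bound: "(\<integral>\<^sup>+r\<in>{e..\<rho>}. ennreal (h r) \<partial>lborel) \<le> ?L + ennreal (M\<^sup>2 * \<bar>N - 1 - \<alpha>\<bar> * e powr (\<kappa> - 1))"
    if e: "0 < e" "e < \<rho>" for e
  proof -
    have sub: "{e..\<rho>} \<subseteq> {0<..<R}" using e \<rho> by auto
    note c_sub = continuous_on_subset[OF _ sub]
    have eR: "e \<in> {0<..<R}" using e \<rho> by auto
    define T where "T r = (f r)\<^sup>2 * r powr (\<kappa> - 1) * (N - 1 - \<alpha> + r * p r)" for r
    define sq where "sq r = (f' r + \<alpha> / r * f r - p r * f r)\<^sup>2 * r powr \<kappa>" for r
    have "((\<lambda>r. lap f f' r - h r - sq r) has_integral (T \<rho> - T e)) {e..\<rho>}"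
    proof (rule fundamental_theorem_of_calculus)
      fix x assume x: "x \<in> {e..\<rho>}"
      then have x': "x > 0" "x \<in> {0<..<R}" using sub by auto
      have "(T has_real_derivative lap f f' x - C * grd f x - c * W x * ((f x)\<^sup>2 * x powr \<kappa>) - sq x) (at x)"
        unfolding T_def[abs_def] sq_def by (intro hardy_identity x' f p)
      then show "(T has_vector_derivative (lap f f' x - h x - sq x)) (at x within {e..\<rho>})"
        unfolding has_real_derivative_iff_has_vector_derivative[symmetric]
        by (auto simp: h_def pot_def algebra_simps intro: has_field_derivative_at_within)
    qed (use e in simp)
    moreover have "T \<rho> = 0" using f0[of \<rho>] \<rho> by (simp add: T_def)
    moreover have "continuous_on {e..\<rho>} sq"
      unfolding sq_def[abs_def] using e
      by (intro continuous_intros c_sub[OF f'] c_sub[OF cf] c_sub[OF cp]) auto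
    then have isq: "sq integrable_on {e..\<rho>}" by (rule integrable_continuous_interval)
    have il: "lap f f' integrable_on {e..\<rho>}" and ih: "h integrable_on {e..\<rho>}"
      using sub by (auto intro!: integrable_continuous_interval cont ch c_sub[OF f'] c_sub[OF cf])
    ultimately have eq: "integral {e..\<rho>} (lap f f') - integral {e..\<rho>} h - integral {e..\<rho>} sq = - T e"
      using integral_diff[OF integrable_diff[OF il ih] isq] integral_diff[OF il ih] by (simp add: integral_unique)
    have "integral {e..\<rho>} sq \<ge> 0" by (intro integral_nonneg isq) (simp add: sq_def)
    \<comment> \<open>Only an upper bound enters, and \<open>e * p e\<close>, whose size near 0 is
      not controlled, is non-positive.\<close>
    moreover have "T e \<le> M\<^sup>2 * \<bar>N - 1 - \<alpha>\<bar> * e powr (\<kappa> - 1)"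
    proof -
      have "e * p e \<le> 0"
        using dec[OF eR] y(4)[OF eR] e by (auto simp: p_def intro!: mult_nonneg_nonpos divide_nonpos_pos)
      then have "T e \<le> (f e)\<^sup>2 * e powr (\<kappa> - 1) * \<bar>N - 1 - \<alpha>\<bar>"
        unfolding T_def by (intro mult_left_mono) auto
      also have "\<dots> \<le> M\<^sup>2 * e powr (\<kappa> - 1) * \<bar>N - 1 - \<alpha>\<bar>"
        using M[OF eR] by (intro mult_right_mono) (auto simp: abs_le_square_iff[symmetric])
      finally show ?thesis by (simp add: mult_ac)
    qed
    ultimately have "integral {e..\<rho>} h \<le> integral {e..\<rho>} (lap f f') + M\<^sup>2 * \<bar>N - 1 - \<alpha>\<bar> * e powr (\<kappa> - 1)"
      using eq by linarith
    then have "ennreal (integral {e..\<rho>} h) \<le> ennreal (integral {e..\<rho>} (lap f f')) + ennreal (M\<^sup>2 * \<bar>N - 1 - \<alpha>\<bar> * e powr (\<kappa> - 1))"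
      by (subst ennreal_plus[symmetric]) (auto intro!: ennreal_leI integral_nonneg il nonneg)
    also have "ennreal (integral {e..\<rho>} (lap f f')) = (\<integral>\<^sup>+r\<in>{e..\<rho>}. ennreal (lap f f' r) \<partial>lborel)"
      using sub by (intro nn_integral_Icc_eq_integral[symmetric] cont c_sub[OF f'] c_sub[OF cf] nonneg)
    also have "\<dots> \<le> ?L"
      using sub by (intro nn_integral_mono) (auto simp: indicator_def)
    also have "ennreal (integral {e..\<rho>} h) = (\<integral>\<^sup>+r\<in>{e..\<rho>}. ennreal (h r) \<partial>lborel)"
      using sub by (intro nn_integral_Icc_eq_integral[symmetric] ch h0) auto
    finally show ?thesis by (simp add: add_right_mono)
  qed
  define e where "e j = \<rho> * (1 / 2) ^ Suc j" for j :: nat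
  have e: "0 < e j" "e j < \<rho>" for j
    using \<rho> power_Suc_less_one[of "1 / 2 :: real" j] by (auto simp: e_def mult_less_cancel_left1)
  have e_lim: "e \<longlonglongrightarrow> 0"
    unfolding e_def[abs_def] by (intro tendsto_mult_right_zero LIMSEQ_Suc LIMSEQ_realpow_zero) auto
  have mono: "incseq (\<lambda>j r. ennreal (h r) * indicator {e j..\<rho>} r)"
  proof (rule incseq_SucI, rule le_funI)
    fix j r
    have "e (Suc j) \<le> e j" using \<rho> by (simp add: e_def)
    then show "ennreal (h r) * indicator {e j..\<rho>} r \<le> ennreal (h r) * indicator {e (Suc j)..\<rho>} r"
      by (auto simp: indicator_def)
  qed
  have "(\<lambda>j. \<integral>\<^sup>+r\<in>{e j..\<rho>}. ennreal (h r) \<partial>lborel) \<longlonglongrightarrow> (\<integral>\<^sup>+r\<in>{0<..<R}. ennreal (h r) \<partial>lborel)"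
  proof (rule nn_integral_LIMSEQ[OF mono])
    fix j
    show "(\<lambda>r. ennreal (h r) * indicator {e j..\<rho>} r) \<in> borel_measurable lborel"
      using e[of j] \<rho> by (intro borel_measurable_ennreal_indicator ch) auto
  next
    fix r
    show "(\<lambda>j. ennreal (h r) * indicator {e j..\<rho>} r) \<longlonglongrightarrow> ennreal (h r) * indicator {0<..<R} r"
    proof (rule tendsto_eventually)
      consider "r \<le> 0" | "0 < r" "r \<le> \<rho>" | "\<rho> < r" by linarith
      then show "\<forall>\<^sub>F j in sequentially. ennreal (h r) * indicator {e j..\<rho>} r = ennreal (h r) * indicator {0<..<R} r"
      proof cases
        case 1
        then have "\<not> e j \<le> r" for j using e(1)[of j] by linarith
        then show ?thesis using 1 by (auto simp: indicator_def)
      next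
        case 2
        have "\<forall>\<^sub>F j in sequentially. e j < r" using e_lim 2(1) by (rule order_tendstoD)
        then show ?thesis by eventually_elim (use 2 \<rho> in \<open>auto simp: indicator_def\<close>)
      next
        case 3
        then have "h r = 0" if "r < R" using f0[of r] that by (simp add: h_def grd_def pot_def)
        then show ?thesis using 3 by (auto simp: indicator_def)
      qed
    qed
  qed
  moreover have "(\<lambda>j. ?L + ennreal (M\<^sup>2 * \<bar>N - 1 - \<alpha>\<bar> * e j powr (\<kappa> - 1))) \<longlonglongrightarrow> ?L + ennreal (M\<^sup>2 * \<bar>N - 1 - \<alpha>\<bar> * 0)"
  proof (intro tendsto_add tendsto_const tendsto_ennrealI tendsto_mult)
    \<comment> \<open>The hypothesis on \<open>m\<close> gives \<open>\<kappa> - 1 > 0\<close>, so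
      the limit is zero.\<close>
    have "(\<lambda>j. e j powr (\<kappa> - 1)) \<longlonglongrightarrow> 0 powr (\<kappa> - 1)"
      using e_lim m e by (intro tendsto_powr') (auto simp: \<kappa>_def less_imp_le)
    then show "(\<lambda>j. e j powr (\<kappa> - 1)) \<longlonglongrightarrow> 0" by simp
  qed
  ultimately have "(\<integral>\<^sup>+r\<in>{0<..<R}. ennreal (h r) \<partial>lborel) \<le> ?L + ennreal (M\<^sup>2 * \<bar>N - 1 - \<alpha>\<bar> * 0)"
    by (rule LIMSEQ_le) (use bound e in blast)
  then have "(\<integral>\<^sup>+r\<in>{0<..<R}. ennreal (h r) \<partial>lborel) \<le> ?L" by simp
  moreover have "(\<integral>\<^sup>+r\<in>{0<..<R}. ennreal (h r) \<partial>lborel) =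
    ennreal C * (\<integral>\<^sup>+r\<in>{0<..<R}. ennreal (grd f r) \<partial>lborel) + ennreal c * (\<integral>\<^sup>+r\<in>{0<..<R}. ennreal (pot f r) \<partial>lborel)"
  proof -
    have "(\<integral>\<^sup>+r\<in>{0<..<R}. ennreal (h r) \<partial>lborel) =
      (\<integral>\<^sup>+r. ennreal C * (ennreal (grd f r) * indicator {0<..<R} r) + ennreal c * (ennreal (pot f r) * indicator {0<..<R} r) \<partial>lborel)"
      using C c nonneg
      by (intro nn_integral_cong) (auto simp: h_def indicator_def ennreal_plus ennreal_mult'[symmetric])
    also have "\<dots> = ennreal C * (\<integral>\<^sup>+r\<in>{0<..<R}. ennreal (grd f r) \<partial>lborel) + ennreal c * (\<integral>\<^sup>+r\<in>{0<..<R}. ennreal (pot f r) \<partial>lborel)"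
      using borel_measurable_ennreal_indicator[OF _ cont(2)[OF cf order_refl]]
        borel_measurable_ennreal_indicator[OF _ cont(3)[OF cf order_refl]]
      by (simp add: nn_integral_add nn_integral_cmult)
    finally show ?thesis .
  qed
  ultimately show ?thesis by simp
qed

end

section \<open>Approximation by radial test functions\<close>

lemma zero_on_boundary:
  fixes h :: "real \<Rightarrow> real"
  assumes "continuous_on UNIV h" "\<And>r. r \<notin> {p..q} \<Longrightarrow> h r = 0"
  shows "h p = 0" "h q = 0"
proof -
  have "h p = 0"
    by (rule continuous_constant_on_closure[of "{..<p}"])
      (use assms in \<open>auto intro: continuous_on_subset\<close>)
  moreover have "h q = 0"
    by (rule continuous_constant_on_closure[of "{q<..}"])
      (use assms in \<open>auto intro: continuous_on_subset\<close>)
  ultimately show "h p = 0" "h q = 0" by auto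
qed

lemma C1_zero_outside:
  fixes f f' :: "real \<Rightarrow> real"
  assumes d: "\<And>r. (f has_real_derivative f' r) (at r)" and c: "continuous_on UNIV f'"
    and z: "\<And>r. r \<notin> {p..q} \<Longrightarrow> f r = 0"
  shows "f p = 0" "f q = 0" "f' p = 0" "f' q = 0" "r \<notin> {p..q} \<Longrightarrow> f' r = 0"
proof -
  have cf: "continuous_on UNIV f" using DERIV_continuous_on[OF d] .
  show "f p = 0" "f q = 0" by (rule zero_on_boundary[OF cf z], assumption)+
  have z': "f' r = 0" if "r \<notin> {p..q}" for r
  proof -
    have "eventually (\<lambda>s. s \<in> - {p..q}) (nhds r)" using that by (intro eventually_nhds_in_open) auto
    then have "eventually (\<lambda>s. f s = 0) (nhds r)" by eventually_elim (auto intro: z)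
    then have "(f has_real_derivative 0) (at r)" by (rule DERIV_eventually_eq) simp
    then show ?thesis using d DERIV_unique by blast
  qed
  show "f' p = 0" "f' q = 0" by (rule zero_on_boundary[OF c z'], assumption)+
  show "r \<notin> {p..q} \<Longrightarrow> f' r = 0" by (rule z')
qed

lemma antiderivative_UNIV:
  fixes f :: "real \<Rightarrow> real"
  assumes "continuous_on UNIV f"
  obtains F where "F t0 = 0" "\<And>t. (F has_real_derivative f t) (at t)"
proof -
  have "\<exists>F. \<forall>x::real. -\<infinity> < ereal x \<longrightarrow> ereal x < \<infinity> \<longrightarrow> (F has_vector_derivative f x) (at x)"
    using assms by (intro einterval_antiderivative) (auto simp: continuous_on_eq_continuous_at)
  then obtain F where F: "\<And>t. (F has_real_derivative f t) (at t)"
    by (auto simp: has_real_derivative_iff_has_vector_derivative)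
  show thesis
  proof (rule that[of "\<lambda>t. F t - F t0"])
    show "((\<lambda>t. F t - F t0) has_real_derivative f t) (at t)" for t
      using DERIV_diff[OF F DERIV_const] by simp
  qed simp
qed

lemma square_mem_Icc_iff:
  fixes p q r :: real assumes "0 < p" "0 < q" "0 < r"
  shows "r\<^sup>2 \<in> {p\<^sup>2..q\<^sup>2} \<longleftrightarrow> r \<in> {p..q}"
  using assms by (auto simp: power_mono_iff)

text \<open>The approximating test function is \<open>u(x) = \<Psi>(\<bar>x\<bar>\<^sup>2)\<close> with \<open>\<Psi>' = \<eta> K\<close>, where \<open>\<eta>\<close> is a
  fixed smooth bump function and \<open>K\<close> is a polynomial; the variable \<open>\<bar>x\<bar>\<^sup>2\<close> makes \<open>u\<close> smooth at
  the origin as well.\<close>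

lemma radial_test_function_approximation:
  fixes f f' :: "real \<Rightarrow> real"
  assumes pq: "0 < p" "p < q" "q < R"
    and f: "\<And>r. (f has_real_derivative f' r) (at r)" and f': "continuous_on UNIV f'"
    and z: "\<And>r. r \<notin> {p..q} \<Longrightarrow> f r = 0"
  obtains \<alpha> \<beta> M where "0 < \<alpha>" "\<alpha> < p" "q < \<beta>" "\<beta> < R" "M \<ge> 0"
    "\<And>\<epsilon>. \<epsilon> > 0 \<Longrightarrow> \<exists>(u :: 'a::euclidean_space \<Rightarrow> real) \<phi> F F'. test_function R u \<and> (\<forall>x. u x = \<phi> (norm x)) \<and>
      (\<forall>r. (\<phi> has_real_derivative F r) (at r)) \<and> (\<forall>r. (F has_real_derivative F' r) (at r)) \<and>
      continuous_on UNIV F' \<and> (\<forall>r>0. r \<notin> {\<alpha>..\<beta>} \<longrightarrow> F r = 0 \<and> F' r = 0) \<and>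
      (\<forall>r\<in>{\<alpha>..\<beta>}. \<bar>F r - f r\<bar> \<le> M * \<epsilon> \<and> \<bar>F' r - f' r\<bar> \<le> M * \<epsilon>)"
proof -
  note fz = C1_zero_outside[OF f f' z]
  \<comment> \<open>Leaves room around \<open>{p..q}\<close> inside (0,R), so that the bump can be
    positive on all of \<open>{p\<^sup>2..q\<^sup>2}\<close> and be divided by there.\<close>
  define \<alpha> \<beta> where "\<alpha> = p / 2" and "\<beta> = (q + R) / 2"
  have ab: "0 < \<alpha>" "\<alpha> < p" "q < \<beta>" "\<beta> < R" "\<alpha> < \<beta>" using pq by (auto simp: \<alpha>_def \<beta>_def)
  have sq: "0 < \<alpha>\<^sup>2" "\<alpha>\<^sup>2 < p\<^sup>2" "p\<^sup>2 < q\<^sup>2" "q\<^sup>2 < \<beta>\<^sup>2"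
    using ab pq by (auto intro!: power_strict_mono)
  \<comment> \<open>Positive exactly between \<open>\<alpha>\<^sup>2\<close> and
    \<open>\<beta>\<^sup>2\<close>; it is written with sums and scalar multiples to match the
    closure rules for \<open>C_k\<close>.\<close>
  define b where "b s = (s + - \<alpha>\<^sup>2) * (\<beta>\<^sup>2 + (- 1) * s)" for s
  define \<eta> \<eta>' where "\<eta> s = flat_exp 0 (b s)" and "\<eta>' s = flat_exp 2 (b s) * (\<alpha>\<^sup>2 + \<beta>\<^sup>2 - 2 * s)" for s
  have d\<eta>: "(\<eta> has_real_derivative \<eta>' s) (at s)" for s
  proof -
    have "(b has_real_derivative (\<alpha>\<^sup>2 + \<beta>\<^sup>2 - 2 * s)) (at s)"
      unfolding b_def[abs_def] by (auto intro!: derivative_eq_intros simp: algebra_simps)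
    from DERIV_chain2[OF flat_exp_deriv[of 0] this] show ?thesis
      by (simp add: \<eta>_def[abs_def] \<eta>'_def numeral_2_eq_2)
  qed
  have Ck_b: "C_k k b" for k
    unfolding b_def[abs_def]
    by (rule C_k_mult; rule C_k_add; (rule C_k_const | rule C_k_linear, rule bounded_linear_ident | rule C_k_linear, rule bounded_linear_mult_right))
  have Ck_\<eta>: "C_k k \<eta>" for k
    unfolding \<eta>_def[abs_def] by (rule C_k_compose[OF C_k_flat_exp Ck_b])
  have c\<eta>: "continuous_on S \<eta>" "continuous_on S \<eta>'" for S
  proof -
    show "continuous_on S \<eta>"
      by (rule DERIV_continuous_on[OF has_field_derivative_at_within[OF d\<eta>]])
    have "continuous_on S (\<lambda>s. flat_exp 2 (b s))"
      using C_k_compose[OF C_k_flat_exp[of 0 2] Ck_b[of 0]] by (auto intro: continuous_on_subset)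
    then show "continuous_on S \<eta>'" unfolding \<eta>'_def[abs_def] by (intro continuous_intros)
  qed
  have b_out: "b s \<le> 0" if "s \<notin> {\<alpha>\<^sup>2<..<\<beta>\<^sup>2}" for s
    using that sq by (auto simp: b_def mult_le_0_iff)
  have \<eta>_out: "\<eta> s = 0" "\<eta>' s = 0" if "s \<notin> {\<alpha>\<^sup>2<..<\<beta>\<^sup>2}" for s
    using b_out[OF that] by (auto simp: \<eta>_def \<eta>'_def flat_exp_def)
  have \<eta>_pos: "\<eta> s > 0" if "s \<in> {p\<^sup>2..q\<^sup>2}" for s
    using that sq by (auto simp: \<eta>_def flat_exp_def b_def zero_less_mult_iff)
  \<comment> \<open>\<open>D s\<close> is the factor \<open>2 * r * \<eta> (r\<^sup>2)\<close> at
    \<open>r = sqrt s\<close>. Dividing by it yields the function \<open>k\<close> for which the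
    exact profile \<open>f\<close> has the shape of the profiles \<open>F\<close> below, with
    \<open>k\<close> in place of \<open>K\<close>.\<close>
  define D D' where "D s = 2 * sqrt s * \<eta> s" and "D' s = \<eta> s / sqrt s + 2 * sqrt s * \<eta>' s" for s
  define k0 k0' where "k0 s = f (sqrt s) / D s"
    and "k0' s = (f' (sqrt s) * (1 / (2 * sqrt s)) * D s - f (sqrt s) * D' s) / (D s * D s)" for s
  define k k' where "k s = (if s \<in> {p\<^sup>2..q\<^sup>2} then k0 s else 0)"
    and "k' s = (if s \<in> {p\<^sup>2..q\<^sup>2} then k0' s else 0)" for s
  have spos: "s > 0" if "s \<in> {p\<^sup>2..q\<^sup>2}" for s
  proof -
    have "p\<^sup>2 \<le> s" using that by simp
    then show ?thesis using sq by linarith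
  qed
  have D0: "D s \<noteq> 0" if "s \<in> {p\<^sup>2..q\<^sup>2}" for s
    using \<eta>_pos[OF that] spos[OF that] by (simp add: D_def)
  have dk0: "(k0 has_real_derivative k0' s) (at s)" if s: "s \<in> {p\<^sup>2..q\<^sup>2}" for s
  proof -
    have dsq: "(sqrt has_real_derivative 1 / (2 * sqrt s)) (at s)"
      by (rule DERIV_cong[OF DERIV_real_sqrt[OF spos[OF s]]]) (simp add: field_simps)
    have "(D has_real_derivative D' s) (at s)"
      unfolding D_def[abs_def] D'_def
      using spos[OF s] by (auto intro!: derivative_eq_intros dsq d\<eta> simp: field_simps)
    from DERIV_divide[OF DERIV_chain2[OF f dsq] this D0[OF s]]
    show ?thesis by (simp add: k0_def[abs_def] k0'_def)
  qed
  have cf: "continuous_on UNIV f" using DERIV_continuous_on[OF f] .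
  have ck0': "continuous_on {p\<^sup>2..q\<^sup>2} k0'"
  proof -
    have "continuous_on {p\<^sup>2..q\<^sup>2} (\<lambda>s. f (sqrt s))" "continuous_on {p\<^sup>2..q\<^sup>2} (\<lambda>s. f' (sqrt s))"
      by (rule continuous_on_compose2[OF cf] continuous_on_compose2[OF f']; auto intro!: continuous_intros)+
    then show ?thesis
      unfolding k0'_def[abs_def]
      using D0 spos by (intro continuous_intros) (auto simp: D_def D'_def intro!: continuous_intros c\<eta>)
  qed
  have kz: "k0 (p\<^sup>2) = 0" "k0 (q\<^sup>2) = 0" "k0' (p\<^sup>2) = 0" "k0' (q\<^sup>2) = 0"
    using fz pq by (auto simp: k0_def k0'_def)
  have dk: "(k has_real_derivative k' s) (at s)" for s
    unfolding k_def[abs_def] k'_def by (rule DERIV_cutoff[OF dk0 kz]) (use sq in auto)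
  have ck': "continuous_on UNIV k'"
    unfolding k'_def[abs_def] by (rule continuous_on_cutoff[OF ck0' kz(3,4)]) (use sq in auto)
  have f_eq: "f r = 2 * r * \<eta> (r\<^sup>2) * k (r\<^sup>2)" if "r > 0" for r
  proof (cases "r \<in> {p..q}")
    case True
    then have *: "r\<^sup>2 \<in> {p\<^sup>2..q\<^sup>2}" using square_mem_Icc_iff[of p q r] pq that by auto
    then show ?thesis using \<eta>_pos[OF *] that by (simp add: k_def k0_def D_def)
  next
    case False
    then have "r\<^sup>2 \<notin> {p\<^sup>2..q\<^sup>2}" using square_mem_Icc_iff[of p q r] pq that by auto
    then show ?thesis using z[OF False] by (auto simp: k_def)
  qed
  have dsq: "((\<lambda>r. g (r\<^sup>2)) has_real_derivative d * (2 * r)) (at r)"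
    if "(g has_real_derivative d) (at (r\<^sup>2))" for g d and r :: real
    by (rule DERIV_cong[OF DERIV_chain2[OF that DERIV_power[OF DERIV_ident, of 2]]]) simp
  have prof: "((\<lambda>r. 2 * r * (\<eta> (r\<^sup>2) * g (r\<^sup>2))) has_real_derivative
      4 * r\<^sup>2 * (\<eta>' (r\<^sup>2) * g (r\<^sup>2) + \<eta> (r\<^sup>2) * d) + 2 * (\<eta> (r\<^sup>2) * g (r\<^sup>2))) (at r)"
    if "(g has_real_derivative d) (at (r\<^sup>2))" for g d and r :: real
    by (rule DERIV_cong[OF DERIV_mult[OF DERIV_cmult[OF DERIV_ident] DERIV_mult[OF dsq[OF d\<eta>] dsq[OF that]]]])
      (simp add: algebra_simps power2_eq_square)
  have f'_eq: "f' r = 4 * r\<^sup>2 * (\<eta>' (r\<^sup>2) * k (r\<^sup>2) + \<eta> (r\<^sup>2) * k' (r\<^sup>2)) + 2 * (\<eta> (r\<^sup>2) * k (r\<^sup>2))"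
    if "r > 0" for r
  proof (rule DERIV_unique[OF f])
    have "eventually (\<lambda>s. s \<in> {0<..}) (nhds r)" using that by (intro eventually_nhds_in_open) auto
    then have "eventually (\<lambda>s. f s = 2 * s * (\<eta> (s\<^sup>2) * k (s\<^sup>2))) (nhds r)"
      by eventually_elim (simp add: f_eq)
    then show "(f has_real_derivative 4 * r\<^sup>2 * (\<eta>' (r\<^sup>2) * k (r\<^sup>2) + \<eta> (r\<^sup>2) * k' (r\<^sup>2)) + 2 * (\<eta> (r\<^sup>2) * k (r\<^sup>2))) (at r)"
      by (rule DERIV_eventually_eq) (rule prof[OF dk])
  qed
  have "compact (\<eta> ` {\<alpha>\<^sup>2..\<beta>\<^sup>2} \<union> \<eta>' ` {\<alpha>\<^sup>2..\<beta>\<^sup>2})"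
    by (intro compact_Un compact_continuous_image c\<eta> compact_Icc)
  then obtain X0 where "\<forall>x\<in>\<eta> ` {\<alpha>\<^sup>2..\<beta>\<^sup>2} \<union> \<eta>' ` {\<alpha>\<^sup>2..\<beta>\<^sup>2}. norm x \<le> X0"
    using compact_imp_bounded[THEN bounded_iff[THEN iffD1]] by fast
  then have X0: "\<And>s. s \<in> {\<alpha>\<^sup>2..\<beta>\<^sup>2} \<Longrightarrow> \<bar>\<eta> s\<bar> \<le> X0 \<and> \<bar>\<eta>' s\<bar> \<le> X0" by auto
  define X where "X = max X0 0"
  have X: "\<And>s. s \<in> {\<alpha>\<^sup>2..\<beta>\<^sup>2} \<Longrightarrow> \<bar>\<eta> s\<bar> \<le> X \<and> \<bar>\<eta>' s\<bar> \<le> X" "X \<ge> 0"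
    using X0 by (force simp: X_def)+
  \<comment> \<open>The sum of the bounds for \<open>F - f\<close> and \<open>F' - f'\<close> with
    \<open>\<epsilon>\<close> divided out, from \<open>r \<le> \<beta>\<close>, the bound
    \<open>X\<close> on \<open>\<eta>\<close> and \<open>\<eta>'\<close>, and the errors
    \<open>\<epsilon> * \<beta>\<^sup>2\<close> of \<open>K\<close> and \<open>\<epsilon>\<close> of
    \<open>P\<close>.\<close>
  define M where "M = 2 * \<beta> * (X * \<beta>\<^sup>2) + (4 * \<beta>\<^sup>2 * (X * \<beta>\<^sup>2 + X) + 2 * (X * \<beta>\<^sup>2))"
  have M: "M \<ge> 0" using X ab by (simp add: M_def)
  have "\<exists>(u :: 'a \<Rightarrow> real) \<phi> F F'. test_function R u \<and> (\<forall>x. u x = \<phi> (norm x)) \<and>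
      (\<forall>r. (\<phi> has_real_derivative F r) (at r)) \<and> (\<forall>r. (F has_real_derivative F' r) (at r)) \<and>
      continuous_on UNIV F' \<and> (\<forall>r>0. r \<notin> {\<alpha>..\<beta>} \<longrightarrow> F r = 0 \<and> F' r = 0) \<and>
      (\<forall>r\<in>{\<alpha>..\<beta>}. \<bar>F r - f r\<bar> \<le> M * \<epsilon> \<and> \<bar>F' r - f' r\<bar> \<le> M * \<epsilon>)" if \<epsilon>: "\<epsilon> > 0" for \<epsilon>
  proof -
    obtain P where P: "real_polynomial_function P" "\<And>s. s \<in> {\<alpha>\<^sup>2..\<beta>\<^sup>2} \<Longrightarrow> \<bar>k' s - P s\<bar> < \<epsilon>"
      using Stone_Weierstrass_real_polynomial_function[OF compact_Icc continuous_on_subset[OF ck' subset_UNIV] \<epsilon>] by blast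
    have Ck_P: "C_k j P" for j using P(1) by (rule C_k_polynomial)
    have cP: "continuous_on UNIV P" using Ck_P[of 0] by simp
    \<comment> \<open>Approximating \<open>k'\<close> and integrating controls function and
      derivative together; \<open>k\<close> also vanishes at \<open>\<alpha>\<^sup>2\<close>, so no
      constant of integration is left.\<close>
    obtain K where K: "K (\<alpha>\<^sup>2) = 0" "\<And>s. (K has_real_derivative P s) (at s)"
      using antiderivative_UNIV[OF cP] by blast
    have Ck_K: "C_k j K" for j using K(2) Ck_P by (rule C_k_antiderivative)
    have Kk: "\<bar>K s - k s\<bar> \<le> \<epsilon> * \<beta>\<^sup>2" if s: "s \<in> {\<alpha>\<^sup>2..\<beta>\<^sup>2}" for s
    proof -
      have "\<bar>(\<lambda>s. K s - k s) s\<bar> \<le> \<epsilon> * \<bar>s - \<alpha>\<^sup>2\<bar> ^ Suc 0 / Suc 0"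
      proof (rule power_bound_antiderivative[where f = "\<lambda>s. P s - k' s" and p = "\<alpha>\<^sup>2" and q = "\<beta>\<^sup>2"])
        show "((\<lambda>s. K s - k s) has_real_derivative P s - k' s) (at s)" for s
          by (rule DERIV_diff[OF K(2) dk])
        show "\<bar>P s - k' s\<bar> \<le> \<epsilon> * \<bar>s - \<alpha>\<^sup>2\<bar> ^ 0" if "s \<in> {\<alpha>\<^sup>2..\<beta>\<^sup>2}" for s
          using P(2)[OF that] by (simp add: abs_minus_commute)
        show "K (\<alpha>\<^sup>2) - k (\<alpha>\<^sup>2) = 0" using K(1) sq by (simp add: k_def)
      qed (use s sq in auto)
      also have "\<dots> \<le> \<epsilon> * \<beta>\<^sup>2"
      proof -
        have "\<alpha>\<^sup>2 \<le> s" "s \<le> \<beta>\<^sup>2" using s by auto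
        then have "\<bar>s - \<alpha>\<^sup>2\<bar> \<le> \<beta>\<^sup>2" using sq by linarith
        then show ?thesis using \<epsilon> by (simp add: mult_left_mono)
      qed
      finally show ?thesis .
    qed
    define h h' where "h s = \<eta> s * K s" and "h' s = \<eta>' s * K s + \<eta> s * P s" for s
    have Ck_h: "C_k j h" for j unfolding h_def[abs_def] by (rule C_k_mult[OF Ck_\<eta> Ck_K])
    have ch: "continuous_on UNIV h" using Ck_h[of 0] by simp
    \<comment> \<open>Normalised at the outer end, so that \<open>\<Psi>\<close> is zero beyond
      \<open>\<beta>\<^sup>2\<close>. Near the origin it is merely constant, which is compatible
      with compact support in the ball.\<close>
    obtain \<Psi> where \<Psi>: "\<Psi> (\<beta>\<^sup>2) = 0" "\<And>s. (\<Psi> has_real_derivative h s) (at s)"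
      using antiderivative_UNIV[OF ch] by blast
    have Ck_\<Psi>: "C_k j \<Psi>" for j using \<Psi>(2) Ck_h by (rule C_k_antiderivative)
    have \<Psi>_out: "\<Psi> s = 0" if "s \<ge> \<beta>\<^sup>2" for s
    proof (cases "s = \<beta>\<^sup>2")
      case False
      have "\<Psi> s = \<Psi> (\<beta>\<^sup>2)"
      proof (rule DERIV_isconst2[of "\<beta>\<^sup>2" s])
        show "continuous_on {\<beta>\<^sup>2..s} \<Psi>"
          by (rule DERIV_continuous_on[OF has_field_derivative_at_within[OF \<Psi>(2)]])
        show "(\<Psi> has_real_derivative 0) (at x)" if "\<beta>\<^sup>2 < x" for x
          using \<Psi>(2)[of x] \<eta>_out(1)[of x] that by (simp add: h_def)
      qed (use that False in auto)
      then show ?thesis using \<Psi>(1) by simp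
    qed (simp add: \<Psi>(1))
    define u :: "'a \<Rightarrow> real" where "u x = \<Psi> (x \<bullet> x)" for x
    define F F' where "F r = 2 * r * (\<eta> (r\<^sup>2) * K (r\<^sup>2))"
      and "F' r = 4 * r\<^sup>2 * (\<eta>' (r\<^sup>2) * K (r\<^sup>2) + \<eta> (r\<^sup>2) * P (r\<^sup>2)) + 2 * (\<eta> (r\<^sup>2) * K (r\<^sup>2))" for r
    have "test_function R u"
      unfolding test_function_def
    proof
      show "\<forall>k. C_k k u" unfolding u_def[abs_def] by (intro allI C_k_compose[OF Ck_\<Psi> C_k_inner_self])
      have "{x. u x \<noteq> 0} \<subseteq> cball 0 \<beta>"
      proof
        fix x assume "x \<in> {x. u x \<noteq> 0}"
        then have "\<not> (norm x)\<^sup>2 \<ge> \<beta>\<^sup>2" using \<Psi>_out by (auto simp: u_def power2_norm_eq_inner)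
        then have "norm x < \<beta>" using power_mono[of \<beta> "norm x" 2] ab by linarith
        then show "x \<in> cball 0 \<beta>" by simp
      qed
      then have "closure {x. u x \<noteq> 0} \<subseteq> cball 0 \<beta>" by (rule closure_minimal) simp
      then show "closure {x. u x \<noteq> 0} \<subseteq> ball 0 R" using ab by auto
    qed
    moreover have "u x = \<Psi> ((norm x)\<^sup>2)" for x by (simp add: u_def power2_norm_eq_inner)
    moreover have "((\<lambda>r. \<Psi> (r\<^sup>2)) has_real_derivative F r) (at r)" for r
      by (rule DERIV_cong[OF dsq[OF \<Psi>(2)]]) (simp add: F_def h_def)
    moreover have "(F has_real_derivative F' r) (at r)" for r
      unfolding F_def[abs_def] F'_def by (rule prof[OF K(2)])
    moreover have "continuous_on UNIV F'"
    proof -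
      have *: "continuous_on UNIV (\<lambda>r. g (r\<^sup>2))" if "continuous_on UNIV g" for g :: "real \<Rightarrow> real"
        by (rule continuous_on_compose2[OF that]) (auto intro!: continuous_intros)
      have cK: "continuous_on UNIV K" using Ck_K[of 0] by simp
      show ?thesis unfolding F'_def[abs_def]
        by (intro continuous_intros *[OF c\<eta>(1)] *[OF c\<eta>(2)] *[OF cP] *[OF cK])
    qed
    moreover have "F r = 0 \<and> F' r = 0" if "r > 0" "r \<notin> {\<alpha>..\<beta>}" for r
    proof -
      have "r\<^sup>2 \<notin> {\<alpha>\<^sup>2..\<beta>\<^sup>2}"
        using ab that by (subst square_mem_Icc_iff) simp_all
      then have "r\<^sup>2 \<notin> {\<alpha>\<^sup>2<..<\<beta>\<^sup>2}" by auto
      then show ?thesis using \<eta>_out by (simp add: F_def F'_def)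
    qed
    moreover have "\<bar>F r - f r\<bar> \<le> M * \<epsilon> \<and> \<bar>F' r - f' r\<bar> \<le> M * \<epsilon>" if r: "r \<in> {\<alpha>..\<beta>}" for r
    proof -
      have r0: "0 < r" "r \<le> \<beta>" using r ab by auto
      have s: "r\<^sup>2 \<in> {\<alpha>\<^sup>2..\<beta>\<^sup>2}" using square_mem_Icc_iff[of \<alpha> \<beta> r] ab r r0 by auto
      have r2: "r\<^sup>2 \<le> \<beta>\<^sup>2" using s by simp
      define \<delta> \<delta>' where "\<delta> = K (r\<^sup>2) - k (r\<^sup>2)" and "\<delta>' = P (r\<^sup>2) - k' (r\<^sup>2)"
      have \<delta>: "\<bar>\<delta>\<bar> \<le> \<epsilon> * \<beta>\<^sup>2" "\<bar>\<delta>'\<bar> \<le> \<epsilon>"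
        using Kk[OF s] P(2)[OF s] by (auto simp: \<delta>_def \<delta>'_def abs_minus_commute)
      have \<eta>\<delta>: "\<bar>\<eta> (r\<^sup>2) * \<delta>\<bar> \<le> X * (\<epsilon> * \<beta>\<^sup>2)" "\<bar>\<eta>' (r\<^sup>2) * \<delta>\<bar> \<le> X * (\<epsilon> * \<beta>\<^sup>2)" "\<bar>\<eta> (r\<^sup>2) * \<delta>'\<bar> \<le> X * \<epsilon>"
        unfolding abs_mult using X(1)[OF s] X(2) \<delta> by (auto intro: mult_mono)
      have "F r - f r = 2 * r * (\<eta> (r\<^sup>2) * \<delta>)"
        by (simp add: F_def f_eq[OF r0(1)] \<delta>_def algebra_simps)
      then have "\<bar>F r - f r\<bar> = 2 * r * \<bar>\<eta> (r\<^sup>2) * \<delta>\<bar>" using r0 by (simp add: abs_mult)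
      also have "\<dots> \<le> 2 * \<beta> * (X * (\<epsilon> * \<beta>\<^sup>2))"
        using r0 ab \<eta>\<delta> by (intro mult_mono) auto
      also have "\<dots> \<le> M * \<epsilon>"
      proof -
        have "0 \<le> (4 * \<beta>\<^sup>2 * (X * \<beta>\<^sup>2 + X) + 2 * (X * \<beta>\<^sup>2)) * \<epsilon>" using X \<epsilon> by simp
        then show ?thesis by (simp add: M_def algebra_simps)
      qed
      finally have 1: "\<bar>F r - f r\<bar> \<le> M * \<epsilon>" .
      have "F' r - f' r = 4 * r\<^sup>2 * (\<eta>' (r\<^sup>2) * \<delta> + \<eta> (r\<^sup>2) * \<delta>') + 2 * (\<eta> (r\<^sup>2) * \<delta>)"
        by (simp add: F'_def f'_eq[OF r0(1)] \<delta>_def \<delta>'_def algebra_simps)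
      also have "\<bar>\<dots>\<bar> \<le> 4 * r\<^sup>2 * \<bar>\<eta>' (r\<^sup>2) * \<delta> + \<eta> (r\<^sup>2) * \<delta>'\<bar> + 2 * \<bar>\<eta> (r\<^sup>2) * \<delta>\<bar>"
        by (rule order_trans[OF abs_triangle_ineq]) (simp add: abs_mult)
      also have "\<dots> \<le> 4 * \<beta>\<^sup>2 * (X * (\<epsilon> * \<beta>\<^sup>2) + X * \<epsilon>) + 2 * (X * (\<epsilon> * \<beta>\<^sup>2))"
        using r2 \<eta>\<delta> by (intro add_mono mult_mono order_trans[OF abs_triangle_ineq]) auto
      also have "\<dots> \<le> M * \<epsilon>"
      proof -
        have "0 \<le> 2 * \<beta> * (X * \<beta>\<^sup>2) * \<epsilon>" using X \<epsilon> ab by simp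
        then show ?thesis by (simp add: M_def algebra_simps)
      qed
      finally show ?thesis using 1 by simp
    qed
    ultimately show ?thesis
      by (intro exI[of _ u] exI[of _ "\<lambda>r. \<Psi> (r\<^sup>2)"] exI[of _ F] exI[of _ F']) blast
  qed
  then show thesis using that ab M by blast
qed

section \<open>The inequality and its sharpness\<close>

lemma integral_Icc_superset:
  fixes h :: "real \<Rightarrow> real"
  assumes "continuous_on {p..q} h" "{p..q} \<subseteq> {a..b}" "\<And>r. r \<notin> {p..q} \<Longrightarrow> h r = 0"
  shows "integral {a..b} h = integral {p..q} h"
proof (rule integral_unique, rule has_integral_on_superset[where S = "{p..q}"])
  show "(h has_integral integral {p..q} h) {p..q}"
    by (intro integrable_integral integrable_continuous_interval assms)
qed (use assms in auto)

lemma set_nn_integral_Ioo_eq_integral: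
  fixes h :: "real \<Rightarrow> real"
  assumes "continuous_on {a..b} h" "\<And>r. r \<in> {a..b} \<Longrightarrow> h r \<ge> 0"
    and "{a..b} \<subseteq> {0<..<R}" "\<And>r. r \<in> {0<..<R} \<Longrightarrow> r \<notin> {a..b} \<Longrightarrow> h r = 0"
  shows "(\<integral>\<^sup>+r\<in>{0<..<R}. ennreal (h r) \<partial>lborel) = ennreal (integral {a..b} h)"
proof -
  have "(\<integral>\<^sup>+r\<in>{0<..<R}. ennreal (h r) \<partial>lborel) = (\<integral>\<^sup>+r\<in>{a..b}. ennreal (h r) \<partial>lborel)"
    using assms(3,4) by (intro nn_integral_cong) (auto simp: indicator_def)
  also have "\<dots> = ennreal (integral {a..b} h)"
    by (rule nn_integral_Icc_eq_integral[OF assms(1,2)])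
  finally show ?thesis .
qed

text \<open>Transfers the inequality from every admissible \<open>c\<close> to the weight, which may
  be infinite: multiplication by \<open>Y\<close> and, for nonempty \<open>S\<close>, addition of
  \<open>X\<close> commute with suprema.\<close>

lemma add_Sup_mult_ennreal_le:
  fixes X Y Z :: ennreal
  assumes "S \<noteq> {}" "\<And>c. c \<in> S \<Longrightarrow> X + c * Y \<le> Z"
  shows "X + Sup S * Y \<le> Z"
proof (cases "X = top")
  case True
  then show ?thesis using assms by fastforce
next
  case False
  have "Sup S * Y = (SUP c\<in>S. c * Y)"
    using SUP_mult_right_ennreal[of "\<lambda>c. c" S Y] by simp
  also have "X + (SUP c\<in>S. c * Y) = (SUP c\<in>S. X + c * Y)"
    by (rule ennreal_SUP_add_right[OF assms(1)])
  also have "\<dots> \<le> Z" by (intro SUP_least assms)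
  finally show ?thesis .
qed

lemma (in radial_hardy) radial_functionals:
  fixes u :: "'a::euclidean_space \<Rightarrow> real"
  assumes dim: "N = real DIM('a)" and u: "\<And>x. u x = \<phi> (norm x)"
    and \<phi>: "\<forall>r>0. (\<phi> has_real_derivative f r) (at r)"
    and f: "\<forall>r>0. (f has_real_derivative f' r) (at r)"
    and f': "continuous_on {0<..<R} f'"
  shows "(\<integral>\<^sup>+x\<in>ball 0 R. ennreal (\<bar>laplacian u x\<bar>\<^sup>2 / norm x powr (2 * m)) \<partial>lborel)
      = ennreal (DIM('a) * unit_ball_vol DIM('a)) * (\<integral>\<^sup>+r\<in>{0<..<R}. ennreal (lap f f' r) \<partial>lborel)" (is ?L)
    and "(\<integral>\<^sup>+x\<in>ball 0 R. ennreal ((norm (grad u x))\<^sup>2 / norm x powr (2 * m + 2)) \<partial>lborel)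
      = ennreal (DIM('a) * unit_ball_vol DIM('a)) * (\<integral>\<^sup>+r\<in>{0<..<R}. ennreal (grd f r) \<partial>lborel)" (is ?G)
    and "(\<integral>\<^sup>+x\<in>ball 0 R. ennreal (W (norm x) * ((norm (grad u x))\<^sup>2 / norm x powr (2 * m))) \<partial>lborel)
      = ennreal (DIM('a) * unit_ball_vol DIM('a)) * (\<integral>\<^sup>+r\<in>{0<..<R}. ennreal (pot f r) \<partial>lborel)" (is ?P)
proof -
  note der = radial_derivatives[of u \<phi> f f', OF u \<phi>[rule_format] f[rule_format]]
  have cf: "continuous_on {0<..<R} f"
    by (rule DERIV_continuous_on[OF has_field_derivative_at_within]) (use f in auto)
  have pw: "r ^ (DIM('a) - 1) / r powr e = r powr (N - 1 - e)" if "r > 0" for r e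
    using that by (simp add: powr_diff powr_realpow[symmetric] dim of_nat_diff)
  have cpw: "continuous_on {0<..<R} (\<lambda>r. r powr e)" for e by (intro continuous_intros) auto
  have c1: "continuous_on {0<..<R} (\<lambda>r. (f' r + (N - 1) / r * f r)\<^sup>2 / r powr (2 * m))"
    by (intro continuous_intros f' cf cpw) auto
  have c2: "continuous_on {0<..<R} (\<lambda>r. (f r)\<^sup>2 / r powr (2 * m + 2))"
    by (intro continuous_intros cf cpw) auto
  have c3: "continuous_on {0<..<R} (\<lambda>r. W r * ((f r)\<^sup>2 / r powr (2 * m)))"
    by (intro continuous_intros cf cont_W cpw) auto
  have e: "\<forall>r>0. (f' r + (N - 1) / r * f r)\<^sup>2 / r powr (2 * m) * r ^ (DIM('a) - 1) = lap f f' r"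
    "\<forall>r>0. (f r)\<^sup>2 / r powr (2 * m + 2) * r ^ (DIM('a) - 1) = grd f r"
    "\<forall>r>0. W r * ((f r)\<^sup>2 / r powr (2 * m)) * r ^ (DIM('a) - 1) = pot f r"
  proof -
    have "x / d * y = x * (y / d)" "w * (x / d) * y = w * x * (y / d)" for w x y d :: real by simp_all
    note swap = this
    show "\<forall>r>0. (f' r + (N - 1) / r * f r)\<^sup>2 / r powr (2 * m) * r ^ (DIM('a) - 1) = lap f f' r"
      by (intro allI impI) (simp only: swap(1) pw lap_def \<kappa>_def)
    show "\<forall>r>0. (f r)\<^sup>2 / r powr (2 * m + 2) * r ^ (DIM('a) - 1) = grd f r"
      by (intro allI impI) (simp only: swap(1) pw grd_def \<kappa>_def, simp add: algebra_simps)
    show "\<forall>r>0. W r * ((f r)\<^sup>2 / r powr (2 * m)) * r ^ (DIM('a) - 1) = pot f r"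
      by (intro allI impI) (simp only: swap(2) pw pot_def \<kappa>_def)
  qed
  have cong: "(\<integral>\<^sup>+r\<in>{0<..<R}. ennreal (h r * r ^ (DIM('a) - 1)) \<partial>lborel) = (\<integral>\<^sup>+r\<in>{0<..<R}. ennreal (k r) \<partial>lborel)"
    if "\<forall>r>0. h r * r ^ (DIM('a) - 1) = k r" for h k :: "real \<Rightarrow> real"
    using that by (intro nn_integral_cong) (auto simp: indicator_def)
  have "(\<integral>\<^sup>+x\<in>ball 0 R. ennreal (\<bar>laplacian u x\<bar>\<^sup>2 / norm x powr (2 * m)) \<partial>lborel)
      = ennreal (DIM('a) * unit_ball_vol DIM('a)) *
        (\<integral>\<^sup>+r\<in>{0<..<R}. ennreal ((f' r + (N - 1) / r * f r)\<^sup>2 / r powr (2 * m) * r ^ (DIM('a) - 1)) \<partial>lborel)"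
    by (rule nn_integral_radial_ball[OF c1]) (simp add: der(2) dim)
  also note cong[OF e(1)]
  finally show ?L by simp
  have "(\<integral>\<^sup>+x\<in>ball 0 R. ennreal ((norm (grad u x))\<^sup>2 / norm x powr (2 * m + 2)) \<partial>lborel)
      = ennreal (DIM('a) * unit_ball_vol DIM('a)) *
        (\<integral>\<^sup>+r\<in>{0<..<R}. ennreal ((f r)\<^sup>2 / r powr (2 * m + 2) * r ^ (DIM('a) - 1)) \<partial>lborel)"
    by (rule nn_integral_radial_ball[OF c2]) (simp add: der(1))
  also note cong[OF e(2)]
  finally show ?G by simp
  have "(\<integral>\<^sup>+x\<in>ball 0 R. ennreal (W (norm x) * ((norm (grad u x))\<^sup>2 / norm x powr (2 * m))) \<partial>lborel)
      = ennreal (DIM('a) * unit_ball_vol DIM('a)) *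
        (\<integral>\<^sup>+r\<in>{0<..<R}. ennreal (W r * ((f r)\<^sup>2 / r powr (2 * m)) * r ^ (DIM('a) - 1)) \<partial>lborel)"
    by (rule nn_integral_radial_ball[OF c3]) (simp add: der(1))
  also note cong[OF e(3)]
  finally show ?P by simp
qed

text \<open>All three integrals carry the area of the unit sphere as a factor; it is positive and
  finite, so it cancels even when the integrals or constants are infinite.\<close>

lemma (in radial_hardy) hardy_rellich_iff_1d:
  fixes u :: "'a::euclidean_space \<Rightarrow> real" and A B :: ennreal
  assumes dim: "N = real DIM('a)" and u: "\<And>x. u x = \<phi> (norm x)"
    and \<phi>: "\<forall>r>0. (\<phi> has_real_derivative f r) (at r)"
    and f: "\<forall>r>0. (f has_real_derivative f' r) (at r)"
    and f': "continuous_on {0<..<R} f'"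
  shows "A * (\<integral>\<^sup>+x\<in>ball 0 R. ennreal ((norm (grad u x))\<^sup>2 / norm x powr (2 * m + 2)) \<partial>lborel)
          + B * (\<integral>\<^sup>+x\<in>ball 0 R. ennreal (W (norm x) * ((norm (grad u x))\<^sup>2 / norm x powr (2 * m))) \<partial>lborel)
        \<le> (\<integral>\<^sup>+x\<in>ball 0 R. ennreal (\<bar>laplacian u x\<bar>\<^sup>2 / norm x powr (2 * m)) \<partial>lborel)
    \<longleftrightarrow> A * (\<integral>\<^sup>+r\<in>{0<..<R}. ennreal (grd f r) \<partial>lborel) + B * (\<integral>\<^sup>+r\<in>{0<..<R}. ennreal (pot f r) \<partial>lborel)
      \<le> (\<integral>\<^sup>+r\<in>{0<..<R}. ennreal (lap f f' r) \<partial>lborel)"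
proof -
  define K where "K = ennreal (DIM('a) * unit_ball_vol DIM('a))"
  have K: "K \<noteq> 0" "K < top" by (auto simp: K_def unit_ball_vol_pos ennreal_eq_0_iff not_le)
  have "A * (K * X) + B * (K * Y) \<le> K * Z \<longleftrightarrow> A * X + B * Y \<le> Z" for X Y Z
  proof -
    have "A * (K * X) + B * (K * Y) = K * (A * X + B * Y)"
      by (simp add: distrib_left mult_ac)
    then show ?thesis using K by (simp add: ennreal_mult_le_mult_iff)
  qed
  then show ?thesis
    unfolding radial_functionals[OF dim u \<phi> f f'] K_def[symmetric] .
qed

text \<open>The profile is the restriction of \<open>u\<close> to a full line along a basis vector,
  so it is differentiable at 0 without one-sided limits. The radius \<open>\<rho>\<close> lies
  strictly between the largest norm in the compact support and \<open>R\<close>.\<close>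

lemma radial_profile:
  fixes u :: "'a::euclidean_space \<Rightarrow> real"
  assumes u: "test_function R u" "radial u" and R: "R > 0"
  obtains \<phi> f f' \<rho> where "\<And>x. u x = \<phi> (norm x)"
    "\<And>r. (\<phi> has_real_derivative f r) (at r)" "\<And>r. (f has_real_derivative f' r) (at r)"
    "continuous_on UNIV f'" "0 < \<rho>" "\<rho> < R" "\<And>r. r \<ge> \<rho> \<Longrightarrow> f r = 0"
proof -
  obtain e :: 'a where e: "e \<in> Basis" using nonempty_Basis by blast
  have C2: "C_k (Suc (Suc 0)) u" using u(1) by (simp add: test_function_def del: C_k.simps)
  have line: "((\<lambda>r. v (r *\<^sub>R e)) has_real_derivative dir_deriv v e (r *\<^sub>R e)) (at r)"
    if "\<And>x. v differentiable at x" for v :: "'a \<Rightarrow> real" and r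
  proof -
    have v: "(v has_derivative frechet_derivative v (at (r *\<^sub>R e))) (at (r *\<^sub>R e))"
      using that frechet_derivative_works by blast
    have "((\<lambda>r. r *\<^sub>R e) has_derivative (\<lambda>h. h *\<^sub>R e)) (at r)"
      by (intro bounded_linear_imp_has_derivative bounded_linear_scaleR_left)
    from has_derivative_compose[OF this v]
    have "((\<lambda>r. v (r *\<^sub>R e)) has_derivative (\<lambda>h. frechet_derivative v (at (r *\<^sub>R e)) (h *\<^sub>R e))) (at r)" .
    moreover have "(\<lambda>h. frechet_derivative v (at (r *\<^sub>R e)) (h *\<^sub>R e)) = (*) (dir_deriv v e (r *\<^sub>R e))"
      using linear_cmul[OF has_derivative_linear[OF v]] by (auto simp: dir_deriv_def mult.commute)
    ultimately show ?thesis by (simp add: has_field_derivative_def)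
  qed
  define \<phi> where "\<phi> r = u (r *\<^sub>R e)" for r
  define f where "f r = dir_deriv u e (r *\<^sub>R e)" for r
  define f' where "f' r = dir_deriv (dir_deriv u e) e (r *\<^sub>R e)" for r
  have eq: "u x = \<phi> (norm x)" for x
    using u(2) e unfolding radial_def \<phi>_def by (metis abs_norm_cancel norm_Basis mult.right_neutral norm_scaleR)
  have d1: "(\<phi> has_real_derivative f r) (at r)" for r
    unfolding \<phi>_def[abs_def] f_def using C2 by (intro line) simp
  have d2: "(f has_real_derivative f' r) (at r)" for r
    unfolding f_def[abs_def] f'_def using C2 e by (intro line) simp
  have c2: "continuous_on UNIV f'"
  proof -
    have "continuous_on UNIV (dir_deriv (dir_deriv u e) e)" using C2 e by simp
    then show ?thesis unfolding f'_def[abs_def]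
      by (rule continuous_on_compose2) (auto intro!: continuous_intros)
  qed
  have "compact (closure {x. u x \<noteq> 0})" "closure {x. u x \<noteq> 0} \<subseteq> ball 0 R"
    using u(1) bounded_subset[OF bounded_ball, of _ "0::'a" R] by (auto simp: test_function_def compact_eq_bounded_closed)
  then obtain r0 where r0: "r0 < R" "\<And>x. u x \<noteq> 0 \<Longrightarrow> norm x \<le> r0"
  proof (cases "closure {x. u x \<noteq> 0} = {}")
    case True
    then have "\<And>x. u x = 0" by auto
    then show thesis using that[of 0] R by auto
  next
    case False
    obtain x where x: "x \<in> closure {x. u x \<noteq> 0}" "\<And>y. y \<in> closure {x. u x \<noteq> 0} \<Longrightarrow> norm y \<le> norm x"
      using continuous_attains_sup[OF \<open>compact _\<close> False, of norm] by (auto intro: continuous_intros)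
    show thesis
    proof (rule that[of "norm x"])
      show "norm x < R" using x(1) \<open>closure _ \<subseteq> _\<close> by auto
      show "norm y \<le> norm x" if "u y \<noteq> 0" for y
        using that closure_subset[of "{x. u x \<noteq> 0}"] by (intro x(2)) auto
    qed
  qed
  define \<rho> where "\<rho> = (max r0 0 + R) / 2"
  have \<rho>: "0 < \<rho>" "\<rho> < R" "r0 < \<rho>" using r0(1) R by (auto simp: \<rho>_def)
  have "f r = 0" if "r \<ge> \<rho>" for r
  proof -
    have "eventually (\<lambda>s. s \<in> {max r0 0<..}) (nhds r)" using that \<rho> by (intro eventually_nhds_in_open) auto
    then have "eventually (\<lambda>s. \<phi> s = 0) (nhds r)"
    proof eventually_elim
      case (elim s)
      then show ?case using r0(2)[of "s *\<^sub>R e"] e by (auto simp: \<phi>_def)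
    qed
    then have "(\<phi> has_real_derivative 0) (at r)" by (rule DERIV_eventually_eq) simp
    then show ?thesis using d1 DERIV_unique by blast
  qed
  then show thesis using that eq d1 d2 c2 \<rho> by blast
qed

lemma (in radial_hardy) hardy_rellich_inequality:
  assumes dim: "N = real DIM('a::euclidean_space)" and pot: "\<exists>c>0. bessel_ode W R c"
  shows "hardy_rellich_radial TYPE('a) m R W (ennreal C) (bessel_weight W R)"
  unfolding hardy_rellich_radial_def
proof (intro allI impI)
  fix u :: "'a \<Rightarrow> real" assume u: "test_function R u" "radial u"
  obtain \<phi> f f' \<rho> where p: "\<And>x. u x = \<phi> (norm x)"
    "\<And>r. (\<phi> has_real_derivative f r) (at r)" "\<And>r. (f has_real_derivative f' r) (at r)"
    "continuous_on UNIV f'" "0 < \<rho>" "\<rho> < R" "\<And>r. r \<ge> \<rho> \<Longrightarrow> f r = 0"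
    using radial_profile[OF u R] by blast
  have d1: "\<forall>r>0. (\<phi> has_real_derivative f r) (at r)" and d2: "\<forall>r>0. (f has_real_derivative f' r) (at r)"
    using p(2,3) by auto
  have cf': "continuous_on {0<..<R} f'" using p(4) by (rule continuous_on_subset) simp
  have "continuous_on {0..R} f" by (rule DERIV_continuous_on[OF has_field_derivative_at_within[OF p(3)]])
  then have "bounded (f ` {0..R})" by (intro compact_imp_bounded compact_continuous_image) auto
  then obtain M where M: "\<And>r. r \<in> {0<..<R} \<Longrightarrow> \<bar>f r\<bar> \<le> M" unfolding bounded_iff by force
  have "ennreal C * (\<integral>\<^sup>+r\<in>{0<..<R}. ennreal (grd f r) \<partial>lborel) + Sup {ennreal c |c. c > 0 \<and> bessel_ode W R c} * (\<integral>\<^sup>+r\<in>{0<..<R}. ennreal (pot f r) \<partial>lborel)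
    \<le> (\<integral>\<^sup>+r\<in>{0<..<R}. ennreal (lap f f' r) \<partial>lborel)"
  proof (rule add_Sup_mult_ennreal_le)
    show "{ennreal c |c. c > 0 \<and> bessel_ode W R c} \<noteq> {}" using pot by blast
    fix b assume "b \<in> {ennreal c |c. c > 0 \<and> bessel_ode W R c}"
    then obtain c where c: "b = ennreal c" "c > 0" "bessel_ode W R c" by blast
    show "ennreal C * (\<integral>\<^sup>+r\<in>{0<..<R}. ennreal (grd f r) \<partial>lborel) + b * (\<integral>\<^sup>+r\<in>{0<..<R}. ennreal (pot f r) \<partial>lborel)
      \<le> (\<integral>\<^sup>+r\<in>{0<..<R}. ennreal (lap f f' r) \<partial>lborel)"
      unfolding c(1) using hardy_rellich_1d[OF c(3,2) p(3) cf' M p(5,6)] p(7) by simp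
  qed
  then show "ennreal C * (\<integral>\<^sup>+x\<in>ball 0 R. ennreal ((norm (grad u x))\<^sup>2 / norm x powr (2 * m + 2)) \<partial>lborel)
      + bessel_weight W R * (\<integral>\<^sup>+x\<in>ball 0 R. ennreal (W (norm x) * ((norm (grad u x))\<^sup>2 / norm x powr (2 * m))) \<partial>lborel)
      \<le> (\<integral>\<^sup>+x\<in>ball 0 R. ennreal (\<bar>laplacian u x\<bar>\<^sup>2 / norm x powr (2 * m)) \<partial>lborel)"
    unfolding hardy_rellich_iff_1d[OF dim p(1) d1 d2 cf'] bessel_weight_def .
qed

section \<open>From smooth radial functions to compactly supported C^1 profiles\<close>

context radial_hardy
begin

text \<open>The profile is zero outside a compact interval in (0,R), where the weights are bounded.
  All integrals are therefore finite, and the inequality may be rearranged by subtraction in the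
  reals.\<close>

lemma test_function_form_nonneg:
  fixes A B :: real
  assumes dim: "N = real DIM('a::euclidean_space)"
    and H: "hardy_rellich_radial TYPE('a) m R W (ennreal A) (ennreal B)" and AB: "A \<ge> 0" "B \<ge> 0"
    and u: "test_function R (u :: 'a \<Rightarrow> real)" "\<And>x. u x = \<phi> (norm x)"
      "\<And>r. (\<phi> has_real_derivative F r) (at r)" "\<And>r. (F has_real_derivative F' r) (at r)"
      "continuous_on UNIV F'" "\<And>r. r > 0 \<Longrightarrow> r \<notin> {a..b} \<Longrightarrow> F r = 0 \<and> F' r = 0"
    and ab: "0 < a" "b < R"
  shows "0 \<le> integral {a..b} (\<lambda>r. lap F F' r - A * grd F r - B * pot F r)"
proof -
  have sub: "{a..b} \<subseteq> {0<..<R}" using ab by auto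
  have cF: "continuous_on S F" for S
    by (rule DERIV_continuous_on[OF has_field_derivative_at_within[OF u(4)]])
  have cF': "continuous_on S F'" for S using u(5) continuous_on_subset by blast
  have d1: "\<forall>r>0. (\<phi> has_real_derivative F r) (at r)" and d2: "\<forall>r>0. (F has_real_derivative F' r) (at r)"
    using u(3,4) by auto
  have "radial u" unfolding radial_def by (simp add: u(2))
  have c: "continuous_on {a..b} (lap F F')" "continuous_on {a..b} (grd F)" "continuous_on {a..b} (pot F)"
    by (intro cont cF cF' sub)+
  have "ennreal A * (\<integral>\<^sup>+r\<in>{0<..<R}. ennreal (grd F r) \<partial>lborel) + ennreal B * (\<integral>\<^sup>+r\<in>{0<..<R}. ennreal (pot F r) \<partial>lborel)
      \<le> (\<integral>\<^sup>+r\<in>{0<..<R}. ennreal (lap F F' r) \<partial>lborel)"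
    using H[unfolded hardy_rellich_radial_def, rule_format, OF u(1) \<open>radial u\<close>]
    unfolding hardy_rellich_iff_1d[OF dim u(2) d1 d2 cF'] .
  moreover have "(\<integral>\<^sup>+r\<in>{0<..<R}. ennreal (lap F F' r) \<partial>lborel) = ennreal (integral {a..b} (lap F F'))"
    using u(6) by (intro set_nn_integral_Ioo_eq_integral c sub nonneg) (auto simp: lap_def)
  moreover have "(\<integral>\<^sup>+r\<in>{0<..<R}. ennreal (grd F r) \<partial>lborel) = ennreal (integral {a..b} (grd F))"
    using u(6) by (intro set_nn_integral_Ioo_eq_integral c sub nonneg) (auto simp: grd_def)
  moreover have "(\<integral>\<^sup>+r\<in>{0<..<R}. ennreal (pot F r) \<partial>lborel) = ennreal (integral {a..b} (pot F))"
    using u(6) sub by (intro set_nn_integral_Ioo_eq_integral c sub nonneg) (auto simp: pot_def)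
  moreover have i: "lap F F' integrable_on {a..b}" "grd F integrable_on {a..b}" "pot F integrable_on {a..b}"
    using c by (auto intro: integrable_continuous_interval)
  moreover have n: "integral {a..b} (lap F F') \<ge> 0" "integral {a..b} (grd F) \<ge> 0" "integral {a..b} (pot F) \<ge> 0"
    using i sub by (auto intro!: integral_nonneg nonneg)
  ultimately have "A * integral {a..b} (grd F) + B * integral {a..b} (pot F) \<le> integral {a..b} (lap F F')"
    using AB by (simp add: ennreal_mult[symmetric] ennreal_plus[symmetric] del: ennreal_plus)
  moreover have "integral {a..b} (\<lambda>r. lap F F' r - A * grd F r - B * pot F r)
    = integral {a..b} (lap F F') - A * integral {a..b} (grd F) - B * integral {a..b} (pot F)"
    by (intro integral_unique has_integral_diff has_integral_mult_right integrable_integral i)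
  ultimately show ?thesis by simp
qed

text \<open>The form of \<open>f\<close> is the limit of the forms of smooth approximations:
  profiles and derivatives converge uniformly on the fixed interval \<open>{a..b}\<close>, which
  stays away from the singularities of the weights.\<close>

lemma C1_form_nonneg:
  fixes A B :: real
  assumes dim: "N = real DIM('a::euclidean_space)"
    and H: "hardy_rellich_radial TYPE('a) m R W (ennreal A) (ennreal B)" and AB: "A \<ge> 0" "B \<ge> 0"
    and pq: "0 < p" "p < q" "q < R"
    and f: "\<And>r. (f has_real_derivative f' r) (at r)" and f': "continuous_on UNIV f'"
    and z: "\<And>r. r \<notin> {p..q} \<Longrightarrow> f r = 0"
  obtains a b where "0 < a" "a < p" "q < b" "b < R"
    "0 \<le> integral {a..b} (\<lambda>r. lap f f' r - A * grd f r - B * pot f r)"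
proof -
  obtain a b M where ab: "0 < a" "a < p" "q < b" "b < R" "M \<ge> 0" and
    approx: "\<And>\<epsilon>. \<epsilon> > 0 \<Longrightarrow> \<exists>(u :: 'a \<Rightarrow> real) \<phi> F F'. test_function R u \<and> (\<forall>x. u x = \<phi> (norm x)) \<and>
      (\<forall>r. (\<phi> has_real_derivative F r) (at r)) \<and> (\<forall>r. (F has_real_derivative F' r) (at r)) \<and>
      continuous_on UNIV F' \<and> (\<forall>r>0. r \<notin> {a..b} \<longrightarrow> F r = 0 \<and> F' r = 0) \<and>
      (\<forall>r\<in>{a..b}. \<bar>F r - f r\<bar> \<le> M * \<epsilon> \<and> \<bar>F' r - f' r\<bar> \<le> M * \<epsilon>)"
    using radial_test_function_approximation[OF pq f f' z, where 'a = 'a] by metis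
  have sub: "{a..b} \<subseteq> {0<..<R}" using ab by auto
  define P where "P j F F' \<longleftrightarrow> continuous_on {a..b} F \<and> continuous_on {a..b} F' \<and>
      0 \<le> integral {a..b} (\<lambda>r. lap F F' r - A * grd F r - B * pot F r) \<and>
      (\<forall>r\<in>{a..b}. \<bar>F r - f r\<bar> \<le> M * inverse (real (Suc j)) \<and> \<bar>F' r - f' r\<bar> \<le> M * inverse (real (Suc j)))"
    for j :: nat and F F' :: "real \<Rightarrow> real"
  have "\<exists>F F'. P j F F'" for j
  proof -
    have inverse_Suc: "0 < inverse (real (Suc j))" by simp
    obtain u :: "'a \<Rightarrow> real" and \<phi> F F' where u: "test_function R u" "\<And>x. u x = \<phi> (norm x)"
      "\<And>r. (\<phi> has_real_derivative F r) (at r)" "\<And>r. (F has_real_derivative F' r) (at r)"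
      "continuous_on UNIV F'" "\<And>r. r > 0 \<Longrightarrow> r \<notin> {a..b} \<Longrightarrow> F r = 0 \<and> F' r = 0"
      "\<And>r. r \<in> {a..b} \<Longrightarrow> \<bar>F r - f r\<bar> \<le> M * inverse (real (Suc j)) \<and> \<bar>F' r - f' r\<bar> \<le> M * inverse (real (Suc j))"
      using approx[of "inverse (real (Suc j))"] inverse_Suc by blast
    have "continuous_on {a..b} F"
      by (rule DERIV_continuous_on[OF has_field_derivative_at_within[OF u(4)]])
    then have "P j F F'"
      unfolding P_def using test_function_form_nonneg[OF dim H AB u(1-6) ab(1,4)] u(5,7)
        continuous_on_subset[OF u(5) subset_UNIV] by blast
    then show ?thesis by blast
  qed
  then obtain F F' where FF: "\<And>j. P j (F j) (F' j)" by metis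
  have F: "continuous_on {a..b} (F j)" "continuous_on {a..b} (F' j)"
      "0 \<le> integral {a..b} (\<lambda>r. lap (F j) (F' j) r - A * grd (F j) r - B * pot (F j) r)" for j
    using FF[of j] unfolding P_def by auto
  have close: "\<bar>F j r - f r\<bar> \<le> M * inverse (real (Suc j))" "\<bar>F' j r - f' r\<bar> \<le> M * inverse (real (Suc j))"
    if "r \<in> {a..b}" for j r
    using FF[of j] that unfolding P_def by auto
  have lim0: "(\<lambda>j. M * inverse (real (Suc j))) \<longlonglongrightarrow> 0"
    by (intro tendsto_mult_right_zero LIMSEQ_inverse_real_of_nat)
  have lim: "(\<lambda>j. F j r) \<longlonglongrightarrow> f r" "(\<lambda>j. F' j r) \<longlonglongrightarrow> f' r" if "r \<in> {a..b}" for r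
  proof -
    have "(\<lambda>j. F j r - f r) \<longlonglongrightarrow> 0" "(\<lambda>j. F' j r - f' r) \<longlonglongrightarrow> 0"
      using close[OF that] by (auto intro!: Lim_null_comparison[OF _ lim0] always_eventually)
    then show "(\<lambda>j. F j r) \<longlonglongrightarrow> f r" "(\<lambda>j. F' j r) \<longlonglongrightarrow> f' r"
      by (simp_all add: LIM_zero_iff)
  qed
  have cf: "continuous_on {a..b} f" by (rule DERIV_continuous_on[OF has_field_derivative_at_within[OF f]])
  have "compact (f ` {a..b} \<union> f' ` {a..b})"
    using cf continuous_on_subset[OF f'] by (intro compact_Un compact_continuous_image) auto
  then obtain S0 where "\<forall>x\<in>f ` {a..b} \<union> f' ` {a..b}. norm x \<le> S0"
    using compact_imp_bounded[THEN bounded_iff[THEN iffD1]] by fast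
  then have S0: "\<bar>f r\<bar> \<le> S0" "\<bar>f' r\<bar> \<le> S0" if "r \<in> {a..b}" for r using that by auto
  define S where "S = S0 + M"
  have S: "\<bar>F j r\<bar> \<le> S" "\<bar>F' j r\<bar> \<le> S" if "r \<in> {a..b}" for j r
  proof -
    have "M * inverse (real (Suc j)) \<le> M" using ab(5) by (intro mult_left_le) (simp_all add: inverse_le_1_iff)
    then show "\<bar>F j r\<bar> \<le> S" "\<bar>F' j r\<bar> \<le> S"
      using close[OF that, of j] S0[OF that] unfolding S_def by linarith+
  qed
  \<comment> \<open>The dominating function: each term is bounded by replacing \<open>F j\<close>
    and \<open>F' j\<close> with their common bound \<open>S\<close>, where \<open>N \<ge> 1\<close>
    makes the coefficient \<open>(N - 1) / r\<close> non-negative.\<close>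
  define h where "h r = (S + (N - 1) / r * S)\<^sup>2 * r powr \<kappa> + A * (S\<^sup>2 * r powr (\<kappa> - 2)) + B * (W r * S\<^sup>2 * r powr \<kappa>)" for r
  have "(\<lambda>j. integral {a..b} (\<lambda>r. lap (F j) (F' j) r - A * grd (F j) r - B * pot (F j) r))
    \<longlonglongrightarrow> integral {a..b} (\<lambda>r. lap f f' r - A * grd f r - B * pot f r)"
  proof (rule dominated_convergence)
    show "(\<lambda>r. lap (F j) (F' j) r - A * grd (F j) r - B * pot (F j) r) integrable_on {a..b}" for j
      by (intro integrable_continuous_interval continuous_intros cont F sub)
    have cpw: "continuous_on {a..b} (\<lambda>r. r powr e)" for e using ab by (intro continuous_intros) auto
    show "h integrable_on {a..b}"
      unfolding h_def[abs_def] using ab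
      by (intro integrable_continuous_interval continuous_intros cpw continuous_on_subset[OF cont_W sub]) auto
    show "norm (lap (F j) (F' j) r - A * grd (F j) r - B * pot (F j) r) \<le> h r" if r: "r \<in> {a..b}" for j r
    proof -
      have r': "r \<in> {0<..<R}" "r > 0" using sub r by auto
      have sq: "(F j r)\<^sup>2 \<le> S\<^sup>2" using S(1)[OF r] by (rule power2_le_iff_abs_le[THEN iffD2, rotated]) (use S(1)[OF r, of j] in linarith)
      have "\<bar>F' j r + (N - 1) / r * F j r\<bar> \<le> \<bar>F' j r\<bar> + (N - 1) / r * \<bar>F j r\<bar>"
        using N r' by (intro order_trans[OF abs_triangle_ineq]) (simp add: abs_mult)
      also have "\<dots> \<le> S + (N - 1) / r * S" using S[OF r, of j] N r' by (intro add_mono mult_left_mono) auto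
      finally have "(F' j r + (N - 1) / r * F j r)\<^sup>2 \<le> (S + (N - 1) / r * S)\<^sup>2"
        by (metis abs_ge_zero abs_le_square_iff abs_of_nonneg order_trans)
      then have "lap (F j) (F' j) r \<le> (S + (N - 1) / r * S)\<^sup>2 * r powr \<kappa>"
        unfolding lap_def by (intro mult_right_mono) auto
      moreover have "A * grd (F j) r \<le> A * (S\<^sup>2 * r powr (\<kappa> - 2))"
        unfolding grd_def using AB sq by (intro mult_left_mono mult_right_mono) auto
      moreover have "B * pot (F j) r \<le> B * (W r * S\<^sup>2 * r powr \<kappa>)"
        unfolding pot_def using AB sq nonneg_W[OF r'(1)] by (intro mult_left_mono mult_right_mono) auto
      moreover have "0 \<le> lap (F j) (F' j) r" "0 \<le> A * grd (F j) r" "0 \<le> B * pot (F j) r"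
        using nonneg(1,2) nonneg(3)[OF r'(1)] AB by (auto intro!: mult_nonneg_nonneg)
      ultimately show ?thesis unfolding h_def real_norm_def by linarith
    qed
    show "(\<lambda>j. lap (F j) (F' j) r - A * grd (F j) r - B * pot (F j) r) \<longlonglongrightarrow> lap f f' r - A * grd f r - B * pot f r"
      if "r \<in> {a..b}" for r
      unfolding lap_def grd_def pot_def by (intro tendsto_intros lim that)
  qed
  then have "0 \<le> integral {a..b} (\<lambda>r. lap f f' r - A * grd f r - B * pot f r)"
    by (rule LIMSEQ_le_const) (use F(3) in blast)
  then show thesis using that ab by blast
qed

text \<open>The substitution \<open>f = r\<^bsup>-\<alpha>\<^esup> g\<close> removes the weights.\<close>

lemma weighted_hardy_form:
  fixes A B :: real
  assumes dim: "N = real DIM('a::euclidean_space)"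
    and H: "hardy_rellich_radial TYPE('a) m R W (ennreal A) (ennreal B)" and AB: "A \<ge> 0" "B \<ge> 0"
    and pq: "0 < p" "p < q" "q < R"
    and g: "\<And>r. (g has_real_derivative g' r) (at r)" and g': "continuous_on UNIV g'"
    and z: "\<And>r. r \<notin> {p..q} \<Longrightarrow> g r = 0"
  shows "(A - C) * integral {p..q} (\<lambda>r. 1 / r\<^sup>2 * r * (g r)\<^sup>2) + B * integral {p..q} (\<lambda>r. W r * r * (g r)\<^sup>2)
    \<le> integral {p..q} (\<lambda>r. r * (g' r)\<^sup>2)"
proof -
  have gz: "g p = 0" "g q = 0" "g' p = 0" "g' q = 0"
    by (rule C1_zero_outside[OF g g' z]; assumption)+
  have g'z: "g' r = 0" if "r \<notin> {p..q}" for r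
    by (rule C1_zero_outside(5)[OF g g' z that])
  have cg: "continuous_on S g" for S by (rule DERIV_continuous_on[OF has_field_derivative_at_within[OF g]])
  have cg': "continuous_on S g'" for S using g' continuous_on_subset by blast
  define h h' where "h r = r powr (- \<alpha>) * g r" and "h' r = r powr (- \<alpha>) * (g' r - \<alpha> / r * g r)" for r
  define f f' where "f r = (if r \<in> {p..q} then h r else 0)" and "f' r = (if r \<in> {p..q} then h' r else 0)" for r
  have dh: "(h has_real_derivative h' r) (at r)" if "r \<in> {p..q}" for r
  proof -
    have r: "r > 0" using that pq by auto
    have "r powr (- \<alpha> - 1) = r powr (- \<alpha>) / r" using r by (simp add: powr_diff)
    with DERIV_mult[OF has_real_derivative_powr[OF r, of "- \<alpha>"] g] show ?thesis
      unfolding h_def[abs_def] h'_def by (simp add: algebra_simps)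
  qed
  have ch': "continuous_on {p..q} h'"
    unfolding h'_def[abs_def] using pq by (intro continuous_intros cg cg') auto
  have df: "(f has_real_derivative f' r) (at r)" for r
    unfolding f_def[abs_def] f'_def by (rule DERIV_cutoff[OF dh]) (use gz pq in \<open>auto simp: h_def h'_def\<close>)
  have cf': "continuous_on UNIV f'"
    unfolding f'_def[abs_def] by (rule continuous_on_cutoff[OF ch']) (use gz pq in \<open>auto simp: h'_def\<close>)
  have zf: "f r = 0" if "r \<notin> {p..q}" for r using that by (auto simp: f_def)
  obtain a b where ab: "0 < a" "a < p" "q < b" "b < R"
    "0 \<le> integral {a..b} (\<lambda>r. lap f f' r - A * grd f r - B * pot f r)"
    using C1_form_nonneg[OF dim H AB pq df cf' zf] by blast
  have sub: "{a..b} \<subseteq> {0<..<R}" "{p..q} \<subseteq> {a..b}" "{p..q} \<subseteq> {0<..<R}" using ab pq by auto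
  \<comment> \<open>The instance \<open>p = 0\<close>, \<open>v = 0\<close> of
    \<open>hardy_identity\<close>, with the zeros left in place to match it. It splits
    \<open>C * grd f\<close> off \<open>lap f f'\<close> exactly, and \<open>T\<close> vanishes at
    both ends.\<close>
  define T T' where "T r = (f r)\<^sup>2 * r powr (\<kappa> - 1) * (N - 1 - \<alpha> + r * 0)"
    and "T' r = lap f f' r - C * grd f r - 0 * ((f r)\<^sup>2 * r powr \<kappa>) - (f' r + \<alpha> / r * f r - 0 * f r)\<^sup>2 * r powr \<kappa>" for r
  have "(T' has_integral (T b - T a)) {a..b}"
  proof (rule fundamental_theorem_of_calculus)
    fix x assume x: "x \<in> {a..b}"
    have "(T has_real_derivative T' x) (at x)"
      unfolding T_def[abs_def] T'_def by (rule hardy_identity[where p = "\<lambda>_. 0"]) (use x ab df in auto)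
    then show "(T has_vector_derivative T' x) (at x within {a..b})"
      unfolding has_real_derivative_iff_has_vector_derivative[symmetric] by (rule has_field_derivative_at_within)
  qed (use ab pq in simp)
  moreover have "T a = 0" "T b = 0" using ab pq by (auto simp: T_def f_def)
  ultimately have T: "(T' has_integral 0) {a..b}" by simp
  define E1 E2 E3 where "E1 r = r * (g' r)\<^sup>2" and "E2 r = 1 / r\<^sup>2 * r * (g r)\<^sup>2" and "E3 r = W r * r * (g r)\<^sup>2" for r
  have E: "lap f f' r - A * grd f r - B * pot f r = T' r + (E1 r - (A - C) * E2 r - B * E3 r)" if r: "r \<in> {a..b}" for r
  proof (cases "r \<in> {p..q}")
    case True
    have r: "r > 0" using r ab by simp
    \<comment> \<open>Here \<open>\<kappa> - 2 * \<alpha> = 1\<close>, so the weights collapse to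
      those of the planar form.\<close>
    have pw: "(r powr (- \<alpha>))\<^sup>2 * r powr \<kappa> = r" "(r powr (- \<alpha>))\<^sup>2 * r powr (\<kappa> - 2) = 1 / r\<^sup>2 * r"
    proof -
      have "(r powr (- \<alpha>))\<^sup>2 * r powr \<kappa> = r powr (- \<alpha> + - \<alpha> + \<kappa>)"
        by (simp only: power2_eq_square powr_add)
      also have "- \<alpha> + - \<alpha> + \<kappa> = 1" by (simp add: \<alpha>_def \<kappa>_def field_simps)
      finally show 1: "(r powr (- \<alpha>))\<^sup>2 * r powr \<kappa> = r" using r by simp
      have "r powr (\<kappa> - 2) = r powr \<kappa> / r\<^sup>2" using r by (simp add: powr_diff)
      with 1 show "(r powr (- \<alpha>))\<^sup>2 * r powr (\<kappa> - 2) = 1 / r\<^sup>2 * r"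
        by (metis mult.commute times_divide_eq_right mult_1)
    qed
    have fr: "f r = r powr (- \<alpha>) * g r" "f' r + \<alpha> / r * f r = r powr (- \<alpha>) * g' r"
      using True by (simp_all add: f_def f'_def h_def h'_def algebra_simps)
    have e1: "(f' r + \<alpha> / r * f r)\<^sup>2 * r powr \<kappa> = E1 r"
      unfolding fr(2) power_mult_distrib E1_def using pw(1) by (metis mult.assoc mult.commute)
    have e2: "grd f r = E2 r"
      unfolding grd_def fr(1) power_mult_distrib E2_def using pw(2) by (metis mult.assoc mult.commute)
    have e3: "pot f r = E3 r"
      unfolding pot_def fr(1) power_mult_distrib E3_def using pw(1) by (metis mult.assoc mult.commute)
    show ?thesis unfolding T'_def using e1 e2 e3 by (simp add: algebra_simps)
  next
    case False
    then show ?thesis using z[OF False] g'z[OF False]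
      by (auto simp: T'_def lap_def grd_def pot_def f_def f'_def E1_def E2_def E3_def)
  qed
  have cE: "continuous_on S E1" "S \<subseteq> {0<..<R} \<Longrightarrow> continuous_on S E2" "S \<subseteq> {0<..<R} \<Longrightarrow> continuous_on S E3" for S
  proof -
    show "continuous_on S E1" unfolding E1_def[abs_def] by (intro continuous_intros cg')
    assume S: "S \<subseteq> {0<..<R}"
    show "continuous_on S E2" unfolding E2_def[abs_def] using S by (intro continuous_intros cg) auto
    show "continuous_on S E3" unfolding E3_def[abs_def]
      by (intro continuous_intros cg continuous_on_subset[OF cont_W S])
  qed
  have i: "E1 integrable_on {a..b}" "E2 integrable_on {a..b}" "E3 integrable_on {a..b}"
    by (intro integrable_continuous_interval cE sub)+
  have "integral {a..b} (\<lambda>r. lap f f' r - A * grd f r - B * pot f r) = integral {a..b} (\<lambda>r. T' r + (E1 r - (A - C) * E2 r - B * E3 r))"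
    by (rule integral_cong) (rule E)
  also have "\<dots> = integral {a..b} E1 - (A - C) * integral {a..b} E2 - B * integral {a..b} E3"
  proof (rule integral_unique)
    have "((\<lambda>r. T' r + (E1 r - (A - C) * E2 r - B * E3 r)) has_integral
      (0 + (integral {a..b} E1 - (A - C) * integral {a..b} E2 - B * integral {a..b} E3))) {a..b}"
      by (intro has_integral_add T has_integral_diff has_integral_mult_right integrable_integral i)
    then show "((\<lambda>r. T' r + (E1 r - (A - C) * E2 r - B * E3 r)) has_integral
      (integral {a..b} E1 - (A - C) * integral {a..b} E2 - B * integral {a..b} E3)) {a..b}" by simp
  qed
  finally have "(A - C) * integral {a..b} E2 + B * integral {a..b} E3 \<le> integral {a..b} E1"
    using ab(5) by linarith
  moreover have "integral {a..b} E1 = integral {p..q} E1" "integral {a..b} E2 = integral {p..q} E2"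
    "integral {a..b} E3 = integral {p..q} E3"
    by (rule integral_Icc_superset; use cE sub z g'z in \<open>auto simp: E1_def E2_def E3_def\<close>)+
  ultimately show ?thesis unfolding E1_def[abs_def] E2_def[abs_def] E3_def[abs_def] by simp
qed

end

text \<open>An Euler equation, whose solutions such as \<open>cos (sqrt c * ln r)\<close> oscillate
  at 0. Directly: a positive solution is non-increasing, so \<open>y \<ge> y r1\<close> on (0,r1]
  and \<open>z' \<le> - k / r\<close> there. Towards 0 this makes \<open>z\<close> grow at least
  like a logarithm, against \<open>z \<le> 0\<close>.\<close>

lemma no_positive_solution_inverse_square:
  assumes R: "R > 0" and c: "c > 0"
  shows "\<not> (bessel_system (\<lambda>r. 1 / r\<^sup>2) R c y z \<and> (\<forall>r\<in>{0<..<R}. y r > 0))"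
proof
  assume "bessel_system (\<lambda>r. 1 / r\<^sup>2) R c y z \<and> (\<forall>r\<in>{0<..<R}. y r > 0)"
  then have "bessel_system (\<lambda>r. 1 / r\<^sup>2) R c y z" and pos: "\<And>r. r \<in> {0<..<R} \<Longrightarrow> y r > 0" by auto
  interpret bessel_system "\<lambda>r. 1 / r\<^sup>2" R c y z by fact
  have dz': "(z has_real_derivative - (c * y r / r)) (at r)" if "r \<in> {0<..<R}" for r
    by (rule DERIV_cong[OF dz[OF that]]) (use that in \<open>simp add: power2_eq_square\<close>)
  have dzr: "((\<lambda>r. z r / r) has_real_derivative - (c * y r / r) / r - z r / r\<^sup>2) (at r)" if "r \<in> {0<..<R}" for r
    by (rule DERIV_cong[OF DERIV_divide[OF dz'[OF that] DERIV_ident]])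
      (use that in \<open>auto simp: diff_divide_distrib power2_eq_square\<close>)
  have dec: "z r / r \<le> 0" if r: "r \<in> {0<..<R}" for r
  proof (rule bessel_solution_decreasing[OF dy dzr _ pos r])
    fix s assume s: "s \<in> {0<..<R}"
    have "- (c * y s / s) / s - z s / s\<^sup>2 + 1 / s * (z s / s) = - (c * y s / s) / s"
      by (simp add: power2_eq_square)
    also have "\<dots> \<le> 0" using pos[OF s] s c by (simp add: divide_nonpos_pos)
    finally show "- (c * y s / s) / s - z s / s\<^sup>2 + 1 / s * (z s / s) \<le> 0" .
  qed
  define r1 where "r1 = R / 2"
  have r1: "r1 \<in> {0<..<R}" using R by (simp add: r1_def)
  define k where "k = c * y r1"
  have k: "k > 0" using c pos[OF r1] by (simp add: k_def)
  have z1: "z r1 \<le> 0" using dec[OF r1] r1 by (simp add: divide_le_0_iff)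
  \<comment> \<open>Chosen so that the lower bound \<open>z r1 + k * (ln r1 - ln s)\<close> for
    \<open>z s\<close> equals 1.\<close>
  define s where "s = r1 * exp ((z r1 - 1) / k)"
  have s: "0 < s" "s \<le> r1" "ln s = ln r1 + (z r1 - 1) / k"
    using r1 z1 k by (auto simp: s_def ln_mult mult_le_cancel_left1 divide_nonpos_pos)
  have y_ge: "y r \<ge> y r1" if "0 < r" "r \<le> r1" for r
  proof (rule DERIV_nonpos_imp_nonincreasing[OF that(2)])
    fix x assume "r \<le> x" "x \<le> r1"
    then have x: "x \<in> {0<..<R}" using that r1 by auto
    show "\<exists>d. (y has_real_derivative d) (at x) \<and> d \<le> 0" using dy[OF x] dec[OF x] by blast
  qed
  have "z s + k * ln s \<ge> z r1 + k * ln r1"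
  proof (rule DERIV_nonpos_imp_nonincreasing[OF s(2)])
    fix x assume "s \<le> x" "x \<le> r1"
    then have x: "x \<in> {0<..<R}" "0 < x" using s r1 by auto
    have "((\<lambda>x. z x + k * ln x) has_real_derivative - (c * y x / x) + k * (1 / x)) (at x)"
      by (rule DERIV_add[OF dz'[OF x(1)] DERIV_cmult[OF DERIV_ln_divide[OF x(2)]]])
    moreover have "- (c * y x / x) + k * (1 / x) \<le> 0"
      using y_ge[OF x(2) \<open>x \<le> r1\<close>] x c by (simp add: k_def divide_right_mono)
    ultimately show "\<exists>d. ((\<lambda>x. z x + k * ln x) has_real_derivative d) (at x) \<and> d \<le> 0" by blast
  qed
  then have "z s \<ge> 1" using s(3) k by (simp add: distrib_left)
  then have "z s / s > 0" using s by simp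
  moreover have "s \<in> {0<..<R}" using s r1 by auto
  ultimately show False using dec by force
qed

lemma hardy_rellich_radial_mono:
  assumes "hardy_rellich_radial TYPE('a::euclidean_space) m R W A B" "A' \<le> A" "B' \<le> B"
  shows "hardy_rellich_radial TYPE('a) m R W A' B'"
  unfolding hardy_rellich_radial_def
proof (intro allI impI)
  fix u :: "'a \<Rightarrow> real" assume u: "test_function R u" "radial u"
  show "A' * (\<integral>\<^sup>+x\<in>ball 0 R. ennreal ((norm (grad u x))\<^sup>2 / norm x powr (2 * m + 2)) \<partial>lborel)
          + B' * (\<integral>\<^sup>+x\<in>ball 0 R. ennreal (W (norm x) * ((norm (grad u x))\<^sup>2 / norm x powr (2 * m))) \<partial>lborel)
        \<le> (\<integral>\<^sup>+x\<in>ball 0 R. ennreal (\<bar>laplacian u x\<bar>\<^sup>2 / norm x powr (2 * m)) \<partial>lborel)"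
    by (rule order_trans[OF add_mono[OF mult_right_mono[OF assms(2)] mult_right_mono[OF assms(3)]]
          assms(1)[unfolded hardy_rellich_radial_def, rule_format, OF u]]) simp_all
qed

section \<open>Optimality of the two constants\<close>

context radial_hardy
begin

text \<open>Lowering \<open>B\<close> to 0 removes the potential, and a real \<open>A'\<close> with
  \<open>C < A' \<le> A\<close> covers infinite \<open>A\<close>. What remains is a Hardy inequality
  for the inverse square with the positive constant \<open>A' - C\<close>; half of it is strictly
  smaller and so would admit a positive solution.\<close>

lemma gradient_constant_sharp:
  assumes dim: "N = real DIM('a::euclidean_space)" and A: "A > ennreal C"
  shows "\<not> hardy_rellich_radial TYPE('a) m R W A B"
proof
  assume H: "hardy_rellich_radial TYPE('a) m R W A B"
  have C: "C \<ge> 0" by (simp add: C_def)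
  obtain A' where A': "C < A'" "ennreal A' \<le> A"
  proof -
    obtain x where x: "ennreal C < x" "x < A" using dense[OF A] by blast
    then have "x \<noteq> top" using top.not_eq_extremum by fastforce
    then obtain a where "x = ennreal a" by (metis ennreal_cases)
    then show thesis using that[of a] x C by (simp add: ennreal_less_iff)
  qed
  have "hardy_form (\<lambda>r. 1 / r\<^sup>2) R (A' - C)"
    unfolding hardy_form_def
    using weighted_hardy_form[OF dim hardy_rellich_radial_mono[OF H A'(2), of "ennreal 0"]] C A' by simp
  then obtain y z where "bessel_system (\<lambda>r. 1 / r\<^sup>2) R ((A' - C) / 2) y z" "\<And>r. r \<in> {0<..<R} \<Longrightarrow> y r > 0"
  proof (rule positive_solution[OF R, rotated 2])
    show "continuous_on {0<..<R} (\<lambda>r. 1 / r\<^sup>2)" by (intro continuous_intros) auto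
  qed (use A' in auto)
  then show False
    using no_positive_solution_inverse_square[OF R, of "(A' - C) / 2" y z] A' by auto
qed

text \<open>With the gradient constant equal to \<open>C\<close> the inverse-square term disappears.
  Two finite values \<open>c < b\<close> are placed between the weight and \<open>B\<close>: the
  Hardy inequality holds at \<open>b\<close>, and the strictly smaller \<open>c\<close> then admits
  a positive solution although it exceeds the supremum of all such numbers.\<close>

lemma potential_constant_sharp:
  assumes dim: "N = real DIM('a::euclidean_space)" and B: "B > bessel_weight W R"
  shows "\<not> hardy_rellich_radial TYPE('a) m R W (ennreal C) B"
proof
  assume H: "hardy_rellich_radial TYPE('a) m R W (ennreal C) B"
  have C: "C \<ge> 0" by (simp add: C_def)
  obtain x where x: "bessel_weight W R < x" "x < B" using dense[OF B] by blast
  obtain x' where x': "bessel_weight W R < x'" "x' < x" using dense[OF x(1)] by blast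
  have "x \<noteq> top" "x' \<noteq> top" using x x' top.not_eq_extremum by fastforce+
  then obtain b c where bc: "x = ennreal b" "b \<ge> 0" "x' = ennreal c" "c \<ge> 0" by (metis ennreal_cases)
  have "c < b" using x' bc by (simp add: ennreal_less_iff)
  have "c \<noteq> 0" using x'(1) bc by auto
  then have "c > 0" using bc by simp
  have "hardy_form W R b"
    unfolding hardy_form_def
    using weighted_hardy_form[OF dim hardy_rellich_radial_mono[OF H order_refl, of "ennreal b"]] C bc x by simp
  then obtain y z where "bessel_system W R c y z" "\<And>r. r \<in> {0<..<R} \<Longrightarrow> y r > 0"
    using positive_solution[OF R cont_W nonneg_W _ \<open>c > 0\<close> \<open>c < b\<close>] by blast
  then have "bessel_ode W R c" by (rule bessel_ode_of_system)
  then have "ennreal c \<le> bessel_weight W R"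
    unfolding bessel_weight_def using \<open>c > 0\<close> by (intro Sup_upper) blast
  then show False using x' bc by simp
qed

end

text \<open>If \<open>W\<close> vanishes on (0,R), every \<open>c > 0\<close> has the positive
  solution 1 and the weight is infinite. The potential term is then infinity times zero, which is
  zero, and no larger \<open>B\<close> exists.\<close>

theorem corollary3p2:
  fixes n :: nat and m R :: real and W :: "real \<Rightarrow> real"
  assumes "n = DIM('a::euclidean_space)"
    and "n \<ge> 1"
    and "m < (real n - 2) / 2"
    and "R > 0"
    and "bessel_potential W R"
  shows "hardy_rellich_radial TYPE('a) m R W (ennreal (((real n + 2 * m) / 2)\<^sup>2)) (bessel_weight W R) \<and>
         (\<forall>A > ennreal (((real n + 2 * m) / 2)\<^sup>2).
            \<not> hardy_rellich_radial TYPE('a) m R W A (bessel_weight W R)) \<and>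
         (\<forall>B > bessel_weight W R.
            \<not> hardy_rellich_radial TYPE('a) m R W (ennreal (((real n + 2 * m) / 2)\<^sup>2)) B)"
proof -
  have "continuous_on {0<..<R} W"
    using assms(5) C1_differentiable_imp_continuous_on by (auto simp: bessel_potential_def)
  then interpret radial_hardy "real n" m R W
    using assms by unfold_locales (auto simp: bessel_potential_def)
  have dim: "real n = real DIM('a)" using assms(1) by simp
  have "\<exists>c>0. bessel_ode W R c" using assms(5) by (simp add: bessel_potential_def)
  then show ?thesis
    using hardy_rellich_inequality[OF dim] gradient_constant_sharp[OF dim] potential_constant_sharp[OF dim]
    unfolding C_def by blast
qed

end
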